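(* Let $Q(x,y,z)$ be a non-degenerate complex quadratic form. (1) The space $V(d)$ of complex homogeneous polynomials of degree $d$ admits an $O_Q(3;\mathbb C)$-invariant decomposition $$V(d)=\bigoplus_{d-2k\ge0}Q^k\cdot Har_Q(d-2k).$$ The summands are orthogonal with respect to the Hermitian inner product $\langle f,g\rangle=\int_{\Upsilon_Q}f\cdot\bar g\,dm_Q$. In particular, the homogeneous polynomials $P\in Har_Q(d)$ (the solutions of $\Delta_Q(P)=0$) are characterized among elements of $V(d)$ by the property: $\int_{\Upsilon_Q}P\cdot\bar T\,dm_Q=0$ for each $T\in V_Q(d)$. (2) Any polynomial function $F$ on the surface $\mathcal S=\{Q(x,y,z)=const\}$ can be obtained by restricting to $\mathcal S$ a (not necessarily homogeneous) polynomial $P\in Ker(\Delta_Q)$. (3) For any two polynomials $M$ and $N$, the complex Dirichlet problem $$\Delta_Q(P)=M,\qquad P|_{\mathcal S}=N|_{\mathcal S}$$ has a unique polynomial solution $P$. (4) Any homogeneous polynomial $P$ of degree $d$ admits a Maxwell-type representation $$P(x,y,z)=\sum_{d-2k\ge0}Q(x,y,z)^{d-k+\frac12}\cdot\nabla_{\mathbf u_{1,k}}\nabla_{\mathbf u_{2,k}}\cdots\nabla_{\mathbf u_{d-2k,k}}\Big(Q(x,y,z)^{-\frac12}\Big)$$ with vectors $\mathbf u_{j,k}\in\mathbb C^3$, where for even $d$ the term with $k=d/2$ is understood as $\lambda\,Q^{d/2}$ with some $\lambda\in\mathbb C$.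
   Context: Write $Q(v)=vBv^T$ for row vectors $v=(x,y,z)$, with $B$ symmetric invertible, and choose an invertible complex matrix $A$ with $B=AA^T$, so that $Q(v)=x'^2+y'^2+z'^2$ for $(x',y',z')=vA$. $\Delta_Q=\sum_{j,k}b^{jk}\partial_j\partial_k$, where $(b^{jk})=B^{-1}$, acts on polynomials in $x,y,z$. $Har_Q(d)=Ker(\Delta_Q)\cap V(d)$. $V_Q(d)\subset V(d)$ is the subspace of polynomials divisible by $Q$. $O_Q(3;\mathbb C)\subset GL(3;\mathbb C)$ is the group of linear transformations preserving $Q$ (matrices $U$ with $UBU^T=B$), acting on polynomials by substitution. $\Upsilon_Q=\{v\in\mathbb C^3: vA\in\mathbb R^3,\ |vA|=1\}$ is the image of the real unit sphere under $A^{-1}$, a totally real surface in $\{Q=1\}$; $dm_Q$ is the pull-back under $v\mapsto vA$ of the standard rotation-invariant measure on the unit sphere. $\nabla_{\mathbf u}$ is the directional derivative along $\mathbf u\in\mathbb C^3$; the same branch of $Q^{1/2}$ is used in both occurrences, so the choice of sign cancels. *)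

theory Defs
  imports "HOL-Analysis.Analysis" "HOL-Library.Function_Algebras"
begin

text \<open>
  Polynomials in \<open>x, y, z\<close> over the complex numbers are represented by the polynomial functions
  they induce on \<^typ>\<open>complex^3\<close>; since the field is infinite, this loses no information.
  Vectors are row vectors, so matrices act from the right through \<^const>\<open>vector_matrix_mult\<close>.
\<close>

definition cscale :: "complex \<Rightarrow> (complex^3 \<Rightarrow> complex) \<Rightarrow> complex^3 \<Rightarrow> complex" where
  "cscale a f = (\<lambda>v. a * f v)"

interpretation cfun: vector_space cscale
  by unfold_locales (auto simp: cscale_def fun_eq_iff algebra_simps)

definition xyz_monomial :: "nat \<Rightarrow> nat \<Rightarrow> nat \<Rightarrow> complex^3 \<Rightarrow> complex" where
  "xyz_monomial a b c = (\<lambda>v. (v $ 1) ^ a * (v $ 2) ^ b * (v $ 3) ^ c)"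

definition polys :: "(complex^3 \<Rightarrow> complex) set" where
  "polys = cfun.span {xyz_monomial a b c | a b c. True}"

definition hom_polys :: "nat \<Rightarrow> (complex^3 \<Rightarrow> complex) set" where
  "hom_polys d = cfun.span {xyz_monomial a b c | a b c. a + b + c = d}"

definition poly_function_on :: "(complex^3) set \<Rightarrow> (complex^3 \<Rightarrow> complex) \<Rightarrow> bool" where
  "poly_function_on S F \<longleftrightarrow> (\<exists>G\<in>polys. \<forall>v\<in>S. F v = G v)"

definition qform :: "complex^3^3 \<Rightarrow> complex^3 \<Rightarrow> complex" where
  "qform B v = (\<Sum>j\<in>UNIV. (v v* B) $ j * v $ j)"

definition level_set :: "complex^3^3 \<Rightarrow> complex \<Rightarrow> (complex^3) set" where
  "level_set B c = {v. qform B v = c}"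

definition dir_deriv :: "complex^3 \<Rightarrow> (complex^3 \<Rightarrow> complex) \<Rightarrow> complex^3 \<Rightarrow> complex" where
  "dir_deriv u f v = deriv (\<lambda>t. f (v + t *s u)) 0"

definition laplacian :: "complex^3^3 \<Rightarrow> (complex^3 \<Rightarrow> complex) \<Rightarrow> complex^3 \<Rightarrow> complex" where
  "laplacian B f v =
     (\<Sum>j\<in>UNIV. \<Sum>k\<in>UNIV.
        matrix_inv B $ j $ k * dir_deriv (axis j 1) (dir_deriv (axis k 1) f) v)"

definition harmonics :: "complex^3^3 \<Rightarrow> nat \<Rightarrow> (complex^3 \<Rightarrow> complex) set" where
  "harmonics B d = {f \<in> hom_polys d. laplacian B f = 0}"

definition qpow_harmonics :: "complex^3^3 \<Rightarrow> nat \<Rightarrow> nat \<Rightarrow> (complex^3 \<Rightarrow> complex) set" where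
  "qpow_harmonics B d k = (\<lambda>h v. qform B v ^ k * h v) ` harmonics B (d - 2 * k)"

definition q_multiples :: "complex^3^3 \<Rightarrow> nat \<Rightarrow> (complex^3 \<Rightarrow> complex) set" where
  "q_multiples B d = {f \<in> hom_polys d. \<exists>g\<in>polys. \<forall>v. f v = qform B v * g v}"

definition orth_group :: "complex^3^3 \<Rightarrow> (complex^3^3) set" where
  "orth_group B = {U. invertible U \<and> U ** B ** transpose U = B}"

definition invariant_under :: "(complex^3^3) set \<Rightarrow> (complex^3 \<Rightarrow> complex) set \<Rightarrow> bool" where
  "invariant_under G W \<longleftrightarrow> (\<forall>U\<in>G. \<forall>f\<in>W. (\<lambda>v. f (v v* U)) \<in> W)"

definition internal_direct_sum ::
    "nat set \<Rightarrow> (nat \<Rightarrow> (complex^3 \<Rightarrow> complex) set) \<Rightarrow> (complex^3 \<Rightarrow> complex) set \<Rightarrow> bool" where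
  "internal_direct_sum K W V \<longleftrightarrow>
     (\<forall>k\<in>K. cfun.subspace (W k)) \<and>
     V = {\<Sum>k\<in>K. h k | h. \<forall>k\<in>K. h k \<in> W k} \<and>
     (\<forall>h. (\<forall>k\<in>K. h k \<in> W k) \<and> (\<Sum>k\<in>K. h k) = 0 \<longrightarrow> (\<forall>k\<in>K. h k = 0))"

text \<open>
  The rotation-invariant surface measure of the unit sphere (total mass \<open>4\<pi>\<close>), as a measure on
  \<^typ>\<open>real^3\<close>: the area of a patch is three times the volume of the solid cone over it, and
  \<^const>\<open>sgn\<close> is the radial projection \<open>x \<mapsto> x / |x|\<close>.
\<close>

definition sphere_measure :: "(real^3) measure" where
  "sphere_measure = scale_measure 3 (distr (restrict_space lborel (cball 0 1)) borel sgn)"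

definition real_form_sphere :: "complex^3^3 \<Rightarrow> (complex^3) set" where
  "real_form_sphere A = {v. (\<forall>i. (v v* A) $ i \<in> \<real>) \<and> norm (v v* A) = 1}"

text \<open>
  The map \<open>v \<mapsto> vA\<close> is a bijection from \<^term>\<open>real_form_sphere A\<close> onto the real unit sphere, so the
  pull-back of the surface measure is its image under the inverse map.
\<close>

definition real_form_measure :: "complex^3^3 \<Rightarrow> (complex^3) measure" where
  "real_form_measure A =
     distr sphere_measure borel (\<lambda>x. (\<chi> i. complex_of_real (x $ i)) v* matrix_inv A)"

definition herm_prod ::
    "complex^3^3 \<Rightarrow> (complex^3 \<Rightarrow> complex) \<Rightarrow> (complex^3 \<Rightarrow> complex) \<Rightarrow> complex" where
  "herm_prod A f g = (LINT v:real_form_sphere A|real_form_measure A. f v * cnj (g v))"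

definition hermitian_inner_product_on ::
    "(complex^3 \<Rightarrow> complex) set
      \<Rightarrow> ((complex^3 \<Rightarrow> complex) \<Rightarrow> (complex^3 \<Rightarrow> complex) \<Rightarrow> complex) \<Rightarrow> bool" where
  "hermitian_inner_product_on V ip \<longleftrightarrow>
     (\<forall>f\<in>V. \<forall>g\<in>V. \<forall>h\<in>V. ip (f + g) h = ip f h + ip g h) \<and>
     (\<forall>a. \<forall>f\<in>V. \<forall>g\<in>V. ip (cscale a f) g = a * ip f g) \<and>
     (\<forall>f\<in>V. \<forall>g\<in>V. ip g f = cnj (ip f g)) \<and>
     (\<forall>f\<in>V. f \<noteq> 0 \<longrightarrow> 0 < Re (ip f f))"

text \<open>
  The square root of a quadratic form has no global branch on the complement of its zero set;
  \<open>s\<close> is a branch of it on the open set \<open>W\<close>. Being continuous, it is automatically holomorphic.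
\<close>

definition sqrt_branch ::
    "complex^3^3 \<Rightarrow> (complex^3) set \<Rightarrow> (complex^3 \<Rightarrow> complex) \<Rightarrow> bool" where
  "sqrt_branch B W s \<longleftrightarrow>
     open W \<and> continuous_on W s \<and> (\<forall>v\<in>W. qform B v \<noteq> 0 \<and> s v ^ 2 = qform B v)"

text \<open>\<open>\<nabla>\<^bsub>u 1\<^esub> \<dots> \<nabla>\<^bsub>u m\<^esub> f\<close>\<close>

definition iter_dir_deriv ::
    "(nat \<Rightarrow> complex^3) \<Rightarrow> nat \<Rightarrow> (complex^3 \<Rightarrow> complex) \<Rightarrow> complex^3 \<Rightarrow> complex" where
  "iter_dir_deriv u m f = foldr (\<lambda>j. dir_deriv (u j)) [1..<Suc m] f"

end

theory Submission
  imports Defs "HOL-Computational_Algebra.Fundamental_Theorem_Algebra"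
begin

text \<open>
  Write \<open>lap\<close> for \<open>\<Delta>\<^sub>Q\<close>. Everything algebraic follows from one formula: for \<open>f\<close> homogeneous of
  degree \<open>d\<close>,
  \<open>lap (Q f) = (6 + 4 d) f + Q (lap f)\<close>  (\<open>laplacian_qform_mult\<close>).
  All the numbers \<open>6 + 4 d\<close> are positive, so an induction that lowers the degree by two shows
  that \<open>f \<mapsto> lap (Q f) + c f\<close> is bijective on the forms of degree \<open>d\<close> for each natural \<open>c\<close>
  (\<open>laplacian_qform_mult_inj\<close>, \<open>laplacian_qform_mult_surj\<close>). For \<open>c = 0\<close> this says that every form
  is, in a unique way, a harmonic form plus \<open>Q\<close> times a form; iteration gives the decomposition.
  It is invariant because an orthogonal substitution commutes with \<open>lap\<close>.

  For the Dirichlet problem look for \<open>P = N + (Q - c) G\<close>. This is the general shape of a solution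
  of the boundary condition, since a polynomial vanishing on \<open>{Q = c}\<close> is divisible by \<open>Q - c\<close>
  (\<open>quadric_divides\<close>). The map \<open>G \<mapsto> lap ((Q - c) G)\<close> has the bijection \<open>g \<mapsto> lap (Q g)\<close> as its
  leading part, hence is itself bijective on polynomials. Taking \<open>lap P = 0\<close> yields the harmonic
  extension of a polynomial function on the surface.

  For the Maxwell representation, differentiating \<open>Q\<^sup>-\<^sup>1\<^sup>/\<^sup>2\<close> along \<open>u\<^sub>1, \<dots>, u\<^sub>m\<close> produces
  \<open>H / Q ^ (m + 1/2)\<close> with a harmonic form \<open>H\<close> of degree \<open>m\<close> that agrees on the cone \<open>{Q = 0}\<close>
  with a nonzero constant times the product of the linear forms \<open>\<langle>u\<^sub>j, \<cdot>\<rangle>\<close>. The cone is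
  parametrized by binary quadratic forms, so on it every form of degree \<open>m\<close> is a binary form of
  degree \<open>2 m\<close> and splits into \<open>2 m\<close> linear factors; in pairs, these are \<open>m\<close> linear forms in three
  variables. As a harmonic form is determined by its values on the cone, every harmonic form is
  such an \<open>H\<close> (\<open>sylvester\<close>).

  For orthogonality pass to \<open>Q = x\<^sup>2 + y\<^sup>2 + z\<^sup>2\<close> by the substitution \<open>v = w A\<^sup>-\<^sup>1\<close>. Rotation invariance
  of the sphere measure gives \<open>(d + 2) \<integral> v\<^sub>i f = \<integral> \<partial>\<^sub>i f\<close> for forms \<open>f\<close> of degree \<open>d\<close>
  (\<open>sphere_int_coord_mult\<close>). With Euler's identity, for harmonic \<open>h\<close>, \<open>g\<close> of degrees \<open>m\<close>, \<open>n\<close> both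
  \<open>m (m + n + 1) \<integral> h g\<close> and \<open>n (m + n + 1) \<integral> h g\<close> are equal to \<open>\<integral> \<nabla>h \<cdot> \<nabla>g\<close>, so that \<open>\<integral> h g = 0\<close>
  for \<open>m \<noteq> n\<close>.
\<close>

section \<open>Polynomial functions\<close>

lemma cscale_plus: "cscale c f + g = (\<lambda>v. c * f v + g v)"
  by (simp add: cscale_def plus_fun_def)

lemma sum_fun_apply: "(\<Sum>k\<in>K. h k) v = (\<Sum>k\<in>K. h k (v :: complex^3) :: complex)"
  by (induction K rule: infinite_finite_induct) auto

lemma polys_scale: "f \<in> polys \<Longrightarrow> (\<lambda>v. c * f v) \<in> polys"
  using cfun.span_scale[of f _ c] by (simp add: polys_def cscale_def)

lemma polys_add: "f \<in> polys \<Longrightarrow> g \<in> polys \<Longrightarrow> (\<lambda>v. f v + g v) \<in> polys"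
  using cfun.span_add[of f _ g] by (simp add: polys_def plus_fun_def)

lemma xyz_monomial_in_polys: "xyz_monomial a b c \<in> polys"
  unfolding polys_def by (rule cfun.span_base) blast

lemma xyz_monomial_mult:
  "xyz_monomial a b c v * xyz_monomial a' b' c' v = xyz_monomial (a + a') (b + b') (c + c') v"
  by (simp add: xyz_monomial_def power_add)

lemma polys_const: "(\<lambda>v. c) \<in> polys"
  using polys_scale[OF xyz_monomial_in_polys[of 0 0 0], of c] by (simp add: xyz_monomial_def)

lemma polys_coord: "(\<lambda>v. v $ i) \<in> polys"
  using exhaust_3[of i] xyz_monomial_in_polys[of 1 0 0] xyz_monomial_in_polys[of 0 1 0]
    xyz_monomial_in_polys[of 0 0 1]
  by (auto simp: xyz_monomial_def)

text \<open>Bilinearity of multiplication, in the form needed for monomials and for weight vectors.\<close>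

lemma span_mult_closed:
  assumes "f \<in> cfun.span S" "g \<in> cfun.span T"
    and "\<And>a b. a \<in> S \<Longrightarrow> b \<in> T \<Longrightarrow> (\<lambda>v. a v * b v) \<in> cfun.span R"
  shows "(\<lambda>v. f v * g v) \<in> cfun.span R"
  using assms(1)
proof (induction rule: cfun.span_induct_alt)
  case base
  show ?case using cfun.span_zero[of R] by (simp add: zero_fun_def)
next
  case (step c a f)
  have "(\<lambda>v. a v * g v) \<in> cfun.span R"
    using assms(2)
  proof (induction rule: cfun.span_induct_alt)
    case base
    show ?case using cfun.span_zero[of R] by (simp add: zero_fun_def)
  next
    case (step e b g)
    have "cscale e (\<lambda>v. a v * b v) + (\<lambda>v. a v * g v) \<in> cfun.span R"
      using step assms(3) \<open>a \<in> S\<close> by (intro cfun.span_add cfun.span_scale) auto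
    moreover have "(\<lambda>v. a v * (cscale e b + g) v) = cscale e (\<lambda>v. a v * b v) + (\<lambda>v. a v * g v)"
      by (simp add: fun_eq_iff cscale_def algebra_simps)
    ultimately show ?case by simp
  qed
  then have "cscale c (\<lambda>v. a v * g v) + (\<lambda>v. f v * g v) \<in> cfun.span R"
    using step by (intro cfun.span_add cfun.span_scale) auto
  moreover have "(\<lambda>v. (cscale c a + f) v * g v) = cscale c (\<lambda>v. a v * g v) + (\<lambda>v. f v * g v)"
    by (simp add: fun_eq_iff cscale_def algebra_simps)
  ultimately show ?case by simp
qed

lemma polys_mult: "f \<in> polys \<Longrightarrow> g \<in> polys \<Longrightarrow> (\<lambda>v. f v * g v) \<in> polys"
  unfolding polys_def
  by (rule span_mult_closed)
    (auto intro!: cfun.span_base simp: xyz_monomial_mult, blast)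

lemma polys_diff: "f \<in> polys \<Longrightarrow> g \<in> polys \<Longrightarrow> (\<lambda>v. f v - g v) \<in> polys"
  using polys_add[of f "\<lambda>v. - 1 * g v"] polys_scale[of g "- 1"] by simp

lemma polys_sum: "(\<And>i. i \<in> I \<Longrightarrow> f i \<in> polys) \<Longrightarrow> (\<lambda>v. \<Sum>i\<in>I. f i v) \<in> polys"
  by (induction I rule: infinite_finite_induct) (auto intro: polys_const polys_add)

lemma polys_power: "f \<in> polys \<Longrightarrow> (\<lambda>v. f v ^ n) \<in> polys"
  by (induction n) (auto intro: polys_const polys_mult)

lemmas polys_intros = polys_const polys_coord polys_add polys_diff polys_mult polys_scale
  polys_sum polys_power

text \<open>Identities between derivations, substitutions and the like are checked on constants and
  coordinates; this rule turns that into a proof for all polynomials.\<close>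

lemma polys_induct [consumes 1, case_names const coord add mult]:
  assumes f: "f \<in> polys"
    and const: "\<And>c. P (\<lambda>v. c)"
    and coord: "\<And>i. P (\<lambda>v. v $ i)"
    and add: "\<And>f g. f \<in> polys \<Longrightarrow> g \<in> polys \<Longrightarrow> P f \<Longrightarrow> P g \<Longrightarrow> P (\<lambda>v. f v + g v)"
    and mult: "\<And>f g. f \<in> polys \<Longrightarrow> g \<in> polys \<Longrightarrow> P f \<Longrightarrow> P g \<Longrightarrow> P (\<lambda>v. f v * g v)"
  shows "P f"
proof -
  have pow: "P (\<lambda>v. (v $ i) ^ n)" for i n
    by (induction n) (auto intro!: const mult coord polys_intros)
  have mon: "P (xyz_monomial a b c)" for a b c
    unfolding xyz_monomial_def by (intro mult pow polys_intros)
  have "f \<in> polys \<and> P f"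
    using f unfolding polys_def
  proof (induction rule: cfun.span_induct_alt)
    case base
    show ?case using const[of 0] cfun.span_zero by (simp add: zero_fun_def)
  next
    case (step c x y)
    have x: "x \<in> polys" "P x" and y: "y \<in> polys" "P y"
      using step mon xyz_monomial_in_polys by (auto simp: polys_def)
    have "P (\<lambda>v. c * x v + y v)"
      by (intro add mult const x y polys_intros)
    moreover have "(\<lambda>v. c * x v + y v) \<in> polys"
      by (intro x y polys_intros)
    ultimately show ?case unfolding polys_def cscale_plus by simp
  qed
  then show ?thesis ..
qed

lemma polys_linear_subst: "f \<in> polys \<Longrightarrow> (\<lambda>v. f (v v* U)) \<in> polys"
  by (induction rule: polys_induct) (auto simp: vector_matrix_mult_def intro!: polys_intros)

lemma polys_continuous: "f \<in> polys \<Longrightarrow> continuous_on S f"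
  by (induction rule: polys_induct) (auto intro!: continuous_intros)

section \<open>Homogeneous components\<close>

lemma hom_polys_scale: "f \<in> hom_polys d \<Longrightarrow> (\<lambda>v. c * f v) \<in> hom_polys d"
  using cfun.span_scale[of f _ c] by (simp add: hom_polys_def cscale_def)

lemma hom_polys_add: "f \<in> hom_polys d \<Longrightarrow> g \<in> hom_polys d \<Longrightarrow> (\<lambda>v. f v + g v) \<in> hom_polys d"
  using cfun.span_add[of f _ g] by (simp add: hom_polys_def plus_fun_def)

lemma hom_polys_zero: "(\<lambda>v. 0) \<in> hom_polys d"
  using cfun.span_zero by (simp add: hom_polys_def zero_fun_def)

lemma hom_polys_diff: "f \<in> hom_polys d \<Longrightarrow> g \<in> hom_polys d \<Longrightarrow> (\<lambda>v. f v - g v) \<in> hom_polys d"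
  using hom_polys_add[of f d "\<lambda>v. - 1 * g v"] hom_polys_scale[of g d "- 1"] by simp

lemma hom_polys_sum:
  "(\<And>i. i \<in> I \<Longrightarrow> f i \<in> hom_polys d) \<Longrightarrow> (\<lambda>v. \<Sum>i\<in>I. f i v) \<in> hom_polys d"
  by (induction I rule: infinite_finite_induct) (auto intro: hom_polys_zero hom_polys_add)

lemma hom_polys_imp_polys: "f \<in> hom_polys d \<Longrightarrow> f \<in> polys"
  unfolding hom_polys_def polys_def by (erule rev_subsetD[OF _ cfun.span_mono]) auto

lemma hom_polysD: "f \<in> hom_polys d \<Longrightarrow> f (c *s v) = c ^ d * f v"
  unfolding hom_polys_def
  by (induction rule: cfun.span_induct_alt)
    (auto simp: cscale_def xyz_monomial_def power_mult_distrib power_add algebra_simps)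

text \<open>\<open>deg_less n\<close> is the space of polynomials of degree below \<open>n\<close>, presented by homogeneous
  components. With a strict bound the filtration starts from the zero space at \<open>n = 0\<close>.\<close>

definition deg_less :: "nat \<Rightarrow> (complex^3 \<Rightarrow> complex) set" where
  "deg_less n = {f. \<exists>g. (\<forall>d. g d \<in> hom_polys d) \<and> (\<forall>v. f v = (\<Sum>d<n. g d v))}"

lemma deg_less_zero: "(\<lambda>v. 0) \<in> deg_less n"
  unfolding deg_less_def by (auto intro!: exI[of _ "\<lambda>d v. 0"] hom_polys_zero)

lemma deg_less_0_iff: "f \<in> deg_less 0 \<longleftrightarrow> f = (\<lambda>v. 0)"
  unfolding deg_less_def by (auto intro!: exI[of _ "\<lambda>d v. 0"] hom_polys_zero)

lemma deg_less_add:
  assumes "f \<in> deg_less n" "g \<in> deg_less n"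
  shows "(\<lambda>v. f v + g v) \<in> deg_less n"
proof -
  obtain f' g' where "\<forall>d. f' d \<in> hom_polys d" "\<forall>v. f v = (\<Sum>d<n. f' d v)"
    "\<forall>d. g' d \<in> hom_polys d" "\<forall>v. g v = (\<Sum>d<n. g' d v)"
    using assms unfolding deg_less_def by blast
  then show ?thesis
    unfolding deg_less_def
    by (auto intro!: exI[of _ "\<lambda>d v. f' d v + g' d v"] hom_polys_add simp: sum.distrib)
qed

lemma deg_less_scale:
  assumes "f \<in> deg_less n"
  shows "(\<lambda>v. c * f v) \<in> deg_less n"
proof -
  obtain f' where "\<forall>d. f' d \<in> hom_polys d" "\<forall>v. f v = (\<Sum>d<n. f' d v)"
    using assms unfolding deg_less_def by blast
  then show ?thesis
    unfolding deg_less_def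
    by (auto intro!: exI[of _ "\<lambda>d v. c * f' d v"] hom_polys_scale simp: sum_distrib_left)
qed

lemma hom_polys_deg_less:
  assumes "f \<in> hom_polys d" "d < n"
  shows "f \<in> deg_less n"
proof -
  have "(\<Sum>e<n. (if e = d then f else (\<lambda>v. 0)) v) = f v" for v
    using assms(2) by (subst sum.mono_neutral_right[of _ "{d}"]) auto
  then show ?thesis
    unfolding deg_less_def using assms(1)
    by (auto intro!: exI[of _ "\<lambda>e. if e = d then f else (\<lambda>v. 0)"] hom_polys_zero)
qed

lemma deg_less_Suc_iff:
  "f \<in> deg_less (Suc n) \<longleftrightarrow> (\<exists>g\<in>deg_less n. \<exists>h\<in>hom_polys n. \<forall>v. f v = g v + h v)"
proof
  assume "f \<in> deg_less (Suc n)"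
  then obtain f' where "\<forall>d. f' d \<in> hom_polys d" "\<forall>v. f v = (\<Sum>d<n. f' d v) + f' n v"
    unfolding deg_less_def by auto
  then show "\<exists>g\<in>deg_less n. \<exists>h\<in>hom_polys n. \<forall>v. f v = g v + h v"
    by (intro bexI[of _ "\<lambda>v. \<Sum>d<n. f' d v"] bexI[of _ "f' n"]) (auto simp: deg_less_def)
next
  assume "\<exists>g\<in>deg_less n. \<exists>h\<in>hom_polys n. \<forall>v. f v = g v + h v"
  then obtain g' h where *: "\<forall>d. g' d \<in> hom_polys d" "h \<in> hom_polys n"
    "\<forall>v. f v = (\<Sum>d<n. g' d v) + h v"
    unfolding deg_less_def by auto
  have "(\<Sum>d<n. g' d v) = (\<Sum>d<n. (g'(n := h)) d v)" for v
    by (rule sum.cong) auto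
  then show "f \<in> deg_less (Suc n)"
    unfolding deg_less_def using * by (auto intro!: exI[of _ "g'(n := h)"])
qed

lemma deg_less_mono: "f \<in> deg_less m \<Longrightarrow> m \<le> n \<Longrightarrow> f \<in> deg_less n"
proof (induction n)
  case (Suc n)
  then show ?case
    using hom_polys_zero[of n] unfolding deg_less_Suc_iff[of f n]
    by (cases "m = Suc n") (force simp: deg_less_Suc_iff[of f n] intro: bexI[of _ f] bexI[of _ "\<lambda>v. 0"])+
qed (auto simp: deg_less_0_iff)

lemma polys_deg_less: assumes "f \<in> polys" obtains n where "f \<in> deg_less n"
proof -
  have "\<exists>n. f \<in> deg_less n"
    using assms unfolding polys_def
  proof (induction rule: cfun.span_induct_alt)
    case base
    show ?case using deg_less_zero by (auto simp: zero_fun_def)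
  next
    case (step c x y)
    then obtain n a b e where y: "y \<in> deg_less n" and x: "x = xyz_monomial a b e" by blast
    have "x \<in> hom_polys (a + b + e)"
      unfolding x hom_polys_def by (rule cfun.span_base) blast
    then have "x \<in> deg_less (max n (Suc (a + b + e)))"
      by (rule hom_polys_deg_less) simp
    moreover have "y \<in> deg_less (max n (Suc (a + b + e)))"
      using y by (rule deg_less_mono) simp
    ultimately have "(\<lambda>v. c * x v + y v) \<in> deg_less (max n (Suc (a + b + e)))"
      by (intro deg_less_add deg_less_scale)
    then show ?case unfolding cscale_plus by blast
  qed
  then show thesis using that by blast
qed

text \<open>Restricted to a line through the origin, the components become the coefficients of one
  complex polynomial, so they are determined by the values of the sum.\<close>

lemma poly_coeffs_eq_0:
  fixes a :: "nat \<Rightarrow> complex"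
  assumes "\<And>c. c \<noteq> 0 \<Longrightarrow> (\<Sum>i\<le>n. a i * c ^ i) = 0" "i \<le> n"
  shows "a i = 0"
proof (rule ccontr)
  assume "a i \<noteq> 0"
  then have "finite {z. (\<Sum>i\<le>n. a i * z ^ i) = 0}"
    using polyfun_finite_roots assms(2) by blast
  moreover have "- {0} \<subseteq> {z. (\<Sum>i\<le>n. a i * z ^ i) = 0}" using assms(1) by auto
  ultimately have "finite (- {0 :: complex})" using finite_subset by blast
  then show False by (simp add: finite_compl infinite_UNIV_char_0)
qed

lemma deg_less_homogeneous_part:
  assumes g: "\<And>e. g e \<in> hom_polys e" and fg: "\<And>v. f v = (\<Sum>e<n. g e v)"
    and f: "\<And>c v. c \<noteq> 0 \<Longrightarrow> f (c *s v) = c ^ d * f v"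
  shows "f v = (if d < n then g d v else 0)"
proof -
  define a where "a e = (if e < n then g e v else 0) - (if e = d then f v else 0)" for e
  have "(\<Sum>e\<le>n + d. a e * c ^ e) = 0" if "c \<noteq> 0" for c
  proof -
    have "(\<Sum>e\<le>n + d. (if e < n then g e v else 0) * c ^ e) = (\<Sum>e<n. g e v * c ^ e)"
      by (rule sum.mono_neutral_cong_right) auto
    also have "\<dots> = f (c *s v)"
      unfolding fg by (rule sum.cong) (auto simp: hom_polysD[OF g])
    finally have 1: "(\<Sum>e\<le>n + d. (if e < n then g e v else 0) * c ^ e) = c ^ d * f v"
      using f that by simp
    have "(\<Sum>e\<le>n + d. (if e = d then f v else 0) * c ^ e) = (\<Sum>e\<in>{d}. f v * c ^ e)"
      by (rule sum.mono_neutral_cong_right) auto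
    then show ?thesis using 1 by (simp add: a_def left_diff_distrib sum_subtractf)
  qed
  then have "a d = 0" by (rule poly_coeffs_eq_0) auto
  then show ?thesis by (simp add: a_def)
qed

text \<open>Membership in the span of the monomials of one degree can thus be read off from the scaling
  behaviour, which is stable under products, substitutions and derivatives.\<close>

lemma hom_polys_iff:
  "f \<in> hom_polys d \<longleftrightarrow> f \<in> polys \<and> (\<forall>c v. c \<noteq> 0 \<longrightarrow> f (c *s v) = c ^ d * f v)"
proof
  assume f: "f \<in> polys \<and> (\<forall>c v. c \<noteq> 0 \<longrightarrow> f (c *s v) = c ^ d * f v)"
  then obtain n where "f \<in> deg_less n" using polys_deg_less by blast
  then obtain g where g: "\<And>e. g e \<in> hom_polys e" "\<And>v. f v = (\<Sum>e<n. g e v)"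
    unfolding deg_less_def by blast
  have "f = (if d < n then g d else (\<lambda>v. 0))"
    using deg_less_homogeneous_part[OF g, of d] f by (auto simp: fun_eq_iff)
  then show "f \<in> hom_polys d" using g(1) hom_polys_zero by presburger
qed (use hom_polysD hom_polys_imp_polys in blast)

lemma hom_polys_deg_less_eq_0:
  assumes "f \<in> hom_polys d" "f \<in> deg_less n" "n \<le> d"
  shows "f = (\<lambda>v. 0)"
proof -
  obtain g where g: "\<And>e. g e \<in> hom_polys e" "\<And>v. f v = (\<Sum>e<n. g e v)"
    using assms(2) unfolding deg_less_def by blast
  show ?thesis
    using deg_less_homogeneous_part[OF g, of d] hom_polysD[OF assms(1)] assms(3) by force
qed

lemma hom_polys_mult:
  "f \<in> hom_polys d \<Longrightarrow> g \<in> hom_polys e \<Longrightarrow> (\<lambda>v. f v * g v) \<in> hom_polys (d + e)"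
  by (auto simp: hom_polys_iff power_add intro: polys_mult)

lemma hom_polys_const: "(\<lambda>v. c) \<in> hom_polys 0"
  by (auto simp: hom_polys_iff polys_const)

lemma hom_polys_linear_subst: "f \<in> hom_polys d \<Longrightarrow> (\<lambda>v. f (v v* U)) \<in> hom_polys d"
  by (auto simp: hom_polys_iff polys_linear_subst scalar_vector_matrix_assoc)

lemma hom_polys_0D: "f \<in> hom_polys 0 \<Longrightarrow> f v = f 0"
  using hom_polysD[of f 0 0 v] by simp

section \<open>Directional derivatives\<close>

lemma polys_differentiable:
  assumes "f \<in> polys"
  shows "\<exists>f'\<in>polys. \<forall>v. ((\<lambda>t. f (v + t *s u)) has_field_derivative f' v) (at 0)"
  using assms
proof (induction rule: polys_induct)
  case (const c)
  show ?case by (rule bexI[of _ "\<lambda>v. 0"]) (auto intro!: polys_intros derivative_eq_intros)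
next
  case (coord i)
  show ?case
    by (rule bexI[of _ "\<lambda>v. u $ i"]) (auto intro!: polys_intros derivative_eq_intros)
next
  case (add f g)
  then obtain f' g' where "f' \<in> polys" "g' \<in> polys"
    "\<And>v. ((\<lambda>t. f (v + t *s u)) has_field_derivative f' v) (at 0)"
    "\<And>v. ((\<lambda>t. g (v + t *s u)) has_field_derivative g' v) (at 0)"
    by blast
  then show ?case
    by (intro bexI[of _ "\<lambda>v. f' v + g' v"]) (auto intro!: polys_intros derivative_eq_intros)
next
  case (mult f g)
  then obtain f' g' where *: "f' \<in> polys" "g' \<in> polys"
    "\<And>v. ((\<lambda>t. f (v + t *s u)) has_field_derivative f' v) (at 0)"
    "\<And>v. ((\<lambda>t. g (v + t *s u)) has_field_derivative g' v) (at 0)"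
    by blast
  show ?case
    by (rule bexI[of _ "\<lambda>v. f' v * g v + f v * g' v"])
      (use * mult in \<open>auto intro!: polys_intros derivative_eq_intros\<close>)
qed

lemma has_dir_deriv:
  "f \<in> polys \<Longrightarrow> ((\<lambda>t. f (v + t *s u)) has_field_derivative dir_deriv u f v) (at 0)"
  using polys_differentiable[of f u] unfolding dir_deriv_def
  by (metis DERIV_imp_deriv)

lemma dir_derivI:
  "(\<And>v. ((\<lambda>t. f (v + t *s u)) has_field_derivative f' v) (at 0)) \<Longrightarrow> dir_deriv u f = f'"
  unfolding dir_deriv_def by (auto simp: fun_eq_iff intro: DERIV_imp_deriv)

lemma dir_deriv_polys: "f \<in> polys \<Longrightarrow> dir_deriv u f \<in> polys"
  using polys_differentiable[of f u] by (metis dir_derivI)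

lemma dir_deriv_const: "dir_deriv u (\<lambda>v. c) = (\<lambda>v. 0)"
  by (rule dir_derivI) (auto intro!: derivative_eq_intros)

lemma dir_deriv_coord: "dir_deriv u (\<lambda>v. v $ i) = (\<lambda>v. u $ i)"
  by (rule dir_derivI) (auto intro!: derivative_eq_intros)

lemma dir_deriv_add:
  "f \<in> polys \<Longrightarrow> g \<in> polys \<Longrightarrow>
    dir_deriv u (\<lambda>v. f v + g v) = (\<lambda>v. dir_deriv u f v + dir_deriv u g v)"
  by (rule dir_derivI) (auto intro!: derivative_eq_intros has_dir_deriv)

lemma dir_deriv_mult:
  "f \<in> polys \<Longrightarrow> g \<in> polys \<Longrightarrow>
    dir_deriv u (\<lambda>v. f v * g v) = (\<lambda>v. dir_deriv u f v * g v + f v * dir_deriv u g v)"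
  by (rule dir_derivI) (auto intro!: derivative_eq_intros has_dir_deriv)

lemma dir_deriv_cmult:
  "f \<in> polys \<Longrightarrow> dir_deriv u (\<lambda>v. c * f v) = (\<lambda>v. c * dir_deriv u f v)"
  by (simp add: dir_deriv_mult polys_const dir_deriv_const)

lemma dir_deriv_sum:
  "(\<And>i. i \<in> I \<Longrightarrow> f i \<in> polys) \<Longrightarrow>
    dir_deriv u (\<lambda>v. \<Sum>i\<in>I. f i v) = (\<lambda>v. \<Sum>i\<in>I. dir_deriv u (f i) v)"
  by (induction I rule: infinite_finite_induct)
    (auto simp: dir_deriv_const dir_deriv_add polys_sum)

lemmas dir_deriv_simps = dir_deriv_const dir_deriv_coord dir_deriv_add dir_deriv_mult
  dir_deriv_cmult

text \<open>Both sides are derivations in \<open>f\<close> that agree on the coordinates.\<close>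

lemma dir_deriv_gradient:
  "f \<in> polys \<Longrightarrow> dir_deriv u f v = (\<Sum>k\<in>UNIV. u $ k * dir_deriv (axis k 1) f v)"
proof (induction rule: polys_induct)
  case (coord i)
  have "(\<Sum>k\<in>UNIV. u $ k * (axis k 1 :: complex^3) $ i) = (\<Sum>k\<in>UNIV. if k = i then u $ k else 0)"
    by (rule sum.cong) (auto simp: axis_def)
  then show ?case by (simp add: dir_deriv_coord)
qed (auto simp: dir_deriv_simps sum.distrib sum_distrib_left sum_distrib_right algebra_simps)

lemma dir_deriv_commute:
  "f \<in> polys \<Longrightarrow> dir_deriv u (dir_deriv w f) = dir_deriv w (dir_deriv u f)"
  by (induction rule: polys_induct)
    (auto simp: dir_deriv_simps dir_deriv_polys polys_add polys_mult algebra_simps)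

lemma dir_deriv_linear_subst:
  "dir_deriv u (\<lambda>v. f (v v* U)) v = dir_deriv (u v* U) f (v v* U)"
  by (simp add: dir_deriv_def vector_matrix_left_distrib scalar_vector_matrix_assoc)

lemma dir_deriv_hom_0: "f \<in> hom_polys 0 \<Longrightarrow> dir_deriv u f = (\<lambda>v. 0)"
  by (subst ext[of f "\<lambda>v. f 0", OF hom_polys_0D]) (simp_all add: dir_deriv_const)

text \<open>Differentiate \<open>f (c v + t c u) = c ^ d f (v + t u)\<close> at \<open>t = 0\<close> and cancel \<open>c\<close>. At \<open>d = 0\<close>, where
  \<open>d - 1\<close> is truncated, the derivative is \<open>0\<close>.\<close>

lemma dir_deriv_hom_polys:
  assumes f: "f \<in> hom_polys d"
  shows "dir_deriv u f \<in> hom_polys (d - 1)"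
proof (cases d)
  case 0
  then show ?thesis using dir_deriv_hom_0 f hom_polys_zero by auto
next
  case (Suc n)
  have fp: "f \<in> polys" using f hom_polys_imp_polys by auto
  have "dir_deriv u f (c *s v) = c ^ n * dir_deriv u f v" if c: "c \<noteq> 0" for c v
  proof -
    have "((\<lambda>t. f (c *s v + t *s u)) has_field_derivative dir_deriv u f (c *s v)) (at (c * 0))"
      using has_dir_deriv[OF fp] by simp
    then have 1: "((\<lambda>t. f (c *s v + (c * t) *s u)) has_field_derivative
        dir_deriv u f (c *s v) * c) (at 0)"
      using DERIV_chain2[OF _ DERIV_cmult_Id] by blast
    have "c *s v + (c * t) *s u = c *s (v + t *s u)" for t
      by (simp add: vec_eq_iff algebra_simps)
    then have "f (c *s v + (c * t) *s u) = c ^ d * f (v + t *s u)" for t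
      by (simp only: hom_polysD[OF f])
    with 1 have 2: "((\<lambda>t. c ^ d * f (v + t *s u)) has_field_derivative
        dir_deriv u f (c *s v) * c) (at 0)"
      by (simp only:)
    have "((\<lambda>t. c ^ d * f (v + t *s u)) has_field_derivative
        c ^ d * dir_deriv u f v) (at 0)"
      by (rule DERIV_cmult[OF has_dir_deriv[OF fp]])
    then have "dir_deriv u f (c *s v) * c = c ^ d * dir_deriv u f v"
      by (rule DERIV_unique[OF 2])
    then show ?thesis using c by (simp add: Suc)
  qed
  then show ?thesis using dir_deriv_polys[OF fp] by (auto simp: hom_polys_iff Suc)
qed

text \<open>Differentiate \<open>f (v + t v) = (1 + t) ^ d f v\<close> at \<open>t = 0\<close>.\<close>

lemma euler_identity:
  assumes f: "f \<in> hom_polys d"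
  shows "(\<Sum>k\<in>UNIV. v $ k * dir_deriv (axis k 1) f v) = of_nat d * f v"
proof -
  have fp: "f \<in> polys" using f hom_polys_imp_polys by auto
  have "v + t *s v = (1 + t) *s v" for t by (simp add: vec_eq_iff algebra_simps)
  then have "f (v + t *s v) = (1 + t) ^ d * f v" for t
    by (simp only: hom_polysD[OF f])
  moreover have "((\<lambda>t. (1 + t) ^ d * f v) has_field_derivative of_nat d * f v) (at 0)"
    by (auto intro!: derivative_eq_intros)
  ultimately have "dir_deriv v f v = of_nat d * f v"
    by (simp add: dir_deriv_def DERIV_imp_deriv)
  then show ?thesis by (simp only: dir_deriv_gradient[OF fp, of v v])
qed


section \<open>The Laplacian of a quadratic form\<close>

lemma matrix_inv_inverse:
  fixes A :: "complex^3^3"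
  assumes "invertible A"
  shows "A ** matrix_inv A = mat 1" "matrix_inv A ** A = mat 1"
  using someI_ex[OF assms[unfolded invertible_def]] by (auto simp: matrix_inv_def)

lemma matrix_inv_unique:
  fixes A :: "complex^3^3"
  assumes "invertible A" "A ** X = mat 1"
  shows "matrix_inv A = X"
  by (metis assms matrix_inv_inverse(2) matrix_mul_assoc matrix_mul_lid matrix_mul_rid)

definition bform :: "complex^3^3 \<Rightarrow> complex^3 \<Rightarrow> complex^3 \<Rightarrow> complex" where
  "bform B v w = (\<Sum>k\<in>UNIV. (v v* B) $ k * w $ k)"

lemma qform_bform: "qform B v = bform B v v"
  by (simp add: qform_def bform_def)

lemma bform_polys: "(\<lambda>v. bform B v u) \<in> polys"
  unfolding bform_def vector_matrix_mult_def by (auto intro!: polys_intros)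

lemma bform_hom_polys: "(\<lambda>v. bform B v u) \<in> hom_polys 1"
  by (auto simp: hom_polys_iff bform_polys)
    (simp add: bform_def scalar_vector_matrix_assoc sum_distrib_left mult.assoc)

lemma qform_polys: "qform B \<in> polys"
proof -
  have "qform B = (\<lambda>v. \<Sum>j\<in>UNIV. (\<Sum>i\<in>UNIV. v $ i * B $ i $ j) * v $ j)"
    by (simp add: fun_eq_iff qform_def vector_matrix_mult_def)
  then show ?thesis by (auto intro!: polys_intros)
qed

lemma qform_scale: "qform B (c *s v) = c ^ 2 * qform B v"
  by (simp add: qform_def scalar_vector_matrix_assoc sum_distrib_left power2_eq_square algebra_simps)

lemma qform_power_hom_polys: "(\<lambda>v. qform B v ^ k) \<in> hom_polys (2 * k)"
  by (auto simp: hom_polys_iff polys_power qform_polys qform_scale power_mult_distrib power_mult)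

lemma qform_hom_polys: "qform B \<in> hom_polys 2"
  using qform_power_hom_polys[of B 1] by simp

lemma bform_simps:
  "bform B (v + v') w = bform B v w + bform B v' w" "bform B (c *s v) w = c * bform B v w"
  "bform B (v - v') w = bform B v w - bform B v' w"
  "bform B v (w + w') = bform B v w + bform B v w'" "bform B v (c *s w) = c * bform B v w"
  by (simp_all add: bform_def vector_matrix_left_distrib vector_matrix_mult_diff_distrib
      scalar_vector_matrix_assoc sum.distrib sum_subtractf sum_distrib_left algebra_simps)

lemma dir_deriv_bform: "dir_deriv u (\<lambda>v. bform B v w) = (\<lambda>v. bform B u w)"
  unfolding bform_def
  by (rule dir_derivI)
    (auto simp: vector_matrix_left_distrib scalar_vector_matrix_assoc intro!: derivative_eq_intros)

lemma bform_axis: "bform B v (axis j 1) = (v v* B) $ j"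
proof -
  have "bform B v (axis j 1) = (\<Sum>k\<in>UNIV. if k = j then (v v* B) $ k else 0)"
    unfolding bform_def by (rule sum.cong) (auto simp: axis_def)
  then show ?thesis by simp
qed

lemma axis_vector_matrix_mult: "axis j (1 :: complex) v* (M :: complex^3^3) = M $ j"
proof -
  have "(axis j 1 v* M) $ k = M $ j $ k" for k
    using exhaust_3[of j] by (auto simp: vector_matrix_mult_def axis_def sum_3)
  then show ?thesis by (simp add: vec_eq_iff)
qed

lemma laplacian_add:
  "f \<in> polys \<Longrightarrow> g \<in> polys \<Longrightarrow>
    laplacian B (\<lambda>v. f v + g v) v = laplacian B f v + laplacian B g v"
  by (simp add: laplacian_def dir_deriv_simps dir_deriv_polys sum.distrib algebra_simps)

lemma laplacian_cmult:
  "f \<in> polys \<Longrightarrow> laplacian B (\<lambda>v. c * f v) v = c * laplacian B f v"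
  by (simp add: laplacian_def dir_deriv_simps dir_deriv_polys sum_distrib_left algebra_simps)

lemma laplacian_diff:
  "f \<in> polys \<Longrightarrow> g \<in> polys \<Longrightarrow>
    laplacian B (\<lambda>v. f v - g v) v = laplacian B f v - laplacian B g v"
  using laplacian_add[of f "\<lambda>v. - 1 * g v" B v] laplacian_cmult[of g B "- 1" v]
    polys_scale[of g "- 1"] by simp

lemma laplacian_const: "laplacian B (\<lambda>v. c) v = 0"
  by (simp add: laplacian_def dir_deriv_simps)

lemma laplacian_polys: "f \<in> polys \<Longrightarrow> laplacian B f \<in> polys"
  unfolding laplacian_def[abs_def] by (auto intro!: polys_intros dir_deriv_polys)

lemma laplacian_hom_polys: "f \<in> hom_polys d \<Longrightarrow> laplacian B f \<in> hom_polys (d - 2)"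
  unfolding laplacian_def[abs_def]
  using dir_deriv_hom_polys[OF dir_deriv_hom_polys[of f d]]
  by (auto intro!: hom_polys_sum hom_polys_scale simp: numeral_2_eq_2)

lemma laplacian_low_degree:
  assumes "f \<in> hom_polys d" "d < 2"
  shows "laplacian B f v = 0"
proof -
  have "dir_deriv u f \<in> hom_polys 0" for u
    using dir_deriv_hom_polys[OF assms(1), of u] assms(2) by (auto simp: less_2_cases_iff)
  then show ?thesis by (simp add: laplacian_def dir_deriv_hom_0)
qed

text \<open>The symbol of the Laplacian is the inverse form, so a linear substitution carrying one form
  to another carries their Laplacians to one another.\<close>

lemma laplacian_linear_subst:
  assumes U: "invertible U" "U ** B ** transpose U = B'" and inv: "invertible B" "invertible B'"
    and f: "f \<in> polys"
  shows "laplacian B' (\<lambda>v. f (v v* U)) v = laplacian B f (v v* U)"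
proof -
  define X where "X = transpose U ** matrix_inv B' ** U"
  have "U ** (B ** X) = (U ** B ** transpose U) ** matrix_inv B' ** U"
    unfolding X_def by (simp only: matrix_mul_assoc)
  also have "\<dots> = U" using U(2) matrix_inv_inverse[OF inv(2)] by simp
  finally have "matrix_inv U ** U ** (B ** X) = matrix_inv U ** U"
    by (simp only: matrix_mul_assoc[symmetric])
  then have "B ** X = mat 1" using matrix_inv_inverse[OF U(1)] by simp
  then have X: "matrix_inv B = X" using matrix_inv_unique inv(1) by blast
  define D where "D l m = dir_deriv (axis l 1) (dir_deriv (axis m 1) f) (v v* U)" for l m
  have first: "dir_deriv (axis k 1) (\<lambda>v. f (v v* U)) = (\<lambda>v. dir_deriv (U $ k) f (v v* U))" for k
    by (simp add: fun_eq_iff dir_deriv_linear_subst axis_vector_matrix_mult)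
  have grad: "dir_deriv (U $ k) f = (\<lambda>w. \<Sum>m\<in>UNIV. U $ k $ m * dir_deriv (axis m 1) f w)" for k
    using dir_deriv_gradient[OF f] by blast
  have second: "dir_deriv (axis j 1) (dir_deriv (axis k 1) (\<lambda>v. f (v v* U))) v =
      (\<Sum>l\<in>UNIV. \<Sum>m\<in>UNIV. U $ j $ l * (U $ k $ m * D l m))" for j k
  proof -
    have "dir_deriv (axis j 1) (dir_deriv (axis k 1) (\<lambda>v. f (v v* U))) v =
        dir_deriv (U $ j) (dir_deriv (U $ k) f) (v v* U)"
      unfolding first by (simp add: dir_deriv_linear_subst axis_vector_matrix_mult)
    also have "\<dots> = (\<Sum>l\<in>UNIV. U $ j $ l *
        dir_deriv (axis l 1) (dir_deriv (U $ k) f) (v v* U))"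
      by (rule dir_deriv_gradient[OF dir_deriv_polys[OF f]])
    finally show ?thesis
      unfolding grad
      by (simp add: dir_deriv_sum dir_deriv_cmult dir_deriv_polys f polys_scale D_def
          sum_distrib_left)
  qed
  have "laplacian B' (\<lambda>v. f (v v* U)) v =
      (\<Sum>l\<in>UNIV. \<Sum>m\<in>UNIV. (\<Sum>k\<in>UNIV. (\<Sum>j\<in>UNIV. U $ j $ l * matrix_inv B' $ j $ k) * U $ k $ m)
        * D l m)"
    unfolding laplacian_def second by (simp add: sum_3 algebra_simps)
  also have "\<dots> = (\<Sum>l\<in>UNIV. \<Sum>m\<in>UNIV. X $ l $ m * D l m)"
    by (simp add: X_def matrix_matrix_mult_def transpose_def)
  finally show ?thesis by (simp add: laplacian_def X D_def)
qed

locale nondegenerate_form =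
  fixes B :: "complex^3^3"
  assumes symmetric: "transpose B = B" and invertible: "invertible B"
begin

abbreviation Q :: "complex^3 \<Rightarrow> complex" where "Q \<equiv> qform B"
abbreviation lap :: "(complex^3 \<Rightarrow> complex) \<Rightarrow> complex^3 \<Rightarrow> complex" where "lap \<equiv> laplacian B"

lemma B_sym: "B $ i $ j = B $ j $ i"
proof -
  have "transpose B $ i $ j = B $ j $ i" by (simp add: transpose_def)
  then show ?thesis by (simp only: symmetric)
qed

lemma matrix_inv_sym: "matrix_inv B $ i $ j = matrix_inv B $ j $ i"
proof -
  have "B ** transpose (matrix_inv B) = transpose (matrix_inv B ** B)"
    by (simp add: matrix_transpose_mul symmetric)
  also have "\<dots> = mat 1"
    by (simp add: matrix_inv_inverse(2)[OF invertible])
  finally have "matrix_inv B = transpose (matrix_inv B)"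
    by (rule matrix_inv_unique[OF invertible])
  then have "matrix_inv B $ i $ j = transpose (matrix_inv B) $ i $ j" by (rule arg_cong)
  then show ?thesis by (simp add: transpose_def)
qed

lemma bform_commute: "bform B v w = bform B w v"
  by (simp add: bform_def vector_matrix_mult_def sum_3 algebra_simps
      B_sym[of 2 1] B_sym[of 3 1] B_sym[of 3 2])

lemma dir_deriv_qform: "dir_deriv u Q = (\<lambda>v. 2 * bform B v u)"
proof (rule dir_derivI)
  fix v
  have "Q (v + t *s u) = Q v + t * (2 * bform B v u) + t ^ 2 * Q u" for t
    unfolding qform_bform bform_simps bform_commute[of u v]
    by (simp add: algebra_simps power2_eq_square)
  then show "((\<lambda>t. Q (v + t *s u)) has_field_derivative 2 * bform B v u) (at 0)"
    by (auto intro!: derivative_eq_intros)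
qed

definition grad_pairing :: "(complex^3 \<Rightarrow> complex) \<Rightarrow> (complex^3 \<Rightarrow> complex) \<Rightarrow> complex^3 \<Rightarrow> complex"
  where "grad_pairing f g v = (\<Sum>j\<in>UNIV. \<Sum>k\<in>UNIV.
    matrix_inv B $ j $ k * dir_deriv (axis j 1) f v * dir_deriv (axis k 1) g v)"

lemma laplacian_mult:
  assumes "f \<in> polys" "g \<in> polys"
  shows "lap (\<lambda>v. f v * g v) v = lap f v * g v + f v * lap g v + 2 * grad_pairing f g v"
proof -
  have "dir_deriv (axis j 1) (dir_deriv (axis k 1) (\<lambda>v. f v * g v)) v =
     dir_deriv (axis j 1) (dir_deriv (axis k 1) f) v * g v
     + dir_deriv (axis k 1) f v * dir_deriv (axis j 1) g v
     + dir_deriv (axis j 1) f v * dir_deriv (axis k 1) g v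
     + f v * dir_deriv (axis j 1) (dir_deriv (axis k 1) g) v" for j k
    using assms by (simp add: dir_deriv_simps dir_deriv_polys polys_mult)
  then show ?thesis
    unfolding laplacian_def grad_pairing_def
    by (simp add: sum_3 algebra_simps matrix_inv_sym[of 2 1] matrix_inv_sym[of 3 1]
        matrix_inv_sym[of 3 2])
qed

text \<open>The inverse matrix turns a gradient of the form \<open>c (u B)\<close> back into the vector \<open>c u\<close>.\<close>

lemma grad_pairing_linear:
  assumes "g \<in> polys" and "\<And>j. dir_deriv (axis j 1) f v = c * bform B u (axis j 1)"
  shows "grad_pairing f g v = c * dir_deriv u g v"
proof -
  have "(\<Sum>j\<in>UNIV. (u v* B) $ j * matrix_inv B $ j $ k) = u $ k" for k
  proof -
    have "(u v* B) v* matrix_inv B = u"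
      by (simp add: vector_matrix_mul_assoc matrix_inv_inverse[OF invertible])
    then have "((u v* B) v* matrix_inv B) $ k = u $ k" by simp
    then show ?thesis by (simp add: vector_matrix_mult_def[of "u v* B"])
  qed
  note * = this[of 1] this[of 2] this[of 3]
  have "grad_pairing f g v = c * (\<Sum>k\<in>UNIV. (\<Sum>j\<in>UNIV. (u v* B) $ j * matrix_inv B $ j $ k)
      * dir_deriv (axis k 1) g v)"
    unfolding grad_pairing_def assms(2) bform_axis by (simp add: sum_3 algebra_simps)
  also have "\<dots> = c * dir_deriv u g v"
    using * dir_deriv_gradient[OF assms(1), of u v] by (simp add: sum_3)
  finally show ?thesis .
qed

lemma laplacian_qform: "lap Q v = 6"
proof -
  have "dir_deriv (axis j 1) (dir_deriv (axis k 1) Q) v = 2 * B $ k $ j" for j k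
    unfolding dir_deriv_qform dir_deriv_cmult[OF bform_polys] dir_deriv_bform
    unfolding bform_axis axis_vector_matrix_mult B_sym[of j k] by (rule refl)
  then have "lap Q v = 2 * (\<Sum>j\<in>UNIV. (matrix_inv B ** B) $ j $ j)"
    by (simp add: laplacian_def matrix_matrix_mult_def sum_3 algebra_simps)
  then show ?thesis
    by (simp add: matrix_inv_inverse[OF invertible] mat_def)
qed

text \<open>The product rule contributes \<open>lap Q = 6\<close> and twice the derivative of \<open>f\<close> along \<open>2 v\<close>, which
  is \<open>4 d f\<close> by Euler's identity.\<close>

lemma laplacian_qform_mult:
  assumes f: "f \<in> hom_polys d"
  shows "lap (\<lambda>v. Q v * f v) v = of_nat (6 + 4 * d) * f v + Q v * lap f v"
proof -
  have fp: "f \<in> polys" using f hom_polys_imp_polys by auto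
  have "grad_pairing Q f v = 2 * dir_deriv v f v"
    by (rule grad_pairing_linear[OF fp]) (simp add: dir_deriv_qform)
  also have "dir_deriv v f v = of_nat d * f v"
    using euler_identity[OF f, of v] dir_deriv_gradient[OF fp, of v v] by simp
  finally show ?thesis
    unfolding laplacian_mult[OF qform_polys fp] laplacian_qform by (simp add: algebra_simps)
qed

text \<open>With \<open>laplacian_qform_mult\<close>, this controls both terms in the recursion for the derivatives of
  \<open>Q\<^sup>-\<^sup>1\<^sup>/\<^sup>2\<close>.\<close>

lemma laplacian_linear_mult:
  assumes f: "f \<in> polys"
  shows "lap (\<lambda>v. bform B v u * f v) v = 2 * dir_deriv u f v + bform B v u * lap f v"
proof -
  have "grad_pairing (\<lambda>v. bform B v u) f v = 1 * dir_deriv u f v"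
    by (rule grad_pairing_linear[OF f])
      (simp add: dir_deriv_bform bform_commute[of u])
  moreover have "lap (\<lambda>v. bform B v u) v = 0"
    using laplacian_low_degree[OF bform_hom_polys] by simp
  ultimately show ?thesis
    by (simp add: laplacian_mult[OF bform_polys f])
qed

end

section \<open>Decomposition into harmonics\<close>

context nondegenerate_form
begin

text \<open>By the formula for the Laplacian of a product with \<open>Q\<close>, a solution of
  \<open>lap (Q f) = - c f\<close> with \<open>c \<ge> 0\<close> is \<open>Q\<close> times a polynomial of degree lower by two that
  solves an equation of the same shape with a larger constant.\<close>

lemma laplacian_qform_mult_inj:
  assumes "f \<in> hom_polys d" "\<And>v. lap (\<lambda>v. Q v * f v) v + of_nat c * f v = 0"
  shows "f v = 0"
  using assms
proof (induction d arbitrary: f c v rule: less_induct)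
  case (less d)
  define c' where "c' = 6 + 4 * d + c"
  have c': "of_nat c' \<noteq> (0 :: complex)" by (simp add: c'_def del: of_nat_add)
  have fp: "f \<in> polys" using less.prems(1) hom_polys_imp_polys by auto
  have eq: "of_nat c' * f v + Q v * lap f v = 0" for v
    using less.prems(2)[of v] laplacian_qform_mult[OF less.prems(1), of v]
    by (simp add: c'_def algebra_simps)
  show ?case
  proof (cases "d < 2")
    case True
    then show ?thesis using eq[of v] c' laplacian_low_degree[OF less.prems(1)] by simp
  next
    case False
    have "lap (\<lambda>v. Q v * lap f v) v + of_nat c' * lap f v = 0" for v
    proof -
      have "(\<lambda>v. Q v * lap f v) = (\<lambda>v. - of_nat c' * f v)"
        using eq by (auto simp: fun_eq_iff eq_neg_iff_add_eq_0 add.commute)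
      then show ?thesis by (simp only: laplacian_cmult[OF fp]) simp
    qed
    then have "lap f v = 0" for v
      using False laplacian_hom_polys[OF less.prems(1)] by (intro less.IH[of "d - 2" "lap f" c']) auto
    then show ?thesis using eq[of v] c' by simp
  qed
qed

text \<open>The substitution from the previous proof, run backwards, constructs a solution from one of
  degree lower by two.\<close>

lemma laplacian_qform_mult_surj:
  assumes "f \<in> hom_polys d"
  shows "\<exists>g\<in>hom_polys d. \<forall>v. lap (\<lambda>v. Q v * g v) v + of_nat c * g v = f v"
  using assms
proof (induction d arbitrary: f c rule: less_induct)
  case (less d)
  define c' where "c' = 6 + 4 * d + c"
  have c': "of_nat c' \<noteq> (0 :: complex)" by (simp add: c'_def del: of_nat_add)
  have fp: "f \<in> polys" using less.prems(1) hom_polys_imp_polys by auto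
  have solve: ?case if g: "g \<in> hom_polys d"
    and eq: "\<And>v. of_nat c' * g v + Q v * lap g v = f v" for g
    using g eq laplacian_qform_mult[OF g] by (auto intro!: bexI[of _ g] simp: c'_def algebra_simps)
  show ?case
  proof (cases "d < 2")
    case True
    have g: "(\<lambda>v. (1 / of_nat c') * f v) \<in> hom_polys d"
      using less.prems by (rule hom_polys_scale)
    show ?thesis
      using laplacian_low_degree[OF g True] c' by (intro solve[OF g]) simp
  next
    case False
    then obtain h where h: "h \<in> hom_polys (d - 2)"
      "\<And>v. lap (\<lambda>v. Q v * h v) v + of_nat c' * h v = lap f v"
      using less.IH[of "d - 2" "lap f" c'] laplacian_hom_polys[OF less.prems] by auto
    have hp: "h \<in> polys" using h(1) hom_polys_imp_polys by auto
    have "2 + (d - 2) = d" using False by simp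
    then have Qh: "(\<lambda>v. Q v * h v) \<in> hom_polys d"
      using hom_polys_mult[OF qform_hom_polys h(1), of B] by metis
    \<comment> \<open>The only candidate is \<open>(f - Q (lap g)) / c'\<close>; \<open>h\<close> is chosen so that it satisfies \<open>lap g = h\<close>.\<close>
    define g where "g v = (1 / of_nat c') * (f v - Q v * h v)" for v
    have g: "g \<in> hom_polys d"
      unfolding g_def[abs_def] by (intro hom_polys_scale hom_polys_diff less.prems Qh)
    have "lap g v = (1 / of_nat c') * (lap f v - lap (\<lambda>v. Q v * h v) v)" for v
      unfolding g_def[abs_def]
      by (simp only: laplacian_cmult laplacian_diff fp hp qform_polys polys_mult polys_diff)
    moreover have "lap f v - lap (\<lambda>v. Q v * h v) v = of_nat c' * h v" for v
      using h(2)[of v] by (simp add: algebra_simps)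
    ultimately have "lap g v = h v" for v using c' by simp
    then show ?thesis using c' by (intro solve[OF g]) (simp add: g_def)
  qed
qed

lemma harmonics_iff: "f \<in> harmonics B d \<longleftrightarrow> f \<in> hom_polys d \<and> (\<forall>v. lap f v = 0)"
  by (auto simp: harmonics_def fun_eq_iff)

text \<open>The quotient \<open>g\<close> is chosen to satisfy \<open>lap (Q g) = lap f\<close>.\<close>

lemma harmonic_qform_splitting:
  assumes f: "f \<in> hom_polys (d + 2)"
  obtains h g where "h \<in> harmonics B (d + 2)" "g \<in> hom_polys d" "\<And>v. f v = h v + Q v * g v"
proof -
  have fp: "f \<in> polys" using f hom_polys_imp_polys by auto
  obtain g where g: "g \<in> hom_polys d" "\<And>v. lap (\<lambda>v. Q v * g v) v = lap f v"
    using laplacian_qform_mult_surj[of "lap f" d 0] laplacian_hom_polys[OF f] by auto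
  have gp: "g \<in> polys" using g(1) hom_polys_imp_polys by auto
  have "(\<lambda>v. Q v * g v) \<in> hom_polys (d + 2)"
    using hom_polys_mult[OF qform_hom_polys g(1), of B] by (metis add.commute)
  then have "(\<lambda>v. f v - Q v * g v) \<in> hom_polys (d + 2)"
    by (intro hom_polys_diff f)
  then have "(\<lambda>v. f v - Q v * g v) \<in> harmonics B (d + 2)"
    by (simp add: harmonics_iff laplacian_diff fp gp qform_polys polys_mult g(2))
  then show thesis using g(1) that[of "\<lambda>v. f v - Q v * g v" g] by simp
qed

lemma halves_Suc_Suc: "{k. 2 * k \<le> d + 2} = insert 0 (Suc ` {k. 2 * k \<le> (d :: nat)})"
proof -
  have "k \<in> Suc ` {k. 2 * k \<le> d}" if "2 * k \<le> d + 2" "k \<noteq> 0" for k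
    using that by (intro image_eqI[of _ _ "k - 1"]) auto
  then show ?thesis by auto
qed

lemma finite_halves: "finite {k. 2 * k \<le> (d :: nat)}"
  by (rule finite_subset[of _ "{..d}"]) auto

lemma sum_halves_Suc_Suc:
  "(\<Sum>k | 2 * k \<le> d + 2. Q v ^ k * h k v) = h 0 v + Q v * (\<Sum>k | 2 * k \<le> d. Q v ^ k * h (Suc k) v)"
  unfolding halves_Suc_Suc
  by (subst sum.insert)
    (auto simp: finite_halves sum.reindex sum_distrib_left mult.assoc)

lemma halves_low: "d < 2 \<Longrightarrow> 2 * k \<le> (d :: nat) \<longleftrightarrow> k = 0"
  by auto

lemma harmonic_decomposition:
  assumes "f \<in> hom_polys d"
  shows "\<exists>h. (\<forall>k. 2 * k \<le> d \<longrightarrow> h k \<in> harmonics B (d - 2 * k)) \<and>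
    (\<forall>v. f v = (\<Sum>k | 2 * k \<le> d. Q v ^ k * h k v))"
  using assms
proof (induction d arbitrary: f rule: less_induct)
  case (less d)
  show ?case
  proof (cases "d < 2")
    case True
    then have "f \<in> harmonics B d"
      using less.prems laplacian_low_degree by (auto simp: harmonics_iff)
    then show ?thesis
      using True by (intro exI[of _ "\<lambda>k. f"]) (auto simp: halves_low[OF True])
  next
    case False
    define e where "e = d - 2"
    have d: "d = e + 2" using False by (simp add: e_def)
    obtain h0 g where *: "h0 \<in> harmonics B d" "g \<in> hom_polys e" "\<And>v. f v = h0 v + Q v * g v"
      using harmonic_qform_splitting[of f e] less.prems unfolding d by blast
    then obtain h where h: "\<And>k. 2 * k \<le> e \<Longrightarrow> h k \<in> harmonics B (e - 2 * k)"
      "\<And>v. g v = (\<Sum>k | 2 * k \<le> e. Q v ^ k * h k v)"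
      using less.IH[of e g] d by auto
    define h' where "h' k = (case k of 0 \<Rightarrow> h0 | Suc k \<Rightarrow> h k)" for k
    have "h' k \<in> harmonics B (d - 2 * k)" if "2 * k \<le> d" for k
      using that * h(1) by (cases k) (auto simp: h'_def d)
    moreover have "f v = (\<Sum>k | 2 * k \<le> d. Q v ^ k * h' k v)" for v
      unfolding d sum_halves_Suc_Suc by (simp add: h'_def *(3) h(2))
    ultimately show ?thesis by blast
  qed
qed

lemma hom_polys_qform_sum:
  assumes "\<And>k. 2 * k \<le> d \<Longrightarrow> h k \<in> hom_polys (d - 2 * k)"
  shows "(\<lambda>v. \<Sum>k | 2 * k \<le> d. Q v ^ k * h k v) \<in> hom_polys d"
proof (rule hom_polys_sum)
  fix k assume k: "k \<in> {k. 2 * k \<le> d}"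
  show "(\<lambda>v. Q v ^ k * h k v) \<in> hom_polys d"
    using hom_polys_mult[OF qform_power_hom_polys assms, of k B k] k by simp
qed

lemma harmonic_decomposition_unique:
  assumes "\<And>k. 2 * k \<le> d \<Longrightarrow> h k \<in> harmonics B (d - 2 * k)"
    and "\<And>v. (\<Sum>k | 2 * k \<le> d. Q v ^ k * h k v) = 0" and "2 * k \<le> d"
  shows "h k v = 0"
  using assms
proof (induction d arbitrary: h k v rule: less_induct)
  case (less d)
  show ?case
  proof (cases "d < 2")
    case True
    then show ?thesis using less.prems(2)[of v] less.prems(3) by (simp add: halves_low[OF True])
  next
    case False
    define e where "e = d - 2"
    have d: "d = e + 2" using False by (simp add: e_def)
    define g where "g v = (\<Sum>k | 2 * k \<le> e. Q v ^ k * h (Suc k) v)" for v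
    have h: "h (Suc k) \<in> harmonics B (e - 2 * k)" if "2 * k \<le> e" for k
      using less.prems(1)[of "Suc k"] that by (simp add: d)
    have g: "g \<in> hom_polys e"
      unfolding g_def[abs_def] using h by (intro hom_polys_qform_sum) (auto simp: harmonics_iff)
    have h0: "h 0 \<in> harmonics B d" using less.prems(1)[of 0] by simp
    then have h0p: "h 0 \<in> polys" using harmonics_iff hom_polys_imp_polys by blast
    have sum0: "h 0 v + Q v * g v = 0" for v
      using less.prems(2)[of v] unfolding d sum_halves_Suc_Suc by (simp add: g_def)
    then have "(\<lambda>v. Q v * g v) = (\<lambda>v. - 1 * h 0 v)"
      by (auto simp: fun_eq_iff eq_neg_iff_add_eq_0 add.commute)
    then have Qg: "lap (\<lambda>v. Q v * g v) v = 0" for v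
      using h0 by (simp only: laplacian_cmult[OF h0p]) (simp add: harmonics_iff)
    have g0: "g v = 0" for v
      by (rule laplacian_qform_mult_inj[OF g, of 0]) (simp add: Qg)
    show ?thesis
    proof (cases k)
      case 0
      then show ?thesis using sum0[of v] g0[of v] by simp
    next
      case (Suc j)
      then have "2 * j \<le> e" using less.prems(3) d by simp
      then show ?thesis
        unfolding Suc using g0 h less.IH[of e "\<lambda>k. h (Suc k)" j v] d by (simp add: g_def)
    qed
  qed
qed

end


section \<open>Orthonormal frames and divisibility by \<open>Q - c\<close>\<close>

lemma bform_linear_subst: "bform B (v v* U) (w v* U) = bform (U ** B ** transpose U) v w"
proof -
  have "(\<Sum>k\<in>UNIV. x $ k * (w v* U) $ k) = (\<Sum>k\<in>UNIV. (x v* transpose U) $ k * w $ k)" for x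
    by (simp add: vector_matrix_mult_def transpose_def sum_3 algebra_simps)
  then show ?thesis
    by (simp only: bform_def vector_matrix_mul_assoc)
qed

lemma qform_linear_subst: "qform B (v v* U) = qform (U ** B ** transpose U) v"
  by (simp only: qform_bform bform_linear_subst)

lemma qform_mat_1: "qform (mat 1) v = (v $ 1)\<^sup>2 + (v $ 2)\<^sup>2 + (v $ 3)\<^sup>2"
  by (simp add: qform_def sum_3 power2_eq_square)

lemma bform_zero: "bform B 0 w = 0" "bform B v 0 = 0"
  by (simp_all add: bform_def)

lemma bform_sum: "bform B (\<Sum>i\<in>I. f i) w = (\<Sum>i\<in>I. bform B (f i) w)"
  by (induction I rule: infinite_finite_induct) (simp_all add: bform_zero bform_simps)

context nondegenerate_form
begin

lemma bform_nondegenerate: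
  assumes "\<And>w. bform B v w = 0"
  shows "v = 0"
proof -
  have "(v v* B) $ j = 0" for j using assms[of "axis j 1"] by (simp add: bform_axis)
  then have "v v* B = 0" by (simp add: vec_eq_iff)
  then have "(v v* B) v* matrix_inv B = 0" by simp
  then show ?thesis
    by (simp add: vector_matrix_mul_assoc matrix_inv_inverse[OF invertible])
qed

text \<open>An orthonormal system that does not span can be extended: were \<open>Q\<close> zero on its orthogonal
  complement, polarization would put that complement into the kernel of the form.\<close>

lemma orthonormal_system_exists:
  assumes "k \<le> 3"
  shows "\<exists>u :: nat \<Rightarrow> complex^3. \<forall>i<k. \<forall>j<k. bform B (u i) (u j) = (if i = j then 1 else 0)"
  using assms
proof (induction k)
  case (Suc k)
  then obtain u where u: "\<And>i j. i < k \<Longrightarrow> j < k \<Longrightarrow> bform B (u i) (u j) = (if i = j then 1 else 0)"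
    by auto
  define proj where "proj w = w - (\<Sum>i<k. bform B w (u i) *s u i)" for w
  have perp: "bform B (proj w) (u j) = 0" if "j < k" for w j
  proof -
    have "(\<Sum>i<k. bform B w (u i) * bform B (u i) (u j)) = (\<Sum>i\<in>{j}. bform B w (u i))"
      using that u by (intro sum.mono_neutral_cong_right) auto
    then show ?thesis by (simp add: proj_def bform_simps bform_sum)
  qed
  have "\<exists>w. Q (proj w) \<noteq> 0"
  proof (rule ccontr)
    assume "\<not> ?thesis"
    then have iso: "Q (proj w) = 0" for w by simp
    have add: "proj (w + y) = proj w + proj y" for w y
      by (simp add: proj_def bform_simps vec_eq_iff sum.distrib algebra_simps)
    have zero: "bform B (proj w) (proj y) = 0" for w y
      using iso[of "w + y"] iso[of w] iso[of y] bform_commute[of "proj y" "proj w"]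
      unfolding add qform_bform bform_simps by simp
    have "bform B (proj w) y = 0" for w y
    proof -
      have "bform B (proj y) (proj w) = bform B y (proj w)"
        unfolding proj_def[of y] bform_simps bform_sum
        using perp by (simp add: bform_commute[of _ "proj w"])
      then show ?thesis using zero[of y w] by (simp add: bform_commute[of _ "proj w"])
    qed
    then have p0: "proj w = 0" for w by (rule bform_nondegenerate)
    have "w \<in> vec.span (u ` {..<k})" for w
    proof -
      have "w = (\<Sum>i<k. bform B w (u i) *s u i)"
        using p0[of w] unfolding proj_def by simp
      also have "\<dots> \<in> vec.span (u ` {..<k})"
        by (intro vec.span_sum vec.span_scale vec.span_base) auto
      finally show ?thesis .
    qed
    then have "vec.span (u ` {..<k}) = UNIV" by blast
    then have "vec.dim (UNIV :: (complex^3) set) = vec.dim (u ` {..<k})"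
      by (metis vec.dim_span)
    also have "\<dots> \<le> card (u ` {..<k})" by (rule vec.dim_le_card') simp
    also have "\<dots> \<le> k" using card_image_le[of "{..<k}" u] by simp
    finally show False using Suc.prems by (simp add: card_cart_basis)
  qed
  then obtain w where w: "Q (proj w) \<noteq> 0" by blast
  define c where "c = csqrt (Q (proj w))"
  have c: "c \<noteq> 0" "c * c = Q (proj w)"
    using w power2_csqrt[of "Q (proj w)"] by (simp_all add: c_def flip: power2_eq_square)
  define e where "e = (1 / c) *s proj w"
  have "bform B e e = (1 / c)\<^sup>2 * (c * c)"
    by (simp only: e_def qform_bform[symmetric] qform_scale c(2))
  then have "bform B e e = 1" using c(1) by (simp add: power2_eq_square)
  moreover have "bform B e (u j) = 0" if "j < k" for j
    using perp[OF that] by (simp add: e_def bform_simps)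
  moreover have "bform B (u j) e = 0" if "j < k" for j
    using perp[OF that] by (simp add: e_def bform_simps bform_commute[of "u j"])
  ultimately show ?case
    using u by (intro exI[of _ "u(k := e)"]) (auto simp: less_Suc_eq)
qed auto

lemma orthonormal_frame:
  obtains U :: "complex^3^3" where "invertible U" "U ** B ** transpose U = mat 1"
proof -
  obtain u :: "nat \<Rightarrow> complex^3"
    where u: "\<And>i j. i < 3 \<Longrightarrow> j < 3 \<Longrightarrow> bform B (u i) (u j) = (if i = j then 1 else 0)"
    using orthonormal_system_exists[of 3] by auto
  define U :: "complex^3^3" where "U = vector [u 0, u 1, u 2]"
  have rows: "U $ 1 = u 0" "U $ 2 = u 1" "U $ 3 = u 2" by (simp_all add: U_def)
  have "bform (U ** B ** transpose U) (axis i 1) (axis j 1) = bform B (U $ i) (U $ j)" for i j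
    unfolding bform_linear_subst[symmetric] axis_vector_matrix_mult ..
  then have entry: "(U ** B ** transpose U) $ i $ j = bform B (U $ i) (U $ j)" for i j
    unfolding bform_axis axis_vector_matrix_mult .
  have "(U ** B ** transpose U) $ i $ j = mat 1 $ i $ j" for i j
    unfolding entry using exhaust_3[of i] exhaust_3[of j] by (auto simp: rows u mat_def)
  then have UBU: "U ** B ** transpose U = mat 1" by (simp add: vec_eq_iff)
  then have "U ** (B ** transpose U) = mat 1" by (simp add: matrix_mul_assoc)
  then have "invertible U" using invertible_right_inverse by blast
  then show thesis using that UBU by blast
qed

end

text \<open>Restriction to lines reduces questions about vanishing to the integral domain of polynomials
  in one variable.\<close>

lemma polys_along_line:
  assumes "f \<in> polys"
  shows "\<exists>p. \<forall>t. f (v + t *s u) = poly p t"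
  using assms
proof (induction rule: polys_induct)
  case (const c)
  show ?case by (rule exI[of _ "[:c:]"]) simp
next
  case (coord i)
  show ?case by (rule exI[of _ "[:v $ i, u $ i:]"]) simp
next
  case (add f g)
  then show ?case by (metis poly_add)
next
  case (mult f g)
  then show ?case by (metis poly_mult)
qed

text \<open>Restrict to the line through \<open>v\<close> and \<open>w\<close>: there \<open>g\<close> is not identically zero.\<close>

lemma polys_no_zero_divisors:
  assumes f: "f \<in> polys" and g: "g \<in> polys" and fg: "\<And>v. f v * g v = 0" and w: "g w \<noteq> 0"
  shows "f v = 0"
proof -
  obtain p q where p: "\<And>t. f (v + t *s (w - v)) = poly p t"
    and q: "\<And>t. g (v + t *s (w - v)) = poly q t"
    using polys_along_line[OF f, of v "w - v"] polys_along_line[OF g, of v "w - v"] by blast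
  have "poly (p * q) t = 0" for t
    using fg[of "v + t *s (w - v)"] p q by simp
  then have "p * q = 0" using poly_all_0_iff_0 by blast
  moreover have "poly q 1 \<noteq> 0" using w q[of 1] by simp
  ultimately have "p = 0" by auto
  then show ?thesis using p[of 0] by simp
qed

definition z_free :: "(complex^3 \<Rightarrow> complex) \<Rightarrow> bool" where
  "z_free f \<longleftrightarrow> (\<forall>v w. v $ 1 = w $ 1 \<longrightarrow> v $ 2 = w $ 2 \<longrightarrow> f v = f w)"

text \<open>As a polynomial in \<open>z\<close>, \<open>x\<^sup>2 + y\<^sup>2 + z\<^sup>2 - c\<close> is monic of degree two, so division by it leaves a
  remainder of degree at most one in \<open>z\<close>.\<close>

lemma z_division:
  assumes "F \<in> polys"
  shows "\<exists>F0\<in>polys. \<exists>F1\<in>polys. \<exists>G\<in>polys. z_free F0 \<and> z_free F1 \<and>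
    (\<forall>v. F v = F0 v + v $ 3 * F1 v + (qform (mat 1) v - c) * G v)"
  using assms
proof (induction rule: polys_induct)
  case (const a)
  show ?case
    by (rule bexI[of _ "\<lambda>v. a"], rule bexI[of _ "\<lambda>v. 0"], rule bexI[of _ "\<lambda>v. 0"])
      (auto simp: z_free_def intro: polys_intros)
next
  case (coord i)
  show ?case
  proof (cases "i = 3")
    case True
    then show ?thesis
      by (intro bexI[of _ "\<lambda>v. 0"] bexI[of _ "\<lambda>v. 1"])
        (auto simp: z_free_def intro: polys_intros)
  next
    case False
    then have "i = 1 \<or> i = 2" using exhaust_3[of i] by blast
    then show ?thesis
      by (intro bexI[of _ "\<lambda>v. v $ i"] bexI[of _ "\<lambda>v. 0"])
        (auto simp: z_free_def intro: polys_intros)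
  qed
next
  case (add f g)
  from add.IH(1) obtain a0 a1 a where a: "a0 \<in> polys" "a1 \<in> polys" "a \<in> polys" "z_free a0"
    "z_free a1" "\<And>v. f v = a0 v + v $ 3 * a1 v + (qform (mat 1) v - c) * a v" by blast
  from add.IH(2) obtain b0 b1 b where b: "b0 \<in> polys" "b1 \<in> polys" "b \<in> polys" "z_free b0"
    "z_free b1" "\<And>v. g v = b0 v + v $ 3 * b1 v + (qform (mat 1) v - c) * b v" by blast
  show ?case
  proof (intro bexI conjI allI)
    show "z_free (\<lambda>v. a0 v + b0 v)" "z_free (\<lambda>v. a1 v + b1 v)"
      using a b unfolding z_free_def by metis+
    show "f v + g v = a0 v + b0 v + v $ 3 * (a1 v + b1 v) + (qform (mat 1) v - c) * (a v + b v)"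
      for v unfolding a(6) b(6) by (simp add: algebra_simps)
  qed (auto intro!: polys_intros a b)
next
  case (mult f g)
  from mult.IH(1) obtain a0 a1 a where a: "a0 \<in> polys" "a1 \<in> polys" "a \<in> polys" "z_free a0"
    "z_free a1" "\<And>v. f v = a0 v + v $ 3 * a1 v + (qform (mat 1) v - c) * a v" by blast
  from mult.IH(2) obtain b0 b1 b where b: "b0 \<in> polys" "b1 \<in> polys" "b \<in> polys" "z_free b0"
    "z_free b1" "\<And>v. g v = b0 v + v $ 3 * b1 v + (qform (mat 1) v - c) * b v" by blast
  define S where "S v = qform (mat 1) v - c" for v
  have S: "S \<in> polys" unfolding S_def[abs_def] by (intro polys_intros qform_polys)
  have z2: "(v $ 3)\<^sup>2 = S v + (c - (v $ 1)\<^sup>2 - (v $ 2)\<^sup>2)" for v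
    by (simp add: S_def qform_mat_1)
  \<comment> \<open>Multiply out and replace \<open>z\<^sup>2\<close> by \<open>S + (c - x\<^sup>2 - y\<^sup>2)\<close>.\<close>
  define F0 where "F0 v = a0 v * b0 v + (c - (v $ 1)\<^sup>2 - (v $ 2)\<^sup>2) * (a1 v * b1 v)" for v
  define F1 where "F1 v = a0 v * b1 v + a1 v * b0 v" for v
  define G where "G v = a1 v * b1 v + a v * (b0 v + v $ 3 * b1 v + S v * b v)
    + (a0 v + v $ 3 * a1 v) * b v" for v
  show ?case
  proof (intro bexI conjI allI)
    have *: "a0 v = a0 w" "a1 v = a1 w" "b0 v = b0 w" "b1 v = b1 w"
      if "v $ 1 = w $ 1" "v $ 2 = w $ 2" for v w
      using a(4,5) b(4,5) that unfolding z_free_def by blast+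
    show "z_free F0" "z_free F1"
      unfolding z_free_def F0_def F1_def by (metis *)+
    fix v
    have "f v * g v = a0 v * b0 v + v $ 3 * (a0 v * b1 v + a1 v * b0 v)
        + (v $ 3)\<^sup>2 * (a1 v * b1 v) + S v * (a v * (b0 v + v $ 3 * b1 v + S v * b v)
    + (a0 v + v $ 3 * a1 v) * b v)"
      unfolding a(6) b(6) S_def[symmetric] by (simp add: algebra_simps power2_eq_square)
    then show "f v * g v = F0 v + v $ 3 * F1 v + (qform (mat 1) v - c) * G v"
      unfolding z2 F0_def F1_def G_def S_def[symmetric] by (simp add: algebra_simps)
  qed (auto intro!: polys_intros a b S simp: F0_def[abs_def] F1_def[abs_def] G_def[abs_def])
qed

text \<open>Over each \<open>(x, y)\<close> the quadric has the two points \<open>z = \<plusminus> r\<close> with \<open>r\<^sup>2 = c - x\<^sup>2 - y\<^sup>2\<close>. Vanishing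
  at both forces \<open>F0 = 0\<close> and \<open>r F1 = 0\<close> for the remainder \<open>F0 + z F1\<close>; since \<open>c - x\<^sup>2 - y\<^sup>2\<close> is
  not the zero polynomial, \<open>F1 = 0\<close> as well.\<close>

lemma standard_quadric_divides:
  assumes F: "F \<in> polys" and zero: "\<And>v. qform (mat 1) v = c \<Longrightarrow> F v = 0"
  shows "\<exists>G\<in>polys. \<forall>v. F v = (qform (mat 1) v - c) * G v"
proof -
  obtain F0 F1 G where p: "F0 \<in> polys" "F1 \<in> polys" "G \<in> polys" and free: "z_free F0" "z_free F1"
    and eq: "\<And>v. F v = F0 v + v $ 3 * F1 v + (qform (mat 1) v - c) * G v"
    using z_division[OF F, of c] by blast
  have both: "F0 v = 0 \<and> F1 v * (c - (v $ 1)\<^sup>2 - (v $ 2)\<^sup>2) = 0" for v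
  proof -
    define z where "z = csqrt (c - (v $ 1)\<^sup>2 - (v $ 2)\<^sup>2)"
    define w :: "complex \<Rightarrow> complex^3" where "w r = (\<chi> i. if i = 3 then r else v $ i)" for r
    have [simp]: "w r $ 1 = v $ 1" "w r $ 2 = v $ 2" "w r $ 3 = r" for r
      by (simp_all add: w_def)
    have wF: "F0 (w r) = F0 v" "F1 (w r) = F1 v" for r
      using free[unfolded z_free_def, rule_format, of "w r" v] by simp_all
    have "qform (mat 1) (w r) = c" if "r\<^sup>2 = z\<^sup>2" for r
      using that by (simp add: qform_mat_1 z_def)
    then have "F0 v + r * F1 v = 0" if "r\<^sup>2 = z\<^sup>2" for r
      using that zero[of "w r"] eq[of "w r"] wF by simp
    from this[of z] this[of "- z"] have *: "F0 v + z * F1 v = 0" "F0 v - z * F1 v = 0" by auto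
    then have "F0 v = 0" "z * F1 v = 0" by (auto simp: algebra_simps)
    then have "F1 v * z\<^sup>2 = 0" by (auto simp: power2_eq_square)
    then show ?thesis using \<open>F0 v = 0\<close> by (simp add: z_def)
  qed
  obtain w :: "complex^3" where "c - (w $ 1)\<^sup>2 - (w $ 2)\<^sup>2 \<noteq> 0"
  proof (cases "c = 0")
    case True
    then show thesis using that[of "axis 1 1"] by (simp add: axis_def)
  next
    case False
    then show thesis using that[of 0] by simp
  qed
  moreover have "(\<lambda>v. c - (v $ 1)\<^sup>2 - (v $ 2)\<^sup>2) \<in> polys" by (intro polys_intros)
  ultimately have "F1 v = 0" for v
    using polys_no_zero_divisors[OF p(2), of "\<lambda>v. c - (v $ 1)\<^sup>2 - (v $ 2)\<^sup>2" w v] both by blast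
  then show ?thesis using eq both p(3) by auto
qed

context nondegenerate_form
begin

text \<open>An orthonormal frame carries \<open>Q\<close> to \<open>x\<^sup>2 + y\<^sup>2 + z\<^sup>2\<close>.\<close>

lemma quadric_divides:
  assumes F: "F \<in> polys" and zero: "\<And>v. Q v = c \<Longrightarrow> F v = 0"
  shows "\<exists>G\<in>polys. \<forall>v. F v = (Q v - c) * G v"
proof -
  obtain U :: "complex^3^3" where U: "invertible U" "U ** B ** transpose U = mat 1"
    by (rule orthonormal_frame)
  have QU: "Q (v v* U) = qform (mat 1) v" for v by (simp add: qform_linear_subst U(2))
  have "\<exists>G\<in>polys. \<forall>v. F (v v* U) = (qform (mat 1) v - c) * G v"
    by (rule standard_quadric_divides) (auto simp: polys_linear_subst F zero QU)
  then obtain G where G: "G \<in> polys" "\<And>v. F (v v* U) = (Q (v v* U) - c) * G v"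
    by (auto simp: QU)
  have "F v = (Q v - c) * G (v v* matrix_inv U)" for v
    using G(2)[of "v v* matrix_inv U"]
    by (simp add: vector_matrix_mul_assoc matrix_inv_inverse[OF U(1)])
  then show ?thesis
    using polys_linear_subst[OF G(1)] by (intro bexI[of _ "\<lambda>v. G (v v* matrix_inv U)"]) auto
qed

end

section \<open>The Dirichlet problem\<close>

context nondegenerate_form
begin

lemma deg_less_polys: "f \<in> deg_less n \<Longrightarrow> f \<in> polys"
proof (induction n arbitrary: f)
  case (Suc n)
  then obtain g h where "g \<in> deg_less n" "h \<in> hom_polys n" "f = (\<lambda>v. g v + h v)"
    unfolding deg_less_Suc_iff by (auto simp: fun_eq_iff)
  then show ?case using Suc.IH hom_polys_imp_polys by (auto intro: polys_intros)
qed (auto simp: deg_less_0_iff intro: polys_intros)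

lemma laplacian_deg_less: "f \<in> deg_less n \<Longrightarrow> lap f \<in> deg_less (n - 1)"
proof (induction n arbitrary: f)
  case 0
  then have "f = (\<lambda>v. 0)" by (simp add: deg_less_0_iff)
  then have "lap f = (\<lambda>v. 0)" using laplacian_const[of B 0] by auto
  then show ?case by (simp add: deg_less_zero)
next
  case (Suc n)
  then obtain g h where gh: "g \<in> deg_less n" "h \<in> hom_polys n" "f = (\<lambda>v. g v + h v)"
    unfolding deg_less_Suc_iff by (auto simp: fun_eq_iff)
  then have "lap f = (\<lambda>v. lap g v + lap h v)"
    using laplacian_add[of g h B] deg_less_polys[OF gh(1)] hom_polys_imp_polys[OF gh(2)] by auto
  moreover have "lap g \<in> deg_less n" using deg_less_mono Suc.IH[OF gh(1)] by fastforce
  moreover have "lap h \<in> deg_less n"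
  proof (cases "n = 0")
    case True
    then have "lap h = (\<lambda>v. 0)" using laplacian_low_degree[OF gh(2)] by auto
    then show ?thesis by (simp add: deg_less_zero)
  next
    case False
    then show ?thesis using hom_polys_deg_less[OF laplacian_hom_polys[OF gh(2)]] by simp
  qed
  ultimately show ?case by (simp add: deg_less_add)
qed

lemma laplacian_qform_hom_polys:
  assumes "g \<in> hom_polys n" shows "lap (\<lambda>v. Q v * g v) \<in> hom_polys n"
  using laplacian_hom_polys[OF hom_polys_mult[OF qform_hom_polys assms]] by simp

lemma laplacian_qform_deg_less: "f \<in> deg_less n \<Longrightarrow> lap (\<lambda>v. Q v * f v) \<in> deg_less n"
proof (induction n arbitrary: f)
  case 0
  then have "f = (\<lambda>v. 0)" by (simp add: deg_less_0_iff)
  then have "lap (\<lambda>v. Q v * f v) = (\<lambda>v. 0)" using laplacian_const[of B 0] by auto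
  then show ?case by (simp add: deg_less_zero)
next
  case (Suc n)
  then obtain g h where gh: "g \<in> deg_less n" "h \<in> hom_polys n" "f = (\<lambda>v. g v + h v)"
    unfolding deg_less_Suc_iff by (auto simp: fun_eq_iff)
  have p: "(\<lambda>v. Q v * g v) \<in> polys" "(\<lambda>v. Q v * h v) \<in> polys"
    using deg_less_polys[OF gh(1)] gh(2) hom_polys_imp_polys
    by (auto intro!: polys_mult qform_polys)
  have "lap (\<lambda>v. Q v * f v) = (\<lambda>v. lap (\<lambda>v. Q v * g v) v + lap (\<lambda>v. Q v * h v) v)"
    using laplacian_add[OF p] by (auto simp: gh(3) distrib_left)
  moreover have "lap (\<lambda>v. Q v * g v) \<in> deg_less (Suc n)"
    using deg_less_mono Suc.IH[OF gh(1)] by fastforce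
  moreover have "lap (\<lambda>v. Q v * h v) \<in> deg_less (Suc n)"
    using hom_polys_deg_less[OF laplacian_qform_hom_polys[OF gh(2)]] by simp
  ultimately show ?case by (simp add: deg_less_add)
qed

lemma laplacian_shifted_mult:
  assumes f: "f \<in> polys"
  shows "lap (\<lambda>v. (Q v - c) * f v) v = lap (\<lambda>v. Q v * f v) v - c * lap f v"
proof -
  have "(\<lambda>v. (Q v - c) * f v) = (\<lambda>v. Q v * f v - c * f v)" by (simp add: left_diff_distrib)
  then show ?thesis
    using laplacian_diff[of "\<lambda>v. Q v * f v" "\<lambda>v. c * f v" B v] laplacian_cmult[OF f, of B c v] f
    by (simp add: polys_mult polys_scale qform_polys)
qed

text \<open>On the top homogeneous component the map \<open>G \<mapsto> lap ((Q - c) G)\<close> is the bijection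
  \<open>g \<mapsto> lap (Q g)\<close>; all other contributions have lower degree. Induction on the degree thus
  shows, here and in the next lemma, that it is a bijection of the space of all polynomials.\<close>

lemma laplacian_shifted_mult_inj:
  assumes "G \<in> deg_less n" "\<And>v. lap (\<lambda>v. (Q v - c) * G v) v = 0"
  shows "G = (\<lambda>v. 0)"
  using assms
proof (induction n arbitrary: G)
  case 0
  then show ?case by (simp add: deg_less_0_iff)
next
  case (Suc n)
  then obtain g h where gh: "g \<in> deg_less n" "h \<in> hom_polys n" "G = (\<lambda>v. g v + h v)"
    unfolding deg_less_Suc_iff by (auto simp: fun_eq_iff)
  have p: "g \<in> polys" "h \<in> polys" "G \<in> polys"
    using gh hom_polys_imp_polys deg_less_polys Suc.prems(1) by blast+
  have "lap (\<lambda>v. Q v * h v) v = c * lap G v + - 1 * lap (\<lambda>v. Q v * g v) v" for v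
  proof -
    have "lap (\<lambda>v. Q v * G v) v = lap (\<lambda>v. Q v * g v) v + lap (\<lambda>v. Q v * h v) v"
      using laplacian_add[of "\<lambda>v. Q v * g v" "\<lambda>v. Q v * h v" B v] p
      by (simp add: gh(3) distrib_left polys_mult qform_polys)
    then show ?thesis
      using Suc.prems(2)[of v] laplacian_shifted_mult[OF p(3), of c v] by (simp add: algebra_simps)
  qed
  then have "lap (\<lambda>v. Q v * h v) = (\<lambda>v. c * lap G v + - 1 * lap (\<lambda>v. Q v * g v) v)" by blast
  also have "\<dots> \<in> deg_less n"
    using laplacian_deg_less[OF Suc.prems(1)] laplacian_qform_deg_less[OF gh(1)]
    by (intro deg_less_add deg_less_scale) auto
  finally have "lap (\<lambda>v. Q v * h v) = (\<lambda>v. 0)"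
    by (rule hom_polys_deg_less_eq_0[OF laplacian_qform_hom_polys[OF gh(2)]]) simp
  then have "lap (\<lambda>v. Q v * h v) v + of_nat 0 * h v = 0" for v by simp
  then have "h v = 0" for v by (rule laplacian_qform_mult_inj[OF gh(2)])
  then have "G = g" by (simp add: gh(3))
  then show ?case using Suc.IH[of G] Suc.prems(2) gh(1) by simp
qed

lemma laplacian_shifted_mult_surj:
  assumes "M \<in> deg_less n"
  shows "\<exists>G\<in>polys. \<forall>v. lap (\<lambda>v. (Q v - c) * G v) v = M v"
  using assms
proof (induction n arbitrary: M)
  case 0
  then have "M = (\<lambda>v. 0)" by (simp add: deg_less_0_iff)
  then show ?case
    using laplacian_const[of B 0] by (intro bexI[of _ "\<lambda>v. 0"]) (auto intro: polys_intros)
next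
  case (Suc n)
  then obtain m h where mh: "m \<in> deg_less n" "h \<in> hom_polys n" "M = (\<lambda>v. m v + h v)"
    unfolding deg_less_Suc_iff by (auto simp: fun_eq_iff)
  obtain g where g: "g \<in> hom_polys n" "\<And>v. lap (\<lambda>v. Q v * g v) v = h v"
    using laplacian_qform_mult_surj[OF mh(2), of 0] by auto
  have gp: "g \<in> polys" using g(1) hom_polys_imp_polys by auto
  have "lap g \<in> deg_less n"
    using laplacian_deg_less[OF hom_polys_deg_less[OF g(1), of "Suc n"]] by simp
  then have "(\<lambda>v. m v + c * lap g v) \<in> deg_less n"
    by (intro deg_less_add deg_less_scale mh)
  then obtain G where G: "G \<in> polys"
    "\<And>v. lap (\<lambda>v. (Q v - c) * G v) v = m v + c * lap g v"
    using Suc.IH by blast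
  have "lap (\<lambda>v. (Q v - c) * (G v + g v)) v = M v" for v
  proof -
    have "lap (\<lambda>v. (Q v - c) * (G v + g v)) v
        = lap (\<lambda>v. (Q v - c) * G v) v + lap (\<lambda>v. (Q v - c) * g v) v"
      using laplacian_add[of "\<lambda>v. (Q v - c) * G v" "\<lambda>v. (Q v - c) * g v" B v] G(1) gp
      by (simp add: distrib_left polys_intros qform_polys)
    then show ?thesis by (simp add: G(2) g(2) laplacian_shifted_mult[OF gp] mh(3))
  qed
  then show ?case
    by (intro bexI[of _ "\<lambda>v. G v + g v"]) (auto intro: polys_intros G gp)
qed

text \<open>The polynomials with the boundary values of \<open>N\<close> are those of the form \<open>N + (Q - c) G\<close>, and the
  equation for \<open>P\<close> becomes \<open>lap ((Q - c) G) = M - lap N\<close>.\<close>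

theorem dirichlet_problem:
  assumes M: "M \<in> polys" and N: "N \<in> polys"
  shows "\<exists>!P. P \<in> polys \<and> lap P = M \<and> (\<forall>v\<in>level_set B c. P v = N v)"
proof (rule ex_ex1I)
  have "(\<lambda>v. M v - lap N v) \<in> polys" by (intro polys_diff M laplacian_polys N)
  then obtain n where "(\<lambda>v. M v - lap N v) \<in> deg_less n" by (rule polys_deg_less)
  then obtain G where G: "G \<in> polys" "\<And>v. lap (\<lambda>v. (Q v - c) * G v) v = M v - lap N v"
    using laplacian_shifted_mult_surj[of _ n c] by blast
  have QG: "(\<lambda>v. (Q v - c) * G v) \<in> polys" by (intro polys_intros qform_polys G)
  have "lap (\<lambda>v. N v + (Q v - c) * G v) = M"
    using laplacian_add[OF N QG] by (simp add: G(2) fun_eq_iff)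
  then show "\<exists>P. P \<in> polys \<and> lap P = M \<and> (\<forall>v\<in>level_set B c. P v = N v)"
    using polys_add[OF N QG] by (auto simp: level_set_def)
next
  fix P P' assume P: "P \<in> polys \<and> lap P = M \<and> (\<forall>v\<in>level_set B c. P v = N v)"
    and P': "P' \<in> polys \<and> lap P' = M \<and> (\<forall>v\<in>level_set B c. P' v = N v)"
  have "\<exists>G\<in>polys. \<forall>v. P v - P' v = (Q v - c) * G v"
    using P P' by (intro quadric_divides polys_diff) (auto simp: level_set_def)
  then obtain G where G: "G \<in> polys" "\<And>v. P v - P' v = (Q v - c) * G v" by blast
  have "lap (\<lambda>v. (Q v - c) * G v) v = 0" for v
    using laplacian_diff[of P P' B v] P P' by (simp add: G(2)[symmetric])
  moreover obtain n where "G \<in> deg_less n" using G(1) by (rule polys_deg_less)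
  ultimately have "G = (\<lambda>v. 0)" using laplacian_shifted_mult_inj by blast
  then show "P = P'" using G(2) by (simp add: fun_eq_iff)
qed

end


section \<open>Iterated derivatives of \<open>Q\<^sup>-\<^sup>1\<^sup>/\<^sup>2\<close>\<close>

text \<open>Divide \<open>q t - q x = (g t - g x) (g t + g x)\<close> by \<open>g t + g x\<close>, which tends to \<open>2 g x \<noteq> 0\<close> by
  continuity. Thus a continuous branch of the square root of \<open>Q\<close> can be differentiated along lines.\<close>

lemma has_field_derivative_continuous_sqrt:
  fixes g q :: "complex \<Rightarrow> complex"
  assumes cont: "isCont g x" and nz: "g x \<noteq> 0"
    and sq: "\<forall>\<^sub>F t in nhds x. (g t)\<^sup>2 = q t" and q: "(q has_field_derivative D) (at x)"
  shows "(g has_field_derivative D / (2 * g x)) (at x)"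
proof -
  have lim: "((\<lambda>t. g t + g x) \<longlongrightarrow> 2 * g x) (at x)"
    using tendsto_add[OF isContD[OF cont] tendsto_const, of "g x"] by simp
  have "((\<lambda>t. (q t - q x) / (t - x) / (g t + g x)) \<longlongrightarrow> D / (2 * g x)) (at x)"
    using q nz by (intro tendsto_divide lim) (auto simp: has_field_derivative_iff)
  moreover have "\<forall>\<^sub>F t in at x. (q t - q x) / (t - x) / (g t + g x) = (g t - g x) / (t - x)"
  proof -
    have qx: "q x = (g x)\<^sup>2" using eventually_nhds_x_imp_x[OF sq] by simp
    have "\<forall>\<^sub>F t in at x. g t + g x \<noteq> 0"
      using tendsto_imp_eventually_ne[OF lim, of 0] nz by simp
    moreover have "\<forall>\<^sub>F t in at x. (g t)\<^sup>2 = q t"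
      using sq by (simp add: eventually_at_filter eventually_mono)
    ultimately show ?thesis
    proof eventually_elim
      case (elim t)
      have "q t - q x = (g t - g x) * (g t + g x)"
        using elim by (simp add: qx algebra_simps power2_eq_square)
      then show ?case using elim by simp
    qed
  qed
  ultimately show ?thesis
    unfolding has_field_derivative_iff by (rule Lim_transform_eventually)
qed

context nondegenerate_form
begin

text \<open>\<open>maxwell us\<close> is the numerator of \<open>\<nabla>\<^bsub>u1\<^esub> \<dots> \<nabla>\<^bsub>um\<^esub> Q\<^sup>-\<^sup>1\<^sup>/\<^sup>2\<close> over the denominator
  \<open>Q ^ (m + 1/2)\<close>.\<close>

primrec maxwell :: "(complex^3) list \<Rightarrow> complex^3 \<Rightarrow> complex" where
  "maxwell [] = (\<lambda>v. 1)"
| "maxwell (u # us) = (\<lambda>v. Q v * dir_deriv u (maxwell us) v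
    + (- of_nat (2 * length us + 1)) * (bform B v u * maxwell us v))"

lemma maxwell_polys: "maxwell us \<in> polys"
  by (induction us) (auto intro!: polys_intros qform_polys dir_deriv_polys bform_polys)

text \<open>By the quotient rule, since \<open>s\<^sup>2 = Q\<close> gives \<open>s\<close> the derivative \<open>bform B v u / s v\<close> along \<open>u\<close>.\<close>

lemma iterated_derivative_inverse_sqrt:
  assumes s: "sqrt_branch B W s" and v: "v \<in> W"
  shows "foldr dir_deriv us (\<lambda>w. 1 / s w) v = maxwell us v / s v ^ (2 * length us + 1)"
  using v
proof (induction us arbitrary: v)
  case Nil
  show ?case by simp
next
  case (Cons u us)
  define m where "m = length us"
  define g where "g t = s (v + t *s u)" for t
  have W: "open W" "continuous_on W s" and sW: "\<And>w. w \<in> W \<Longrightarrow> Q w \<noteq> 0 \<and> (s w)\<^sup>2 = Q w"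
    using s by (auto simp: sqrt_branch_def)
  have cont: "isCont (\<lambda>t. v + t *s u) 0"
    unfolding isCont_def
    by (rule vec_tendstoI) (auto intro!: tendsto_eq_intros)
  have g0: "g 0 = s v" by (simp add: g_def)
  have sv: "s v \<noteq> 0" "(s v)\<^sup>2 = Q v" using sW[OF Cons.prems] by auto
  have nearW: "\<forall>\<^sub>F t in nhds 0. v + t *s u \<in> W"
    using topological_tendstoD[OF cont[unfolded isCont_def] W(1)] Cons.prems
    by (simp add: eventually_nhds_conv_at)
  have "isCont s v" using W Cons.prems continuous_on_eq_continuous_at by blast
  then have "isCont g 0"
    unfolding g_def[abs_def] using isCont_o2[OF cont, of s] by simp
  moreover have "\<forall>\<^sub>F t in nhds 0. (g t)\<^sup>2 = Q (v + t *s u)"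
    using nearW sW by (auto simp: g_def elim!: eventually_mono)
  moreover have "((\<lambda>t. Q (v + t *s u)) has_field_derivative 2 * bform B v u) (at 0)"
    using has_dir_deriv[OF qform_polys[of B], of v u] by (simp add: dir_deriv_qform)
  ultimately have "(g has_field_derivative 2 * bform B v u / (2 * g 0)) (at 0)"
    using sv(1) by (intro has_field_derivative_continuous_sqrt) (auto simp: g0)
  then have g': "(g has_field_derivative bform B v u / s v) (at 0)" by (simp add: g0)
  define H H' where "H = maxwell us v" and "H' = dir_deriv u (maxwell us) v"
  have "((\<lambda>t. maxwell us (v + t *s u)) has_field_derivative H') (at 0)"
    unfolding H'_def by (rule has_dir_deriv[OF maxwell_polys])
  from DERIV_divide[OF this DERIV_power[OF g', of "2 * m + 1"]]
  have "((\<lambda>t. maxwell us (v + t *s u) / g t ^ (2 * m + 1)) has_field_derivative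
      (H' * s v ^ (2 * m + 1) - H * (of_nat (2 * m + 1) * (bform B v u / s v * s v ^ (2 * m))))
        / (s v ^ (2 * m + 1) * s v ^ (2 * m + 1))) (at 0)"
    using sv(1) by (simp add: g0 H_def)
  also have "(H' * s v ^ (2 * m + 1) - H * (of_nat (2 * m + 1) * (bform B v u / s v * s v ^ (2 * m))))
        / (s v ^ (2 * m + 1) * s v ^ (2 * m + 1))
      = ((s v)\<^sup>2 * H' - of_nat (2 * m + 1) * (bform B v u * H)) / s v ^ (2 * Suc m + 1)"
    using sv(1) by (simp add: field_simps power2_eq_square)
  also have "(s v)\<^sup>2 * H' - of_nat (2 * m + 1) * (bform B v u * H) = maxwell (u # us) v"
    by (simp add: sv(2) H_def H'_def m_def algebra_simps)
  also have "2 * Suc m + 1 = 2 * length (u # us) + 1" by (simp add: m_def)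
  finally have "((\<lambda>t. maxwell us (v + t *s u) / g t ^ (2 * m + 1)) has_field_derivative
      maxwell (u # us) v / s v ^ (2 * length (u # us) + 1)) (at 0)" .
  moreover have ev: "\<forall>\<^sub>F t in nhds 0. foldr dir_deriv us (\<lambda>w. 1 / s w) (v + t *s u)
      = maxwell us (v + t *s u) / g t ^ (2 * m + 1)"
    using nearW by eventually_elim (simp add: Cons.IH g_def m_def)
  ultimately have "((\<lambda>t. foldr dir_deriv us (\<lambda>w. 1 / s w) (v + t *s u)) has_field_derivative
      maxwell (u # us) v / s v ^ (2 * length (u # us) + 1)) (at 0)"
    by (simp only: DERIV_cong_ev[OF refl ev refl])
  then show ?case
    unfolding foldr.simps o_apply dir_deriv_def[of u] by (rule DERIV_imp_deriv)
qed

lemma laplacian_dir_deriv: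
  assumes f: "f \<in> polys"
  shows "lap (dir_deriv u f) v = dir_deriv u (lap f) v"
proof -
  have "dir_deriv (axis j 1) (dir_deriv (axis k 1) (dir_deriv u f)) =
      dir_deriv u (dir_deriv (axis j 1) (dir_deriv (axis k 1) f))" for j k
    using f by (simp add: dir_deriv_commute[of _ _ u] dir_deriv_polys)
  then have "lap (dir_deriv u f) v = (\<Sum>j\<in>UNIV. \<Sum>k\<in>UNIV. matrix_inv B $ j $ k *
      dir_deriv u (dir_deriv (axis j 1) (dir_deriv (axis k 1) f)) v)"
    by (simp add: laplacian_def)
  also have "\<dots> = dir_deriv u (lap f) v"
    unfolding laplacian_def[abs_def]
    by (simp add: dir_deriv_sum dir_deriv_cmult f dir_deriv_polys polys_sum polys_scale)
  finally show ?thesis .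
qed

text \<open>This is the harmonicity of \<open>Q\<^sup>-\<^sup>1\<^sup>/\<^sup>2\<close> in disguise: the constant \<open>2 m + 1\<close> is just the one
  for which the two contributions to the Laplacian cancel.\<close>

lemma maxwell_harmonic: "maxwell us \<in> harmonics B (length us)"
proof (induction us)
  case Nil
  show ?case
    using hom_polys_const[of 1] laplacian_const[of B 1] by (auto simp: harmonics_iff)
next
  case (Cons u us)
  define m where "m = length us"
  define H where "H = maxwell us"
  have H: "H \<in> hom_polys m" "\<And>v. lap H v = 0"
    using Cons by (auto simp: harmonics_iff H_def m_def)
  then have lapH: "lap H = (\<lambda>v. 0)" by auto
  have Hp: "H \<in> polys" using H(1) by (rule hom_polys_imp_polys)
  have one: "(\<lambda>v. Q v * dir_deriv u H v) \<in> hom_polys (Suc m)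
      \<and> (\<forall>v. lap (\<lambda>v. Q v * dir_deriv u H v) v = of_nat (2 * m + 1) * (2 * dir_deriv u H v))"
  proof (cases m)
    case 0
    then have "dir_deriv u H = (\<lambda>v. 0)" using dir_deriv_hom_0 H(1) by auto
    then show ?thesis using hom_polys_zero laplacian_const[of B 0] by simp
  next
    case (Suc n)
    have DH: "dir_deriv u H \<in> hom_polys n" using dir_deriv_hom_polys[OF H(1), of u] Suc by simp
    have "lap (\<lambda>v. Q v * dir_deriv u H v) v = of_nat (6 + 4 * n) * dir_deriv u H v" for v
      using laplacian_qform_mult[OF DH, of v] laplacian_dir_deriv[OF Hp, of u v]
      by (simp add: lapH dir_deriv_const)
    moreover have "6 + 4 * n = (2 * m + 1) * 2" using Suc by simp
    ultimately show ?thesis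
      using hom_polys_mult[OF qform_hom_polys DH, of B] Suc by (simp only: of_nat_mult) simp
  qed
  have two: "(\<lambda>v. bform B v u * H v) \<in> hom_polys (Suc m)"
    "\<And>v. lap (\<lambda>v. bform B v u * H v) v = 2 * dir_deriv u H v"
    using hom_polys_mult[OF bform_hom_polys H(1)] laplacian_linear_mult[OF Hp] H(2) by auto
  have p: "(\<lambda>v. Q v * dir_deriv u H v) \<in> polys" "(\<lambda>v. bform B v u * H v) \<in> polys"
    using one two(1) hom_polys_imp_polys by blast+
  have eq: "maxwell (u # us) = (\<lambda>v. Q v * dir_deriv u H v +
      (- of_nat (2 * m + 1)) * (bform B v u * H v))"
    by (simp add: H_def m_def)
  have "maxwell (u # us) \<in> hom_polys (Suc m)"
    unfolding eq using one two(1) by (intro hom_polys_add hom_polys_scale) auto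
  moreover have "lap (maxwell (u # us)) v = 0" for v
    unfolding eq laplacian_add[OF p(1) polys_scale[OF p(2)]] laplacian_cmult[OF p(2)] two(2)
    using one by (simp add: algebra_simps)
  ultimately show ?case by (simp add: harmonics_iff m_def del: maxwell.simps)
qed

text \<open>On the cone only the second term of the recursion survives.\<close>

lemma maxwell_on_cone:
  "Q v = 0 \<Longrightarrow> maxwell us v =
    (\<Prod>i<length us. - of_nat (2 * i + 1)) * prod_list (map (bform B v) us)"
  by (induction us) simp_all

end

section \<open>Factorization on the isotropic cone\<close>

text \<open>The rational parametrization of the cone \<open>x\<^sup>2 + y\<^sup>2 + z\<^sup>2 = 0\<close> by binary quadratic forms. It
  turns ternary forms of degree \<open>d\<close> into binary forms of degree \<open>2 d\<close>, and linear forms into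
  arbitrary binary quadratic forms.\<close>

definition cone_point :: "complex \<Rightarrow> complex \<Rightarrow> complex^3" where
  "cone_point s t = vector [s\<^sup>2 - t\<^sup>2, \<i> * (s\<^sup>2 + t\<^sup>2), 2 * s * t]"

lemma cone_point_nth [simp]:
  "cone_point s t $ 1 = s\<^sup>2 - t\<^sup>2" "cone_point s t $ 2 = \<i> * (s\<^sup>2 + t\<^sup>2)"
  "cone_point s t $ 3 = 2 * s * t"
  by (simp_all add: cone_point_def)

text \<open>The first two coordinates determine \<open>s\<^sup>2\<close> and \<open>t\<^sup>2\<close>; the third then fixes the sign of \<open>t\<close>.\<close>

lemma cone_point_surj:
  assumes "qform (mat 1) w = 0"
  shows "\<exists>s t. w = cone_point s t"
proof -
  define s where "s = csqrt ((w $ 1 - \<i> * w $ 2) / 2)"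
  define t where "t = csqrt (- (w $ 1 + \<i> * w $ 2) / 2)"
  have s: "s\<^sup>2 = (w $ 1 - \<i> * w $ 2) / 2" and t: "t\<^sup>2 = - (w $ 1 + \<i> * w $ 2) / 2"
    by (simp_all only: s_def t_def power2_csqrt)
  have 1: "w $ 1 = s\<^sup>2 - t\<^sup>2" "w $ 2 = \<i> * (s\<^sup>2 + t\<^sup>2)"
    unfolding s t by (simp_all add: field_simps)
  have "(w $ 3)\<^sup>2 = - ((w $ 1)\<^sup>2 + (w $ 2)\<^sup>2)"
    using assms by (simp add: qform_mat_1 eq_neg_iff_add_eq_0 algebra_simps)
  also have "\<dots> = (2 * s * t)\<^sup>2"
    unfolding 1 by (simp add: power2_eq_square algebra_simps)
  finally have "w $ 3 = 2 * s * t \<or> w $ 3 = 2 * s * (- t)"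
    by (simp add: power2_eq_iff)
  then have "w = cone_point s t \<or> w = cone_point s (- t)"
    using 1 by (auto simp: vec_eq_iff forall_3)
  then show ?thesis by blast
qed

lemma hom_polys_on_cone:
  assumes "f \<in> hom_polys d"
  shows "\<exists>p. degree p \<le> 2 * d \<and> (\<forall>s. f (cone_point s 1) = poly p s)"
  using assms unfolding hom_polys_def
proof (induction rule: cfun.span_induct_alt)
  case base
  show ?case by (rule exI[of _ 0]) simp
next
  case (step c x y)
  then obtain q where q: "degree q \<le> 2 * d" "\<And>s. y (cone_point s 1) = poly q s" by blast
  obtain i j k where x: "x = xyz_monomial i j k" "i + j + k = d" using step by blast
  define p where "p = [:-1, 0, 1:] ^ i * [:\<i>, 0, \<i>:] ^ j * [:0, 2 :: complex:] ^ k"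
  have "degree p \<le> 2 * i + 2 * j + 1 * k"
    unfolding p_def
    by (intro order_trans[OF degree_mult_le] add_mono order_trans[OF degree_power_le]) auto
  then have "degree (smult c p + q) \<le> 2 * d"
    using q(1) x(2) by (intro degree_add_le order_trans[OF degree_smult_le]) auto
  moreover have "x (cone_point s 1) = poly p s" for s
    by (simp add: x p_def xyz_monomial_def power2_eq_square algebra_simps)
  ultimately show ?case
    using q(2) by (intro exI[of _ "smult c p + q"]) (simp add: cscale_def)
qed

text \<open>A root \<open>r\<close> of \<open>p\<close> contributes the factor \<open>s - r t\<close>, and the defect \<open>n - degree p\<close> is made up
  by factors \<open>t\<close>.\<close>

lemma homogenized_factorization:
  fixes p :: "complex poly"
  assumes "degree p \<le> n"
  shows "\<exists>K L. length L = n \<and> (\<forall>s t. t \<noteq> 0 \<longrightarrow>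
    t ^ n * poly p (s / t) = K * (\<Prod>(a, b)\<leftarrow>L. a * s + b * t))"
proof (cases "p = 0")
  case True
  then show ?thesis by (intro exI[of _ 0] exI[of _ "replicate n (0, 0)"]) simp
next
  case False
  then obtain A where A: "size A = degree p" "p = smult (lead_coeff p) (\<Prod>x\<in>#A. [:-x, 1:])"
    using alg_closed_imp_factorization[OF False] by blast
  obtain rs where rs: "mset rs = A" using ex_mset by blast
  define L where "L = map (\<lambda>x. (1 :: complex, - x)) rs @ replicate (n - degree p) (0, 1)"
  have len: "length rs = degree p" using A(1) rs by auto
  have "prod_mset (image_mset (\<lambda>x. [:-x, 1:]) A) = prod_list (map (\<lambda>x. [:-x, 1:]) rs)"
    by (simp flip: rs mset_map add: prod_mset_prod_list)
  moreover have "poly (prod_list (map (\<lambda>x. [:-x, 1:]) rs)) x = (\<Prod>r\<leftarrow>rs. x - r)" for rs and x :: complex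
    by (induction rs) (simp_all add: algebra_simps)
  ultimately have pval: "poly p x = lead_coeff p * (\<Prod>r\<leftarrow>rs. x - r)" for x
    by (subst A(2)) simp
  have "t ^ n * poly p (s / t) = lead_coeff p * (\<Prod>(a, b)\<leftarrow>L. a * s + b * t)" if "t \<noteq> 0" for s t
  proof -
    have "t ^ length rs * (\<Prod>r\<leftarrow>rs. s / t - r) = (\<Prod>r\<leftarrow>rs. s - r * t)" for rs
    proof (induction rs)
      case (Cons a rs)
      have "t ^ length (a # rs) * (\<Prod>r\<leftarrow>a # rs. s / t - r)
          = (t * (s / t - a)) * (t ^ length rs * (\<Prod>r\<leftarrow>rs. s / t - r))"
        by simp
      also have "t * (s / t - a) = s - a * t" using that by (simp add: field_simps)
      finally show ?case using Cons by simp
    qed simp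
    moreover have "t ^ n = t ^ (n - degree p) * t ^ degree p"
      using assms by (simp flip: power_add)
    ultimately have "t ^ n * (\<Prod>r\<leftarrow>rs. s / t - r) = t ^ (n - degree p) * (\<Prod>r\<leftarrow>rs. s - r * t)"
      using len by (metis mult.assoc)
    then show ?thesis by (simp add: pval L_def o_def prod_list_replicate algebra_simps)
  qed
  moreover have "length L = n" using assms len by (simp add: L_def)
  ultimately show ?thesis by blast
qed

lemma bform_mat_1: "bform (mat 1) w u = w $ 1 * u $ 1 + w $ 2 * u $ 2 + w $ 3 * u $ 3"
  by (simp add: bform_def sum_3)

text \<open>A product of two of the factors is a binary quadratic form in \<open>s, t\<close>, a combination of \<open>s\<^sup>2\<close>,
  \<open>t\<^sup>2\<close> and \<open>s t\<close>. On the cone these are \<open>(w\<^sub>1 - \<i> w\<^sub>2) / 2\<close>, \<open>- (w\<^sub>1 + \<i> w\<^sub>2) / 2\<close> and \<open>w\<^sub>3 / 2\<close>, which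
  explains the vector \<open>u\<close> in the proof.\<close>

lemma pair_linear_factors:
  fixes L :: "(complex \<times> complex) list"
  assumes "length L = 2 * d"
  shows "\<exists>us. length us = d \<and> (\<forall>s t. (\<Prod>(a, b)\<leftarrow>L. a * s + b * t) =
    prod_list (map (bform (mat 1) (cone_point s t)) us))"
  using assms
proof (induction d arbitrary: L)
  case 0
  then show ?case by simp
next
  case (Suc d)
  then obtain a b a' b' L' where L: "L = (a, b) # (a', b') # L'" "length L' = 2 * d"
    by (cases L; cases "tl L") auto
  then obtain us where us: "length us = d" "\<And>s t. (\<Prod>(a, b)\<leftarrow>L'. a * s + b * t) =
      prod_list (map (bform (mat 1) (cone_point s t)) us)"
    using Suc.IH by blast
  define u :: "complex^3" where
    "u = vector [(a * a' - b * b') / 2, - \<i> * (a * a' + b * b') / 2, (a * b' + a' * b) / 2]"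
  have "bform (mat 1) (cone_point s t) u = (a * s + b * t) * (a' * s + b' * t)" for s t
    by (simp add: bform_mat_1 u_def power2_eq_square field_simps)
  then show ?case
    using us L by (intro exI[of _ "u # us"]) (simp add: mult.assoc)
qed

lemma isCont_polys_cone_point: "f \<in> polys \<Longrightarrow> isCont (\<lambda>t. f (cone_point s t)) x"
proof (induction rule: polys_induct)
  case (coord i)
  show ?case
    using exhaust_3[of i]
    by (elim disjE) (simp_all only: cone_point_nth, (intro continuous_intros)+)
qed (auto intro!: continuous_intros)

lemma standard_cone_factorization:
  assumes f: "f \<in> hom_polys d"
  shows "\<exists>K us. length us = d \<and>
    (\<forall>w. qform (mat 1) w = 0 \<longrightarrow> f w = K * prod_list (map (bform (mat 1) w) us))"
proof -
  obtain p where p: "degree p \<le> 2 * d" "\<And>s. f (cone_point s 1) = poly p s"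
    using hom_polys_on_cone[OF f] by blast
  obtain K L where L: "length L = 2 * d" "\<And>s t. t \<noteq> 0 \<Longrightarrow>
      t ^ (2 * d) * poly p (s / t) = K * (\<Prod>(a, b)\<leftarrow>L. a * s + b * t)"
    using homogenized_factorization[OF p(1)] by blast
  obtain us where us: "length us = d" "\<And>s t. (\<Prod>(a, b)\<leftarrow>L. a * s + b * t) =
      prod_list (map (bform (mat 1) (cone_point s t)) us)"
    using pair_linear_factors[OF L(1)] by blast
  define g where "g w = f w - K * prod_list (map (bform (mat 1) w) us)" for w
  have "(\<lambda>w. prod_list (map (bform (mat 1) w) us)) \<in> polys"
    by (induction us) (auto intro!: polys_intros bform_polys)
  then have gp: "g \<in> polys"
    unfolding g_def[abs_def] using hom_polys_imp_polys[OF f] by (intro polys_intros)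
  have nz: "g (cone_point s t) = 0" if "t \<noteq> 0" for s t
  proof -
    have "cone_point s t = t\<^sup>2 *s cone_point (s / t) 1"
      using that by (simp add: vec_eq_iff forall_3 power2_eq_square field_simps)
    then have "f (cone_point s t) = t ^ (2 * d) * poly p (s / t)"
      by (simp add: hom_polysD[OF f] p(2) power_mult)
    then show ?thesis using L(2)[OF that, of s] us(2) by (simp add: g_def)
  qed
  \<comment> \<open>Dehomogenizing loses the points with \<open>t = 0\<close>, which are limits of the others.\<close>
  have "g (cone_point s t) = 0" for s t
  proof (cases "t = 0")
    case True
    have "((\<lambda>t. g (cone_point s t)) \<longlongrightarrow> g (cone_point s 0)) (at 0)"
      using isCont_polys_cone_point[OF gp, where s = s and x = 0] by (simp add: isCont_def)
    moreover have "((\<lambda>t. g (cone_point s t)) \<longlongrightarrow> 0) (at 0)"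
      by (rule tendsto_eventually) (auto simp: eventually_at_filter nz)
    ultimately show ?thesis using True tendsto_unique by (metis at_neq_bot)
  qed (rule nz)
  then show ?thesis
    using us(1) cone_point_surj by (intro exI[of _ K] exI[of _ us]) (force simp: g_def)
qed

context nondegenerate_form
begin

lemma cone_factorization:
  assumes f: "f \<in> hom_polys d"
  shows "\<exists>K us. length us = d \<and> (\<forall>v. Q v = 0 \<longrightarrow> f v = K * prod_list (map (bform B v) us))"
proof -
  obtain U :: "complex^3^3" where U: "invertible U" "U ** B ** transpose U = mat 1"
    by (rule orthonormal_frame)
  obtain K us where us: "length us = d" "\<And>w. qform (mat 1) w = 0 \<Longrightarrow>
      f (w v* U) = K * prod_list (map (bform (mat 1) w) us)"
    using standard_cone_factorization[OF hom_polys_linear_subst[OF f, of U]] by blast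
  have "f v = K * prod_list (map (bform B v) (map (\<lambda>u. u v* U) us))" if "Q v = 0" for v
  proof -
    define w where "w = v v* matrix_inv U"
    have v: "v = w v* U"
      by (simp add: w_def vector_matrix_mul_assoc matrix_inv_inverse[OF U(1)])
    have "bform B v (u v* U) = bform (mat 1) w u" for u
      by (simp only: v bform_linear_subst U(2))
    moreover have "qform (mat 1) w = 0"
      using that by (simp only: v qform_linear_subst U(2))
    ultimately show ?thesis using us(2)[of w] by (simp add: o_def flip: v)
  qed
  then show ?thesis using us(1) by (intro exI[of _ K] exI[of _ "map (\<lambda>u. u v* U) us"]) simp
qed

text \<open>This is uniqueness in the Dirichlet problem with zero data on \<open>{Q = 0}\<close>.\<close>

lemma harmonic_vanishing_on_cone:
  assumes "h \<in> harmonics B d" "\<And>v. Q v = 0 \<Longrightarrow> h v = 0"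
  shows "h v = 0"
proof -
  have "h \<in> polys \<and> lap h = (\<lambda>v. 0) \<and> (\<forall>v\<in>level_set B 0. h v = 0)"
    using assms by (auto simp: harmonics_iff level_set_def intro: hom_polys_imp_polys)
  moreover have "(\<lambda>v. 0) \<in> polys \<and> lap (\<lambda>v. 0) = (\<lambda>v. 0)"
    using laplacian_const[of B 0] by (auto intro: polys_intros)
  ultimately have "h = (\<lambda>v. 0)"
    using dirichlet_problem[OF polys_const polys_const, of 0 0 0] by blast
  then show ?thesis by simp
qed

text \<open>Sylvester's theorem. The directions come from factoring \<open>f\<close> on the cone, the constant being
  absorbed in the first of them; then \<open>f\<close> and the numerator are harmonic forms with the same values
  on the cone.\<close>

lemma sylvester:
  assumes f: "f \<in> harmonics B d" and d: "d > 0"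
  shows "\<exists>us. length us = d \<and> f = maxwell us"
proof -
  obtain K us where us: "length us = d"
    "\<And>v. Q v = 0 \<Longrightarrow> f v = K * prod_list (map (bform B v) us)"
    using cone_factorization f harmonics_iff by blast
  obtain u us' where u: "us = u # us'" using us(1) d by (cases us) auto
  define kappa :: complex where "kappa = (\<Prod>i<d. - of_nat (2 * i + 1))"
  have "- of_nat (2 * i + 1) \<noteq> (0 :: complex)" for i
    by (simp only: neg_equal_0_iff_equal of_nat_eq_0_iff)
  then have kappa: "kappa \<noteq> 0"
    unfolding kappa_def by (auto simp only: prod_zero_iff finite_lessThan)
  define ws where "ws = ((K / kappa) *s u) # us'"
  have len: "length ws = d" using us(1) u by (simp add: ws_def)
  have cone: "f v - maxwell ws v = 0" if "Q v = 0" for v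
  proof -
    have "maxwell ws v = kappa * prod_list (map (bform B v) ws)"
      using maxwell_on_cone[OF that, of ws] by (simp only: len kappa_def)
    then show ?thesis using us(2)[OF that] kappa by (simp add: ws_def u bform_simps)
  qed
  have m: "maxwell ws \<in> harmonics B d" using maxwell_harmonic[of ws] len by simp
  have "(\<lambda>v. f v - maxwell ws v) \<in> harmonics B d"
    using f m by (auto simp: harmonics_iff laplacian_diff hom_polys_imp_polys hom_polys_diff)
  then have "f v - maxwell ws v = 0" for v
    using harmonic_vanishing_on_cone cone by blast
  then show ?thesis using len by (intro exI[of _ ws]) (auto simp: fun_eq_iff)
qed

text \<open>Sylvester's theorem applied to each term of the decomposition. A term with \<open>2 k < d\<close> gets
  \<open>s ^ (2 (d - k) + 1)\<close> as its factor because the denominator is \<open>s ^ (2 (d - 2 k) + 1)\<close> and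
  \<open>s ^ (2 k) = Q ^ k\<close> has to remain.\<close>

theorem maxwell_representation:
  assumes P: "P \<in> hom_polys d"
  shows "\<exists>(u :: nat \<Rightarrow> nat \<Rightarrow> complex^3) (lam :: complex).
          \<forall>W s. sqrt_branch B W s \<longrightarrow>
            (\<forall>v\<in>W. P v =
               (\<Sum>k | 2 * k \<le> d.
                  if 2 * k = d then lam * qform B v ^ k
                  else s v ^ (2 * (d - k) + 1)
                       * iter_dir_deriv (\<lambda>j. u j k) (d - 2 * k) (\<lambda>w. 1 / s w) v))"
proof -
  obtain h where h: "\<And>k. 2 * k \<le> d \<Longrightarrow> h k \<in> harmonics B (d - 2 * k)"
    "\<And>v. P v = (\<Sum>k | 2 * k \<le> d. Q v ^ k * h k v)"
    using harmonic_decomposition[OF P] by blast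
  have "\<forall>k. \<exists>us. 2 * k < d \<longrightarrow> length us = d - 2 * k \<and> h k = maxwell us"
  proof
    fix k
    show "\<exists>us. 2 * k < d \<longrightarrow> length us = d - 2 * k \<and> h k = maxwell us"
    proof (cases "2 * k < d")
      case True
      then show ?thesis using sylvester[OF h(1)[of k]] by auto
    qed auto
  qed
  then obtain us where us: "\<And>k. 2 * k < d \<Longrightarrow> length (us k) = d - 2 * k \<and> h k = maxwell (us k)"
    by metis
  define u where "u j k = us k ! (j - 1)" for j k
  define lam where "lam = h (d div 2) 0"
  show ?thesis
  proof (intro exI allI impI ballI)
    fix W s v assume s: "sqrt_branch B W s" and v: "v \<in> W"
    have sv: "s v \<noteq> 0" "Q v = (s v)\<^sup>2" using s v by (auto simp: sqrt_branch_def)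
    have "Q v ^ k * h k v = (if 2 * k = d then lam * Q v ^ k
        else s v ^ (2 * (d - k) + 1) * iter_dir_deriv (\<lambda>j. u j k) (d - 2 * k) (\<lambda>w. 1 / s w) v)"
      if k: "2 * k \<le> d" for k
    proof (cases "2 * k = d")
      case True
      then have "h k \<in> hom_polys 0" using h(1)[OF k] by (simp add: harmonics_iff)
      then show ?thesis using True hom_polys_0D[of "h k" v] by (auto simp: lam_def)
    next
      case False
      then have k': "2 * k < d" using k by simp
      define m where "m = d - 2 * k"
      have "map (\<lambda>j. u j k) [1..<Suc m] = us k"
        using us[OF k'] by (intro nth_equalityI) (auto simp: u_def m_def simp del: upt_Suc)
      moreover have "iter_dir_deriv (\<lambda>j. u j k) m f = foldr dir_deriv (map (\<lambda>j. u j k) [1..<Suc m]) f"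
        for f by (simp only: iter_dir_deriv_def foldr_map comp_def)
      ultimately have "iter_dir_deriv (\<lambda>j. u j k) m (\<lambda>w. 1 / s w) v
          = foldr dir_deriv (us k) (\<lambda>w. 1 / s w) v"
        by (simp only:)
      also have "\<dots> = h k v / s v ^ (2 * m + 1)"
        using iterated_derivative_inverse_sqrt[OF s v, of "us k"] us[OF k'] by (simp add: m_def)
      finally have "s v ^ (2 * k + (2 * m + 1)) * iter_dir_deriv (\<lambda>j. u j k) m (\<lambda>w. 1 / s w) v
          = s v ^ (2 * k + (2 * m + 1)) / s v ^ (2 * m + 1) * h k v" by simp
      also have "s v ^ (2 * k + (2 * m + 1)) / s v ^ (2 * m + 1) = Q v ^ k"
        using sv by (simp only: power_add) (simp add: power_mult)
      finally have eq: "s v ^ (2 * k + (2 * m + 1)) * iter_dir_deriv (\<lambda>j. u j k) m (\<lambda>w. 1 / s w) v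
          = Q v ^ k * h k v" .
      have "2 * k + (2 * m + 1) = 2 * (d - k) + 1" using k by (simp add: m_def)
      with eq show ?thesis using False by (simp only: m_def if_False)
    qed
    then show "P v = (\<Sum>k | 2 * k \<le> d. if 2 * k = d then lam * qform B v ^ k
        else s v ^ (2 * (d - k) + 1) * iter_dir_deriv (\<lambda>j. u j k) (d - 2 * k) (\<lambda>w. 1 / s w) v)"
      unfolding h(2) by (intro sum.cong) auto
  qed
qed

end


section \<open>Integration over the unit sphere\<close>

definition cvec :: "real^3 \<Rightarrow> complex^3" where
  "cvec x = (\<chi> i. complex_of_real (x $ i))"

definition sphere_int :: "(complex^3 \<Rightarrow> complex) \<Rightarrow> complex" where
  "sphere_int F = (LINT x|sphere_measure. F (cvec x))"

lemma cvec_nth [simp]: "cvec x $ i = of_real (x $ i)"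
  by (simp add: cvec_def)

lemma cvec_scaleR: "cvec (c *\<^sub>R x) = of_real c *s cvec x"
  by (simp add: vec_eq_iff)

lemma norm_cvec: "norm (cvec x) = norm x"
  by (simp add: norm_vec_def)

lemma continuous_on_cvec: "continuous_on S cvec"
  unfolding cvec_def[abs_def] by (intro continuous_intros)

lemma sets_sphere_measure [simp, measurable_cong]: "sets sphere_measure = sets borel"
  by (simp add: sphere_measure_def)

lemma space_sphere_measure [simp]: "space sphere_measure = UNIV"
  by (simp add: sphere_measure_def space_scale_measure)

lemma emeasure_sphere_measure:
  assumes "A \<in> sets borel"
  shows "emeasure sphere_measure A = 3 * emeasure lborel (sgn -` A \<inter> cball 0 1)"
proof -
  have sgn: "sgn \<in> measurable (restrict_space lborel (cball (0 :: real^3) 1)) borel"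
    by (intro measurable_restrict_space1) simp
  have "sgn -` A \<inter> space (restrict_space lborel (cball (0 :: real^3) 1)) = sgn -` A \<inter> cball 0 1"
    by (simp add: space_restrict_space)
  then show ?thesis
    unfolding sphere_measure_def
    by (simp add: emeasure_distr[OF sgn assms] emeasure_restrict_space)
qed

lemma finite_measure_sphere: "finite_measure sphere_measure"
proof
  have "emeasure lborel (cball (0 :: real^3) 1) < \<infinity>" by (rule emeasure_lborel_cball_finite)
  then show "emeasure sphere_measure (space sphere_measure) \<noteq> \<infinity>"
    by (simp add: emeasure_sphere_measure ennreal_mult_eq_top_iff)
qed

text \<open>The origin is the only point that the radial projection does not send to the sphere.\<close>

lemma AE_sphere_norm: "AE x in sphere_measure. norm x = 1"
proof (rule AE_I)
  let ?N = "{x :: real^3. norm x \<noteq> 1}"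
  have N: "?N \<in> sets borel" by measurable
  have "sgn -` ?N \<inter> cball 0 1 = {0 :: real^3}" by (auto simp: norm_sgn)
  then show "emeasure sphere_measure ?N = 0" by (simp add: emeasure_sphere_measure[OF N])
  show "?N \<in> sets sphere_measure" using N by simp
qed simp

lemma measurable_cvec:
  assumes "continuous_on UNIV F"
  shows "(\<lambda>x. F (cvec x)) \<in> borel_measurable borel"
  by (intro borel_measurable_continuous_onI continuous_on_compose2[OF assms] continuous_on_cvec) auto

lemma measurable_sphere_cvec:
  "continuous_on UNIV F \<Longrightarrow> (\<lambda>x. F (cvec x)) \<in> borel_measurable sphere_measure"
  using measurable_cvec[of F] measurable_cong_sets[OF sets_sphere_measure refl] by blast

lemma integrable_sphere_continuous:
  fixes F :: "complex^3 \<Rightarrow> complex"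
  assumes F: "continuous_on UNIV F"
  shows "integrable sphere_measure (\<lambda>x. F (cvec x))"
proof -
  interpret finite_measure sphere_measure by (rule finite_measure_sphere)
  have "continuous_on (sphere 0 1) (\<lambda>x. F (cvec x))"
    by (intro continuous_on_compose2[OF F] continuous_on_cvec) auto
  then have "bounded ((\<lambda>x. F (cvec x)) ` sphere 0 1)"
    by (intro compact_imp_bounded compact_continuous_image) auto
  then obtain b where "\<forall>x\<in>sphere 0 1. norm (F (cvec x)) \<le> b"
    by (auto simp: bounded_iff)
  then have b: "norm (F (cvec x)) \<le> b" if "norm x = 1" for x
    using that by simp
  show ?thesis
  proof (rule integrable_const_bound[of _ b])
    show "AE x in sphere_measure. norm (F (cvec x)) \<le> b"
      using AE_sphere_norm by eventually_elim (rule b)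
  qed (rule measurable_sphere_cvec[OF F])
qed

lemma integrable_sphere_polys: "F \<in> polys \<Longrightarrow> integrable sphere_measure (\<lambda>x. F (cvec x))"
  by (intro integrable_sphere_continuous polys_continuous)

lemma sphere_int_add:
  "f \<in> polys \<Longrightarrow> g \<in> polys \<Longrightarrow> sphere_int (\<lambda>v. f v + g v) = sphere_int f + sphere_int g"
  by (simp add: sphere_int_def integrable_sphere_polys)

lemma sphere_int_cmult: "sphere_int (\<lambda>v. c * f v) = c * sphere_int f"
  by (simp add: sphere_int_def)

lemma sphere_int_sum:
  "(\<And>i. i \<in> I \<Longrightarrow> f i \<in> polys) \<Longrightarrow> sphere_int (\<lambda>v. \<Sum>i\<in>I. f i v) = (\<Sum>i\<in>I. sphere_int (f i))"
  by (simp add: sphere_int_def integrable_sphere_polys)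

lemma sphere_int_cong:
  assumes "f \<in> polys" "g \<in> polys" "\<And>x. norm x = 1 \<Longrightarrow> f (cvec x) = g (cvec x)"
  shows "sphere_int f = sphere_int g"
  unfolding sphere_int_def
proof (rule integral_cong_AE)
  show "AE x in sphere_measure. f (cvec x) = g (cvec x)"
    using AE_sphere_norm by eventually_elim (rule assms(3))
qed (auto intro!: measurable_sphere_cvec polys_continuous assms)

text \<open>The sphere measure has full support, since the cone over an open patch is a nonempty open
  set up to its apex.\<close>

lemma sphere_int_norm_eq_0:
  fixes F :: "complex^3 \<Rightarrow> complex"
  assumes F: "continuous_on UNIV F"
    and zero: "(LINT x|sphere_measure. (norm (F (cvec x)))\<^sup>2) = 0" and x: "norm x = 1"
  shows "F (cvec x) = 0"
proof (rule ccontr)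
  assume nz: "F (cvec x) \<noteq> 0"
  have cont: "continuous_on UNIV (\<lambda>x. F (cvec x))"
    by (intro continuous_on_compose2[OF F] continuous_on_cvec) auto
  define A where "A = {x. F (cvec x) \<noteq> 0}"
  have A: "open A"
    unfolding A_def by (intro open_Collect_neq cont continuous_intros)
  then have Ab: "A \<in> sets borel" by simp
  have int: "integrable sphere_measure (\<lambda>x. (norm (F (cvec x)))\<^sup>2)"
  proof -
    have "continuous_on UNIV (\<lambda>v. of_real ((norm (F v))\<^sup>2) :: complex)"
      by (intro continuous_intros F)
    from integrable_sphere_continuous[OF this] show ?thesis
      by (simp only: complex_of_real_integrable_eq)
  qed
  have "AE x in sphere_measure. (norm (F (cvec x)))\<^sup>2 = 0"
    using integral_nonneg_eq_0_iff_AE[OF int] zero by simp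
  then have "AE x in sphere_measure. x \<notin> A" by (simp add: A_def)
  then have "A \<in> null_sets sphere_measure" using Ab by (subst AE_iff_null_sets) auto
  then have "emeasure sphere_measure A = 0" by auto
  then have null: "emeasure lborel (sgn -` A \<inter> cball 0 1) = 0"
    by (simp add: emeasure_sphere_measure[OF Ab])
  define C where "C = sgn -` A \<inter> (ball 0 1 - {0 :: real^3})"
  have "continuous_on (ball 0 1 - {0 :: real^3}) sgn"
    by (intro continuous_on_sgn continuous_intros) auto
  then have C: "open C"
    unfolding C_def Int_commute[of "sgn -` A"] using A by (intro continuous_open_preimage) auto
  have "sgn ((1 / 2) *\<^sub>R x) = x" using x by (simp add: sgn_div_norm)
  then have "(1 / 2) *\<^sub>R x \<in> C" using x nz by (auto simp: C_def A_def)
  then have "\<not> negligible C" using open_not_negligible C by blast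
  moreover have "emeasure lborel C = 0"
  proof -
    have "sgn -` A \<inter> cball 0 1 \<in> sets lborel"
      using measurable_sets[OF borel_measurable_sgn Ab] by simp
    then have "emeasure lborel C \<le> emeasure lborel (sgn -` A \<inter> cball 0 1)"
      by (intro emeasure_mono) (auto simp: C_def)
    then show ?thesis using null by simp
  qed
  then have "C \<in> null_sets lebesgue" using C by (intro null_sets_completionI) auto
  ultimately show False by (simp add: negligible_iff_null_sets)
qed

section \<open>Rotation invariance\<close>

text \<open>The passage to the inverse map turns a preimage into an image, to which the invariance of
  Lebesgue measure applies.\<close>

lemma emeasure_orthogonal_vimage:
  fixes R :: "real^3 \<Rightarrow> real^3"
  assumes R: "orthogonal_transformation R" and S: "S \<in> sets borel" "bounded S"
  shows "emeasure lborel (R -` S) = emeasure lborel S"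
proof -
  have inv: "orthogonal_transformation (inv R)" by (rule orthogonal_transformation_inv[OF R])
  have vimage: "R -` S = inv R ` S"
    using bij_vimage_eq_inv_image[OF orthogonal_transformation_bij[OF R]] .
  have "R \<in> borel_measurable borel"
    using orthogonal_transformation_linear[OF R]
    by (intro borel_measurable_continuous_onI linear_continuous_on linear_conv_bounded_linear[THEN iffD1])
  then have RS: "R -` S \<in> sets borel" using measurable_sets[of R borel borel S] S by simp
  have bnd: "bounded (R -` S)"
    unfolding vimage using orthogonal_transformation_linear[OF inv] S(2)
    by (intro bounded_linear_image linear_conv_bounded_linear[THEN iffD1])
  have lm: "S \<in> lmeasurable" using S by (intro bounded_set_imp_lmeasurable) auto
  have "measure lborel (R -` S) = measure lebesgue (inv R ` S)"
    using RS by (simp add: vimage[symmetric])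
  also have "\<dots> = measure lebesgue S" by (rule measure_orthogonal_image[OF inv lm])
  also have "\<dots> = measure lborel S" using S by simp
  finally have "measure lborel (R -` S) = measure lborel S" .
  moreover have "emeasure lborel (R -` S) < \<infinity>" "emeasure lborel S < \<infinity>"
    using emeasure_bounded_finite[OF bnd] emeasure_bounded_finite[OF S(2)] by simp_all
  ultimately show ?thesis by (simp add: emeasure_eq_ennreal_measure)
qed

lemma sphere_measure_rotation:
  fixes R :: "real^3 \<Rightarrow> real^3"
  assumes R: "orthogonal_transformation R"
  shows "distr sphere_measure borel R = sphere_measure"
proof (rule measure_eqI)
  fix A assume "A \<in> sets (distr sphere_measure borel R)"
  then have A: "A \<in> sets borel" by simp
  have Rb: "R \<in> borel_measurable borel"
    using orthogonal_transformation_linear[OF R]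
    by (intro borel_measurable_continuous_onI linear_continuous_on linear_conv_bounded_linear[THEN iffD1])
  then have Rs: "R \<in> measurable sphere_measure borel"
    using measurable_cong_sets[OF sets_sphere_measure refl] by blast
  have RA: "R -` A \<in> sets borel" using measurable_sets[OF Rb A] by simp
  have "sgn (R x) = R (sgn x)" for x
    by (simp add: sgn_div_norm orthogonal_transformation_norm[OF R] orthogonal_transformation_scaleR[OF R])
  then have eq: "sgn -` (R -` A) \<inter> cball 0 1 = R -` (sgn -` A \<inter> cball 0 1)"
    using orthogonal_transformation_norm[OF R] by auto
  have S: "sgn -` A \<inter> cball 0 1 \<in> sets (borel :: (real^3) measure)"
    using measurable_sets[OF borel_measurable_sgn A] by simp
  have bnd: "bounded (sgn -` A \<inter> cball (0 :: real^3) 1)" by (simp add: bounded_Int)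
  show "emeasure (distr sphere_measure borel R) A = emeasure sphere_measure A"
    by (simp only: emeasure_distr[OF Rs A] space_sphere_measure Int_UNIV_right
        emeasure_sphere_measure[OF A] emeasure_sphere_measure[OF RA] eq
        emeasure_orthogonal_vimage[OF R S bnd])
qed simp

definition rot :: "3 \<Rightarrow> 3 \<Rightarrow> real \<Rightarrow> real^3 \<Rightarrow> real^3" where
  "rot i j \<theta> x = (\<chi> k. if k = i then cos \<theta> * x $ i - sin \<theta> * x $ j
    else if k = j then sin \<theta> * x $ i + cos \<theta> * x $ j else x $ k)"

lemma rot_orthogonal:
  assumes "i \<noteq> j"
  shows "orthogonal_transformation (rot i j \<theta>)"
  unfolding orthogonal_transformation_def
proof (intro conjI allI)
  show "linear (rot i j \<theta>)"
    by (rule linearI) (auto simp: rot_def vec_eq_iff algebra_simps)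
  fix v w :: "real^3"
  have sq: "c * c + s * s = 1 \<Longrightarrow> (c * a - s * b) * (c * a' - s * b') + (s * a + c * b) * (s * a' + c * b')
      = a * a' + b * b'" for a b a' b' c s :: real
    by algebra
  have "cos \<theta> * cos \<theta> + sin \<theta> * sin \<theta> = 1"
    using sin_cos_squared_add2[of \<theta>] by (simp add: power2_eq_square)
  note sq = sq[OF this]
  show "rot i j \<theta> v \<bullet> rot i j \<theta> w = v \<bullet> w"
    using exhaust_3[of i] exhaust_3[of j] assms sq[of "v $ i" "v $ j" "w $ i" "w $ j"]
    by (auto simp: rot_def inner_vec_def sum_3)
qed

lemma sphere_int_rot:
  assumes f: "f \<in> polys" and ij: "i \<noteq> j"
  shows "(LINT x|sphere_measure. f (cvec (rot i j \<theta> x))) = sphere_int f"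
proof -
  have "rot i j \<theta> \<in> borel_measurable borel"
    using orthogonal_transformation_linear[OF rot_orthogonal[OF ij]]
    by (intro borel_measurable_continuous_onI linear_continuous_on linear_conv_bounded_linear[THEN iffD1])
  then have "rot i j \<theta> \<in> measurable sphere_measure borel"
    using measurable_cong_sets[OF sets_sphere_measure refl] by blast
  from integral_distr[OF this measurable_cvec[OF polys_continuous[OF f]]] show ?thesis
    by (simp add: sphere_int_def sphere_measure_rotation[OF rot_orthogonal[OF ij]])
qed

definition rot_gen :: "3 \<Rightarrow> 3 \<Rightarrow> (complex^3 \<Rightarrow> complex) \<Rightarrow> complex^3 \<Rightarrow> complex" where
  "rot_gen i j f v = v $ i * dir_deriv (axis j 1) f v - v $ j * dir_deriv (axis i 1) f v"

lemma rot_gen_polys: "f \<in> polys \<Longrightarrow> rot_gen i j f \<in> polys"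
  unfolding rot_gen_def[abs_def] by (intro polys_intros dir_deriv_polys)

text \<open>Invariance under rotations in the \<open>i, j\<close>-plane makes the integral vanish on the image of
  the infinitesimal rotation. The argument is algebraic: polynomials are spanned by weight vectors,
  products of \<open>v\<^sub>i + \<i> v\<^sub>j\<close>, \<open>v\<^sub>i - \<i> v\<^sub>j\<close> and the third coordinate. On
  one of weight \<open>n \<noteq> 0\<close> the rotation by \<open>\<pi> / n\<close> acts as \<open>- 1\<close>, so that its integral is \<open>0\<close>, and
  the infinitesimal rotation multiplies it by \<open>\<i> n\<close>.\<close>

definition weight_vectors :: "3 \<Rightarrow> 3 \<Rightarrow> (complex^3 \<Rightarrow> complex) set" where
  "weight_vectors i j = {f \<in> polys. \<exists>n :: int.
    (\<forall>\<theta> x. f (cvec (rot i j \<theta> x)) = cis (of_int n * \<theta>) * f (cvec x)) \<and>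
    (\<forall>v. rot_gen i j f v = \<i> * of_int n * f v)}"

lemma weight_vectors_mult:
  assumes "f \<in> weight_vectors i j" "g \<in> weight_vectors i j"
  shows "(\<lambda>v. f v * g v) \<in> weight_vectors i j"
proof -
  obtain n m :: int where f: "f \<in> polys"
      "\<And>\<theta> x. f (cvec (rot i j \<theta> x)) = cis (of_int n * \<theta>) * f (cvec x)"
      "\<And>v. rot_gen i j f v = \<i> * of_int n * f v"
    and g: "g \<in> polys" "\<And>\<theta> x. g (cvec (rot i j \<theta> x)) = cis (of_int m * \<theta>) * g (cvec x)"
      "\<And>v. rot_gen i j g v = \<i> * of_int m * g v"
    using assms unfolding weight_vectors_def by blast
  have "rot_gen i j (\<lambda>v. f v * g v) v = rot_gen i j f v * g v + f v * rot_gen i j g v" for v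
    by (simp add: rot_gen_def dir_deriv_mult f(1) g(1) algebra_simps)
  then have "rot_gen i j (\<lambda>v. f v * g v) v = \<i> * of_int (n + m) * (f v * g v)" for v
    by (simp add: f(3) g(3) algebra_simps)
  moreover have "f (cvec (rot i j \<theta> x)) * g (cvec (rot i j \<theta> x))
      = cis (of_int (n + m) * \<theta>) * (f (cvec x) * g (cvec x))" for \<theta> x
    by (simp add: f(2) g(2) distrib_right flip: cis_mult)
  ultimately show ?thesis
    unfolding weight_vectors_def using f(1) g(1) by (blast intro: polys_mult)
qed

lemma weight_vectors_const: "(\<lambda>v. c) \<in> weight_vectors i j"
  unfolding weight_vectors_def
  by (auto intro!: polys_const exI[of _ 0] simp: rot_gen_def dir_deriv_const)

lemma weight_vectors_coord:
  "k \<noteq> i \<Longrightarrow> k \<noteq> j \<Longrightarrow> (\<lambda>v. v $ k) \<in> weight_vectors i j"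
  unfolding weight_vectors_def
  by (auto intro!: polys_coord exI[of _ 0] simp: rot_gen_def dir_deriv_coord rot_def axis_def)

lemma weight_vectors_plus_minus:
  assumes "i \<noteq> j"
  shows "(\<lambda>v. v $ i + \<i> * v $ j) \<in> weight_vectors i j" (is ?plus)
    and "(\<lambda>v. v $ i - \<i> * v $ j) \<in> weight_vectors i j" (is ?minus)
proof -
  have d: "dir_deriv u (\<lambda>v. v $ i + \<i> * v $ j) = (\<lambda>v. u $ i + \<i> * u $ j)"
    "dir_deriv u (\<lambda>v. v $ i - \<i> * v $ j) = (\<lambda>v. u $ i - \<i> * u $ j)" for u
    by (rule dir_derivI, auto intro!: derivative_eq_intros)+
  have "rot_gen i j (\<lambda>v. v $ i + \<i> * v $ j) v = \<i> * of_int 1 * (v $ i + \<i> * v $ j)" for v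
    using assms by (simp add: rot_gen_def d axis_def algebra_simps)
  moreover have "cvec (rot i j \<theta> x) $ i + \<i> * cvec (rot i j \<theta> x) $ j
      = cis (of_int 1 * \<theta>) * (cvec x $ i + \<i> * cvec x $ j)" for \<theta> x
    using assms by (simp add: rot_def complex_eq_iff)
  ultimately show ?plus
    unfolding weight_vectors_def by (auto intro!: polys_intros exI[of _ 1])
  have "rot_gen i j (\<lambda>v. v $ i - \<i> * v $ j) v = \<i> * of_int (- 1) * (v $ i - \<i> * v $ j)" for v
    using assms by (simp add: rot_gen_def d axis_def algebra_simps)
  moreover have "cvec (rot i j \<theta> x) $ i - \<i> * cvec (rot i j \<theta> x) $ j
      = cis (of_int (- 1) * \<theta>) * (cvec x $ i - \<i> * cvec x $ j)" for \<theta> x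
    using assms by (simp add: rot_def complex_eq_iff)
  ultimately show ?minus
    unfolding weight_vectors_def by (auto intro!: polys_intros exI[of _ "- 1"])
qed

text \<open>Weight vectors are closed under products and the coordinates are sums of weight vectors.\<close>

lemma polys_span_weight_vectors:
  assumes ij: "i \<noteq> j" and f: "f \<in> polys"
  shows "f \<in> cfun.span (weight_vectors i j)"
  using f
proof (induction rule: polys_induct)
  case (const c)
  show ?case by (intro cfun.span_base weight_vectors_const)
next
  case (coord k)
  let ?p = "\<lambda>v. v $ i + \<i> * v $ j" and ?m = "\<lambda>v. v $ i - \<i> * v $ j"
  have pm: "cscale a ?p + cscale b ?m \<in> cfun.span (weight_vectors i j)" for a b
    by (intro cfun.span_add cfun.span_scale cfun.span_base weight_vectors_plus_minus ij)
  consider "k = i" | "k = j" | "k \<noteq> i" "k \<noteq> j" by blast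
  then show ?case
  proof cases
    case 1
    have "(\<lambda>v. v $ k) = cscale (1 / 2) ?p + cscale (1 / 2) ?m"
      by (simp add: 1 cscale_def fun_eq_iff algebra_simps)
    then show ?thesis using pm by (simp only:)
  next
    case 2
    have "(\<lambda>v. v $ k) = cscale (- \<i> / 2) ?p + cscale (\<i> / 2) ?m"
      by (simp add: 2 cscale_def fun_eq_iff algebra_simps)
    then show ?thesis using pm by (simp only:)
  next
    case 3
    then show ?thesis by (intro cfun.span_base weight_vectors_coord) auto
  qed
next
  case (add f g)
  then have "f + g \<in> cfun.span (weight_vectors i j)" by (intro cfun.span_add)
  then show ?case by (simp add: plus_fun_def)
next
  case (mult f g)
  show ?case
    by (rule span_mult_closed[OF mult.IH]) (intro cfun.span_base weight_vectors_mult)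
qed

lemma sphere_int_weight_vector:
  assumes ij: "i \<noteq> j" and f: "f \<in> weight_vectors i j"
  shows "sphere_int (rot_gen i j f) = 0"
proof -
  obtain n :: int where fp: "f \<in> polys"
    and rot: "\<And>\<theta> x. f (cvec (rot i j \<theta> x)) = cis (of_int n * \<theta>) * f (cvec x)"
    and gen: "rot_gen i j f = (\<lambda>v. \<i> * of_int n * f v)"
    using f unfolding weight_vectors_def by blast
  have "of_int n * sphere_int f = 0"
  proof (cases "n = 0")
    case False
    then have "f (cvec (rot i j (pi / of_int n) x)) = - f (cvec x)" for x
      by (simp add: rot cis_pi)
    then have "sphere_int f = - sphere_int f"
      using sphere_int_rot[OF fp ij, of "pi / of_int n"] by (simp add: sphere_int_def)
    then show ?thesis by simp
  qed simp
  then show ?thesis unfolding gen sphere_int_cmult by simp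
qed

lemma sphere_int_rot_gen:
  assumes ij: "i \<noteq> j" and f: "f \<in> polys"
  shows "sphere_int (rot_gen i j f) = 0"
proof -
  have "f \<in> polys \<and> sphere_int (rot_gen i j f) = 0"
    using polys_span_weight_vectors[OF ij f]
  proof (induction rule: cfun.span_induct_alt)
    case base
    have "rot_gen i j 0 = (\<lambda>v. 0)"
      by (simp add: rot_gen_def fun_eq_iff zero_fun_def dir_deriv_const)
    then show ?case
      using polys_const[of 0] by (simp add: sphere_int_def zero_fun_def)
  next
    case (step c x y)
    have x: "x \<in> polys" using step by (simp add: weight_vectors_def)
    have y: "y \<in> polys" using step by simp
    have eq: "rot_gen i j (cscale c x + y) = (\<lambda>v. c * rot_gen i j x v + rot_gen i j y v)"
      unfolding cscale_plus
      by (simp add: rot_gen_def[abs_def] dir_deriv_add dir_deriv_cmult polys_scale x y algebra_simps)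
    have "sphere_int (rot_gen i j (cscale c x + y)) = 0"
      unfolding eq
      using sphere_int_add[OF polys_scale[OF rot_gen_polys[OF x]] rot_gen_polys[OF y]]
        sphere_int_cmult[of c "rot_gen i j x"] sphere_int_weight_vector[OF ij] step
      by simp
    moreover have "cscale c x + y \<in> polys" unfolding cscale_plus by (intro polys_intros x y)
    ultimately show ?case by blast
  qed
  then show ?thesis ..
qed

section \<open>Orthogonality of harmonics of different degrees\<close>

lemma qform_mat_1_cvec: "qform (mat 1) (cvec x) = of_real ((norm x)\<^sup>2)"
proof -
  have eq: "(norm x)\<^sup>2 = (x $ 1)\<^sup>2 + (x $ 2)\<^sup>2 + (x $ 3)\<^sup>2"
    unfolding power2_norm_eq_inner by (simp add: inner_vec_def sum_3 power2_eq_square)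
  show ?thesis unfolding eq by (simp add: qform_mat_1)
qed

text \<open>The divergence theorem on the ball, restated on the sphere. It is the sum over \<open>j\<close> of
  \<open>\<integral> rot_gen i j (v\<^sub>j f) = 0\<close>: by Euler's identity the integrands add up to
  \<open>(d + 2) v\<^sub>i f - |v|\<^sup>2 \<partial>\<^sub>i f\<close>, and \<open>|v| = 1\<close> on the sphere.\<close>

lemma sphere_int_coord_mult:
  assumes f: "f \<in> hom_polys d"
  shows "of_nat (d + 2) * sphere_int (\<lambda>v. v $ i * f v) = sphere_int (dir_deriv (axis i 1) f)"
proof -
  have fp: "f \<in> polys" using f by (rule hom_polys_imp_polys)
  define D where "D k = dir_deriv (axis k 1) f" for k
  have Dp: "D k \<in> polys" for k unfolding D_def by (intro dir_deriv_polys fp)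
  have gen: "rot_gen i j (\<lambda>v. v $ j * f v) v =
      v $ i * f v + v $ i * (v $ j * D j v) - v $ j * axis i 1 $ j * f v - v $ j * v $ j * D i v" for j v
    by (simp add: rot_gen_def dir_deriv_mult dir_deriv_coord polys_coord fp D_def axis_def algebra_simps)
  have "(\<Sum>j\<in>UNIV. rot_gen i j (\<lambda>v. v $ j * f v) v)
      = of_nat (d + 2) * (v $ i * f v) + - 1 * (qform (mat 1) v * D i v)" for v
  proof -
    have ax: "(\<Sum>j\<in>UNIV. v $ j * axis i 1 $ j * f v) = v $ i * f v"
      using exhaust_3[of i] by (auto simp: sum_3 axis_def)
    have "(\<Sum>j\<in>UNIV. rot_gen i j (\<lambda>v. v $ j * f v) v) = 3 * (v $ i * f v)
        + v $ i * (\<Sum>j\<in>UNIV. v $ j * D j v) - v $ i * f v - (\<Sum>j\<in>UNIV. v $ j * v $ j) * D i v"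
      unfolding gen sum.distrib sum_subtractf ax
      by (simp add: sum_distrib_left sum_distrib_right)
    also have "(\<Sum>j\<in>UNIV. v $ j * D j v) = of_nat d * f v"
      unfolding D_def by (rule euler_identity[OF f])
    also have "(\<Sum>j\<in>UNIV. v $ j * v $ j) = qform (mat 1) v"
      by (simp add: qform_mat_1 sum_3 power2_eq_square)
    finally show ?thesis by (simp add: algebra_simps)
  qed
  note sum_gen = this
  have "rot_gen i j g v = 0" if "i = j" for j g v using that by (simp add: rot_gen_def)
  then have zero: "sphere_int (rot_gen i j g) = 0" if "g \<in> polys" for j g
    using sphere_int_rot_gen[of i j g] that by (cases "i = j") (auto simp: sphere_int_def)
  have "sphere_int (\<lambda>v. \<Sum>j\<in>UNIV. rot_gen i j (\<lambda>v. v $ j * f v) v) = 0"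
    by (subst sphere_int_sum) (simp_all add: rot_gen_polys polys_mult polys_coord fp zero)
  then have "of_nat (d + 2) * sphere_int (\<lambda>v. v $ i * f v)
      + - 1 * sphere_int (\<lambda>v. qform (mat 1) v * D i v) = 0"
    unfolding sum_gen
    by (simp only: sphere_int_add sphere_int_cmult polys_scale polys_mult polys_coord fp Dp
        qform_polys)
  moreover have "sphere_int (\<lambda>v. qform (mat 1) v * D i v) = sphere_int (D i)"
    by (rule sphere_int_cong) (auto simp: qform_mat_1_cvec intro!: polys_intros qform_polys Dp)
  ultimately show ?thesis by (simp add: D_def algebra_simps)
qed

lemma matrix_inv_mat_1: "matrix_inv (mat 1 :: complex^3^3) = mat 1"
  by (rule matrix_inv_unique) (auto simp: invertible_def)

lemma laplacian_mat_1:
  "laplacian (mat 1) f v = (\<Sum>i\<in>UNIV. dir_deriv (axis i 1) (dir_deriv (axis i 1) f) v)"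
  unfolding laplacian_def matrix_inv_mat_1 by (simp add: mat_def sum_3)

text \<open>Write \<open>m h = \<Sum> v\<^sub>i \<partial>\<^sub>i h\<close> and apply the previous identity to the forms \<open>(\<partial>\<^sub>i h) g\<close> of degree
  \<open>m + n - 1\<close>; in \<open>\<Sum> \<partial>\<^sub>i ((\<partial>\<^sub>i h) g)\<close> the second derivatives of \<open>h\<close> add up to \<open>0\<close>.\<close>

lemma sphere_int_gradients:
  assumes h: "h \<in> harmonics (mat 1) m" and g: "g \<in> hom_polys n"
  shows "of_nat (m * (m + n + 1)) * sphere_int (\<lambda>v. h v * g v) =
    sphere_int (\<lambda>v. \<Sum>i\<in>UNIV. dir_deriv (axis i 1) h v * dir_deriv (axis i 1) g v)"
proof (cases m)
  case 0
  then have "dir_deriv (axis i 1) h = (\<lambda>v. 0)" for i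
    using h by (intro dir_deriv_hom_0) (simp add: harmonics_def)
  then show ?thesis using 0 by (simp add: sphere_int_def)
next
  case (Suc k)
  define D where "D i = dir_deriv (axis i 1) h" for i
  have hh: "h \<in> hom_polys m" "\<And>v. laplacian (mat 1) h v = 0"
    using h by (auto simp: harmonics_def fun_eq_iff)
  have hp: "h \<in> polys" and gp: "g \<in> polys" using hh(1) g hom_polys_imp_polys by auto
  have Dp: "D i \<in> polys" for i unfolding D_def by (intro dir_deriv_polys hp)
  have D: "D i \<in> hom_polys k" for i
    unfolding D_def using dir_deriv_hom_polys[OF hh(1), of "axis i 1"] Suc by simp
  have one: "of_nat (m + n + 1) * sphere_int (\<lambda>v. v $ i * (D i v * g v))
      = sphere_int (\<lambda>v. dir_deriv (axis i 1) (D i) v * g v + D i v * dir_deriv (axis i 1) g v)" for i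
    using sphere_int_coord_mult[OF hom_polys_mult[OF D[of i] g], of i] Suc
    by (simp add: dir_deriv_mult Dp gp algebra_simps)
  have "of_nat (m * (m + n + 1)) * sphere_int (\<lambda>v. h v * g v)
      = of_nat (m + n + 1) * sphere_int (\<lambda>v. of_nat m * (h v * g v))"
    by (simp add: sphere_int_cmult algebra_simps)
  also have "(\<lambda>v. of_nat m * (h v * g v)) = (\<lambda>v. \<Sum>i\<in>UNIV. v $ i * (D i v * g v))"
  proof
    fix v
    have "of_nat m * (h v * g v) = (\<Sum>i\<in>UNIV. v $ i * D i v) * g v"
      unfolding D_def euler_identity[OF hh(1)] by simp
    then show "of_nat m * (h v * g v) = (\<Sum>i\<in>UNIV. v $ i * (D i v * g v))"
      by (simp add: sum_distrib_right mult.assoc)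
  qed
  also have "sphere_int \<dots> = (\<Sum>i\<in>UNIV. sphere_int (\<lambda>v. v $ i * (D i v * g v)))"
    by (rule sphere_int_sum) (intro polys_intros Dp gp)
  also have "of_nat (m + n + 1) * \<dots> = (\<Sum>i\<in>UNIV. sphere_int
      (\<lambda>v. dir_deriv (axis i 1) (D i) v * g v + D i v * dir_deriv (axis i 1) g v))"
    unfolding sum_distrib_left one ..
  also have "\<dots> = sphere_int (\<lambda>v. \<Sum>i\<in>UNIV.
      dir_deriv (axis i 1) (D i) v * g v + D i v * dir_deriv (axis i 1) g v)"
    by (rule sphere_int_sum[symmetric]) (intro polys_intros Dp gp dir_deriv_polys)
  also have "(\<lambda>v. \<Sum>i\<in>UNIV. dir_deriv (axis i 1) (D i) v * g v + D i v * dir_deriv (axis i 1) g v)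
      = (\<lambda>v. \<Sum>i\<in>UNIV. D i v * dir_deriv (axis i 1) g v)"
  proof
    fix v
    have "(\<Sum>i\<in>UNIV. dir_deriv (axis i 1) (D i) v) = 0"
      using hh(2)[of v] by (simp add: laplacian_mat_1 D_def)
    then show "(\<Sum>i\<in>UNIV. dir_deriv (axis i 1) (D i) v * g v + D i v * dir_deriv (axis i 1) g v)
        = (\<Sum>i\<in>UNIV. D i v * dir_deriv (axis i 1) g v)"
      by (simp add: sum.distrib flip: sum_distrib_right)
  qed
  finally show ?thesis by (simp add: D_def)
qed

text \<open>The integral of the gradients is symmetric in \<open>h\<close> and \<open>g\<close>, the factor \<open>m (m + n + 1)\<close> is not.\<close>

lemma harmonics_orthogonal:
  assumes h: "h \<in> harmonics (mat 1) m" and g: "g \<in> harmonics (mat 1) n" and "m \<noteq> n"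
  shows "sphere_int (\<lambda>v. h v * g v) = 0"
proof -
  have "of_nat (m * (m + n + 1)) * sphere_int (\<lambda>v. h v * g v)
      = of_nat (n * (n + m + 1)) * sphere_int (\<lambda>v. g v * h v)"
    using sphere_int_gradients[OF h, of g n] sphere_int_gradients[OF g, of h m] h g
    by (simp add: harmonics_def mult.commute)
  moreover have "m * (m + n + 1) \<noteq> n * (n + m + 1)"
    unfolding add.commute[of n m] mult_cancel2 using \<open>m \<noteq> n\<close> by simp
  then have "of_nat (m * (m + n + 1)) \<noteq> (of_nat (n * (n + m + 1)) :: complex)"
    by (simp only: of_nat_eq_iff not_False_eq_True)
  ultimately show ?thesis by (simp add: mult.commute)
qed


section \<open>The Hermitian inner product on the real form\<close>

text \<open>Complex conjugation on the real sphere is realized by a polynomial: conjugate the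
  coefficients.\<close>

definition conj_poly :: "(complex^3 \<Rightarrow> complex) \<Rightarrow> complex^3 \<Rightarrow> complex" where
  "conj_poly f v = cnj (f (\<chi> i. cnj (v $ i)))"

lemma conj_poly_cvec: "conj_poly f (cvec x) = cnj (f (cvec x))"
  by (simp add: conj_poly_def cvec_def)

lemma conj_poly_polys: "f \<in> polys \<Longrightarrow> conj_poly f \<in> polys"
  unfolding conj_poly_def[abs_def]
  by (induction rule: polys_induct) (auto intro: polys_intros)

lemma conj_poly_hom_polys:
  assumes f: "f \<in> hom_polys d"
  shows "conj_poly f \<in> hom_polys d"
proof -
  have "(\<chi> i. cnj ((c *s v) $ i)) = cnj c *s (\<chi> i. cnj (v $ i))" for c and v :: "complex^3"
    by (simp add: vec_eq_iff)
  then have "conj_poly f (c *s v) = c ^ d * conj_poly f v" for c v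
    by (simp add: conj_poly_def hom_polysD[OF f])
  then show ?thesis
    using conj_poly_polys[OF hom_polys_imp_polys[OF f]] by (simp add: hom_polys_iff)
qed

lemma dir_deriv_conj_poly:
  "f \<in> polys \<Longrightarrow> dir_deriv (axis i 1) (conj_poly f) = conj_poly (dir_deriv (axis i 1) f)"
proof (induction rule: polys_induct)
  case (const c)
  show ?case by (simp add: conj_poly_def[abs_def] dir_deriv_const)
next
  case (coord k)
  show ?case by (simp add: conj_poly_def[abs_def] dir_deriv_coord axis_def)
next
  case (add f g)
  have "conj_poly (\<lambda>v. f v + g v) = (\<lambda>v. conj_poly f v + conj_poly g v)" for f g
    by (simp add: conj_poly_def fun_eq_iff)
  then show ?case using add by (simp add: dir_deriv_add conj_poly_polys)
next
  case (mult f g)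
  have m: "conj_poly (\<lambda>v. f v * g v) = (\<lambda>v. conj_poly f v * conj_poly g v)" for f g
    by (simp add: conj_poly_def fun_eq_iff)
  have a: "conj_poly (\<lambda>v. f v + g v) = (\<lambda>v. conj_poly f v + conj_poly g v)" for f g
    by (simp add: conj_poly_def fun_eq_iff)
  show ?case using mult by (simp add: m a dir_deriv_mult conj_poly_polys)
qed

lemma conj_poly_harmonics:
  assumes f: "f \<in> harmonics (mat 1) d"
  shows "conj_poly f \<in> harmonics (mat 1) d"
proof -
  have fh: "f \<in> hom_polys d" and fl: "\<And>v. laplacian (mat 1) f v = 0"
    using f by (auto simp: harmonics_def fun_eq_iff)
  have fp: "f \<in> polys" using fh by (rule hom_polys_imp_polys)
  have "laplacian (mat 1) (conj_poly f) v = conj_poly (laplacian (mat 1) f) v" for v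
    by (simp add: laplacian_mat_1 dir_deriv_conj_poly fp dir_deriv_polys)
      (simp add: conj_poly_def laplacian_mat_1)
  then show ?thesis
    using conj_poly_hom_polys[OF fh] fl by (simp add: harmonics_def fun_eq_iff conj_poly_def)
qed

text \<open>A polynomial is determined by its values at real vectors, because one in a single variable
  is determined by its values on the real line.\<close>

lemma polys_eq_0_if_real:
  assumes f: "f \<in> polys" and zero: "\<And>x. f (cvec x) = 0"
  shows "f w = 0"
proof -
  define a b where "a = (\<chi> i. Re (w $ i))" and "b = (\<chi> i. Im (w $ i))"
  obtain p where p: "\<And>t. f (cvec a + t *s cvec b) = poly p t"
    using polys_along_line[OF f] by blast
  have "poly p (of_real r) = 0" for r
  proof -
    have "cvec a + of_real r *s cvec b = cvec (a + r *\<^sub>R b)" by (simp add: vec_eq_iff)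
    then show ?thesis using p[of "of_real r"] zero by simp
  qed
  then have "range complex_of_real \<subseteq> {z. poly p z = 0}" by auto
  moreover have "infinite (range complex_of_real)"
    by (simp add: finite_image_iff inj_of_real infinite_UNIV_char_0)
  ultimately have "p = 0" using poly_roots_finite finite_subset by blast
  moreover have "w = cvec a + \<i> *s cvec b"
    by (simp add: vec_eq_iff a_def b_def complex_eq_iff)
  ultimately show ?thesis using p[of \<i>] by simp
qed

lemma herm_prod_sphere:
  assumes A: "invertible A" and f: "f \<in> polys" and g: "g \<in> polys"
  shows "herm_prod A f g =
    (LINT x|sphere_measure. f (cvec x v* matrix_inv A) * cnj (g (cvec x v* matrix_inv A)))"
proof -
  define U where "U = matrix_inv A"
  have UA: "U ** A = mat 1" unfolding U_def by (rule matrix_inv_inverse(2)[OF A])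
  define F where "F v = indicator (real_form_sphere A) v *\<^sub>R (f v * cnj (g v))" for v
  have lin: "continuous_on S (\<lambda>v. v v* M)" for S and M :: "complex^3^3"
    unfolding vector_matrix_mult_def by (intro continuous_intros)
  have "closed (real_form_sphere A)"
  proof -
    have "real_form_sphere A = (\<Inter>i. {v. Im ((v v* A) $ i) = 0}) \<inter> {v. norm (v v* A) = 1}"
      by (auto simp: real_form_sphere_def complex_is_Real_iff)
    moreover have "closed {v. Im ((v v* A) $ i) = 0}" for i
      by (intro closed_Collect_eq continuous_intros lin)
    moreover have "closed {v. norm (v v* A) = 1}"
      by (intro closed_Collect_eq continuous_intros lin)
    ultimately show ?thesis by (simp add: closed_Int closed_INT)
  qed
  then have "real_form_sphere A \<in> sets borel" by simp
  moreover have "(\<lambda>v. f v * cnj (g v)) \<in> borel_measurable borel"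
    by (intro borel_measurable_continuous_onI continuous_intros polys_continuous f g)
  ultimately have F: "F \<in> borel_measurable borel"
    unfolding F_def[abs_def] by (intro borel_measurable_scaleR borel_measurable_indicator)
  have T: "(\<lambda>x. cvec x v* U) \<in> measurable sphere_measure borel"
    by (rule measurable_sphere_cvec[OF lin])
  have "herm_prod A f g = (LINT v|real_form_measure A. F v)"
    by (simp add: herm_prod_def set_lebesgue_integral_def F_def)
  also have "\<dots> = (LINT v|distr sphere_measure borel (\<lambda>x. cvec x v* U). F v)"
    by (simp add: real_form_measure_def cvec_def U_def)
  also have "\<dots> = (LINT x|sphere_measure. F (cvec x v* U))"
    by (rule integral_distr[OF T F])
  also have "\<dots> = (LINT x|sphere_measure. f (cvec x v* U) * cnj (g (cvec x v* U)))"
  proof (rule integral_cong_AE)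
    have "cvec x v* U \<in> real_form_sphere A" if "norm x = 1" for x
      using that by (simp add: real_form_sphere_def vector_matrix_mul_assoc UA norm_cvec)
    then show "AE x in sphere_measure. F (cvec x v* U) = f (cvec x v* U) * cnj (g (cvec x v* U))"
      using AE_sphere_norm by (auto simp: F_def elim!: AE_mp)
    show "(\<lambda>x. F (cvec x v* U)) \<in> borel_measurable sphere_measure"
      using measurable_compose[OF T F] .
    show "(\<lambda>x. f (cvec x v* U) * cnj (g (cvec x v* U))) \<in> borel_measurable sphere_measure"
      by (rule measurable_sphere_cvec)
        (intro continuous_intros polys_continuous polys_linear_subst f g)
  qed
  finally show ?thesis by (simp add: U_def)
qed

lemma herm_prod_sphere_int:
  assumes "invertible A" "f \<in> polys" "g \<in> polys"
  shows "herm_prod A f g = sphere_int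
    (\<lambda>w. f (w v* matrix_inv A) * conj_poly (\<lambda>w. g (w v* matrix_inv A)) w)"
  by (simp add: herm_prod_sphere[OF assms] sphere_int_def conj_poly_cvec)

lemma herm_prod_commute:
  assumes "invertible A" "f \<in> polys" "g \<in> polys"
  shows "herm_prod A g f = cnj (herm_prod A f g)"
  unfolding herm_prod_sphere[OF assms] herm_prod_sphere[OF assms(1,3,2)]
  by (subst Bochner_Integration.integral_cnj[symmetric]) (simp add: mult.commute)

lemma herm_prod_add:
  assumes "invertible A" "f \<in> polys" "g \<in> polys" "h \<in> polys"
  shows "herm_prod A (\<lambda>v. f v + g v) h = herm_prod A f h + herm_prod A g h"
proof -
  have c: "conj_poly (\<lambda>w. h (w v* matrix_inv A)) \<in> polys"
    by (intro conj_poly_polys polys_linear_subst assms)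
  show ?thesis
    unfolding herm_prod_sphere_int[OF assms(1) polys_add[OF assms(2,3)] assms(4)]
      herm_prod_sphere_int[OF assms(1,2,4)] herm_prod_sphere_int[OF assms(1,3,4)] distrib_right
    by (intro sphere_int_add polys_mult polys_linear_subst assms c)
qed

lemma herm_prod_scale:
  assumes "invertible A" "f \<in> polys" "g \<in> polys"
  shows "herm_prod A (\<lambda>v. c * f v) g = c * herm_prod A f g"
  unfolding herm_prod_sphere_int[OF assms] herm_prod_sphere_int[OF assms(1) polys_scale[OF assms(2)] assms(3)]
  by (simp only: mult.assoc sphere_int_cmult)

lemma herm_prod_sum:
  assumes "invertible A" "\<And>k. k \<in> K \<Longrightarrow> f k \<in> polys" "g \<in> polys"
  shows "herm_prod A (\<lambda>v. \<Sum>k\<in>K. f k v) g = (\<Sum>k\<in>K. herm_prod A (f k) g)"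
  using assms(2)
proof (induction K rule: infinite_finite_induct)
  case (insert k K)
  then show ?case
    using herm_prod_add[OF assms(1), of "f k" "\<lambda>v. \<Sum>k\<in>K. f k v" g] assms(3)
    by (simp add: polys_sum)
qed (use herm_prod_scale[OF assms(1) polys_const assms(3), of 0 0] in auto)

text \<open>If the integral of \<open>|f|\<^sup>2\<close> is zero, then \<open>f\<close> vanishes on the real form of the unit sphere, by
  homogeneity at all nonzero vectors of the real form, and hence everywhere. The factor \<open>w\<^sub>1\<close> in the
  proof takes care of the origin.\<close>

lemma herm_prod_positive:
  assumes A: "invertible A" and f: "f \<in> hom_polys d" and nz: "f \<noteq> 0"
  shows "0 < Re (herm_prod A f f)"
proof -
  define g where "g w = f (w v* matrix_inv A)" for w
  have g: "g \<in> hom_polys d" unfolding g_def[abs_def] by (rule hom_polys_linear_subst[OF f])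
  have fp: "f \<in> polys" and gp: "g \<in> polys" using f g by (auto intro: hom_polys_imp_polys)
  have "herm_prod A f f = (LINT x|sphere_measure. of_real ((norm (g (cvec x)))\<^sup>2))"
    unfolding herm_prod_sphere[OF A fp fp] by (simp add: g_def complex_norm_square del: of_real_power)
  then have eq: "Re (herm_prod A f f) = (LINT x|sphere_measure. (norm (g (cvec x)))\<^sup>2)"
    by (simp only: integral_complex_of_real Re_complex_of_real)
  have "(LINT x|sphere_measure. (norm (g (cvec x)))\<^sup>2) \<noteq> 0"
  proof
    assume "(LINT x|sphere_measure. (norm (g (cvec x)))\<^sup>2) = 0"
    then have sphere: "g (cvec x) = 0" if "norm x = 1" for x
      using sphere_int_norm_eq_0 polys_continuous[OF gp] that by blast
    have "g (cvec x) = 0" if "x \<noteq> 0" for x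
    proof -
      have "cvec x = of_real (norm x) *s cvec (sgn x)"
        using that by (simp add: sgn_div_norm flip: cvec_scaleR)
      then have "g (cvec x) = of_real (norm x) ^ d * g (cvec (sgn x))"
        by (simp only: hom_polysD[OF g])
      then show ?thesis using sphere[of "sgn x"] that by (simp add: norm_sgn)
    qed
    then have real: "g (cvec x) * cvec x $ 1 = 0" for x
      by (cases "x = 0") auto
    have prod: "g w * w $ 1 = 0" for w
      by (rule polys_eq_0_if_real[of "\<lambda>w. g w * w $ 1"])
        (rule polys_mult[OF gp polys_coord], rule real)
    have "g w = 0" for w
      by (rule polys_no_zero_divisors[OF gp polys_coord prod, where w = "axis 1 1"])
        (simp add: axis_def)
    then have "f v = 0" for v
      using matrix_inv_inverse(1)[OF A]
      by (metis g_def vector_matrix_mul_assoc vector_matrix_mul_rid)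
    then show False using nz by (auto simp: fun_eq_iff)
  qed
  moreover have "(LINT x|sphere_measure. (norm (g (cvec x)))\<^sup>2) \<ge> 0" by simp
  ultimately show ?thesis unfolding eq by linarith
qed

lemma herm_prod_is_hermitian_inner_product:
  assumes A: "invertible A"
  shows "hermitian_inner_product_on (hom_polys d) (herm_prod A)"
  unfolding hermitian_inner_product_on_def
  by (auto simp: plus_fun_def cscale_def A hom_polys_imp_polys herm_prod_add herm_prod_scale
      intro: herm_prod_commute herm_prod_positive)

section \<open>The invariant orthogonal decomposition\<close>

context nondegenerate_form
begin

lemma harmonics_polys: "h \<in> harmonics B d \<Longrightarrow> h \<in> polys"
  by (auto simp: harmonics_iff intro: hom_polys_imp_polys)

lemma qpow_harmonics_hom_polys:
  assumes "f \<in> qpow_harmonics B d k" "2 * k \<le> d"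
  shows "f \<in> hom_polys d"
proof -
  obtain h where h: "h \<in> harmonics B (d - 2 * k)" "f = (\<lambda>v. Q v ^ k * h v)"
    using assms(1) unfolding qpow_harmonics_def by blast
  have "h \<in> hom_polys (d - 2 * k)" using h(1) by (simp add: harmonics_iff)
  then show ?thesis
    using hom_polys_mult[OF qform_power_hom_polys, of h "d - 2 * k" B k] assms(2) by (simp add: h(2))
qed

lemma qpow_harmonics_subspace: "cfun.subspace (qpow_harmonics B d k)"
proof (rule cfun.subspaceI)
  have "(\<lambda>v. 0) \<in> harmonics B (d - 2 * k)"
    using hom_polys_zero laplacian_const[of B 0] by (auto simp: harmonics_iff)
  then show "0 \<in> qpow_harmonics B d k"
    unfolding qpow_harmonics_def by (rule rev_image_eqI) (simp add: fun_eq_iff)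
next
  fix x y assume "x \<in> qpow_harmonics B d k" "y \<in> qpow_harmonics B d k"
  then obtain f g where f: "f \<in> harmonics B (d - 2 * k)" "x = (\<lambda>v. Q v ^ k * f v)"
    and g: "g \<in> harmonics B (d - 2 * k)" "y = (\<lambda>v. Q v ^ k * g v)"
    unfolding qpow_harmonics_def by blast
  have "(\<lambda>v. f v + g v) \<in> harmonics B (d - 2 * k)"
    using f(1) g(1) harmonics_polys[OF f(1)] harmonics_polys[OF g(1)]
    by (simp add: harmonics_iff hom_polys_add laplacian_add)
  then show "x + y \<in> qpow_harmonics B d k"
    unfolding qpow_harmonics_def
    by (rule rev_image_eqI) (simp add: fun_eq_iff f(2) g(2) distrib_left)
next
  fix c x assume "x \<in> qpow_harmonics B d k"
  then obtain f where f: "f \<in> harmonics B (d - 2 * k)" "x = (\<lambda>v. Q v ^ k * f v)"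
    unfolding qpow_harmonics_def by blast
  have "(\<lambda>v. c * f v) \<in> harmonics B (d - 2 * k)"
    using f(1) harmonics_polys[OF f(1)]
    by (simp add: harmonics_iff hom_polys_scale laplacian_cmult)
  then show "cscale c x \<in> qpow_harmonics B d k"
    unfolding qpow_harmonics_def
    by (rule rev_image_eqI) (simp add: fun_eq_iff f(2) cscale_def)
qed

lemma harmonic_direct_sum:
  "internal_direct_sum {k. 2 * k \<le> d} (qpow_harmonics B d) (hom_polys d)"
  unfolding internal_direct_sum_def
proof (intro conjI ballI allI impI)
  show "cfun.subspace (qpow_harmonics B d k)" for k by (rule qpow_harmonics_subspace)
  show "hom_polys d = {\<Sum>k | 2 * k \<le> d. h k |h. \<forall>k\<in>{k. 2 * k \<le> d}. h k \<in> qpow_harmonics B d k}"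
    (is "_ = ?S")
  proof (intro equalityI subsetI)
    fix f assume "f \<in> hom_polys d"
    then obtain h where h: "\<And>k. 2 * k \<le> d \<Longrightarrow> h k \<in> harmonics B (d - 2 * k)"
      "\<And>v. f v = (\<Sum>k | 2 * k \<le> d. Q v ^ k * h k v)"
      using harmonic_decomposition by blast
    have "f = (\<Sum>k | 2 * k \<le> d. (\<lambda>v. Q v ^ k * h k v))"
      by (simp add: fun_eq_iff sum_fun_apply h(2))
    moreover have "(\<lambda>v. Q v ^ k * h k v) \<in> qpow_harmonics B d k" if "2 * k \<le> d" for k
      using h(1)[OF that] by (auto simp: qpow_harmonics_def)
    ultimately show "f \<in> ?S" by blast
  next
    fix f assume "f \<in> ?S"
    then obtain h where h: "f = (\<Sum>k | 2 * k \<le> d. h k)"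
      "\<And>k. 2 * k \<le> d \<Longrightarrow> h k \<in> qpow_harmonics B d k" by blast
    have "f = (\<lambda>v. \<Sum>k | 2 * k \<le> d. h k v)" by (simp add: fun_eq_iff h(1) sum_fun_apply)
    then show "f \<in> hom_polys d"
      using h(2) qpow_harmonics_hom_polys hom_polys_sum[of "{k. 2 * k \<le> d}" h d] by auto
  qed
  fix h k
  assume h: "(\<forall>k\<in>{k. 2 * k \<le> d}. h k \<in> qpow_harmonics B d k) \<and> (\<Sum>k | 2 * k \<le> d. h k) = 0"
    and k: "k \<in> {k. 2 * k \<le> d}"
  have "\<forall>k. \<exists>g. 2 * k \<le> d \<longrightarrow> g \<in> harmonics B (d - 2 * k) \<and> h k = (\<lambda>v. Q v ^ k * g v)"
    using h unfolding qpow_harmonics_def by blast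
  then obtain g where g: "\<And>k. 2 * k \<le> d \<Longrightarrow> g k \<in> harmonics B (d - 2 * k)"
    "\<And>k. 2 * k \<le> d \<Longrightarrow> h k = (\<lambda>v. Q v ^ k * g k v)" by metis
  have "(\<Sum>k | 2 * k \<le> d. Q v ^ k * g k v) = 0" for v
  proof -
    have "(\<Sum>k | 2 * k \<le> d. Q v ^ k * g k v) = (\<Sum>k | 2 * k \<le> d. h k v)"
      by (rule sum.cong) (auto simp: g(2))
    also have "\<dots> = (\<Sum>k | 2 * k \<le> d. h k) v" by (simp add: sum_fun_apply)
    finally show ?thesis using h by simp
  qed
  then have "g k v = 0" for v
    using harmonic_decomposition_unique[of d g k v] g(1) k by simp
  then show "h k = 0" using g(2) k by (simp add: fun_eq_iff)
qed

lemma qpow_harmonics_invariant: "invariant_under (orth_group B) (qpow_harmonics B d k)"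
  unfolding invariant_under_def
proof (intro ballI)
  fix U f assume U: "U \<in> orth_group B" and "f \<in> qpow_harmonics B d k"
  then obtain h where h: "h \<in> harmonics B (d - 2 * k)" "f = (\<lambda>v. Q v ^ k * h v)"
    unfolding qpow_harmonics_def by blast
  have U: "invertible U" "U ** B ** transpose U = B" using U by (auto simp: orth_group_def)
  have "(\<lambda>v. h (v v* U)) \<in> harmonics B (d - 2 * k)"
    using h(1) laplacian_linear_subst[OF U invertible invertible harmonics_polys[OF h(1)]]
    by (simp add: harmonics_iff hom_polys_linear_subst)
  then show "(\<lambda>v. f (v v* U)) \<in> qpow_harmonics B d k"
    unfolding qpow_harmonics_def
    by (rule rev_image_eqI) (simp add: fun_eq_iff h(2) qform_linear_subst U(2))
qed

context
  fixes A :: "complex^3^3"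
  assumes A: "invertible A" and BA: "B = A ** transpose A"
begin

lemma matrix_inv_A_normalizes: "matrix_inv A ** B ** transpose (matrix_inv A) = mat 1"
proof -
  have "matrix_inv A ** B = transpose A"
    by (simp add: BA matrix_mul_assoc matrix_inv_inverse[OF A])
  moreover have "transpose A ** transpose (matrix_inv A) = mat 1"
    by (simp add: matrix_inv_inverse[OF A] flip: matrix_transpose_mul)
  ultimately show ?thesis by simp
qed

lemma harmonics_normalize:
  assumes "h \<in> harmonics B d"
  shows "(\<lambda>w. h (w v* matrix_inv A)) \<in> harmonics (mat 1) d"
proof -
  have "invertible (matrix_inv A)"
    "invertible (mat 1 :: complex^3^3)"
    using matrix_inv_inverse[OF A] by (auto simp: invertible_def)
  then have "laplacian (mat 1) (\<lambda>w. h (w v* matrix_inv A)) v = 0" for v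
    using laplacian_linear_subst[OF _ matrix_inv_A_normalizes invertible, of h v] assms
      harmonics_polys[OF assms] by (simp add: harmonics_iff)
  then show ?thesis
    using assms by (simp add: harmonics_def hom_polys_linear_subst fun_eq_iff)
qed

text \<open>On the surface of integration \<open>Q = 1\<close>, so the powers of \<open>Q\<close> disappear and harmonics of the
  different degrees \<open>d - 2 k\<close> and \<open>d - 2 l\<close> remain.\<close>

lemma qpow_harmonics_orthogonal:
  assumes k: "2 * k \<le> d" and l: "2 * l \<le> d" and kl: "k \<noteq> l"
    and f: "f \<in> qpow_harmonics B d k" and g: "g \<in> qpow_harmonics B d l"
  shows "herm_prod A f g = 0"
proof -
  obtain h where h: "h \<in> harmonics B (d - 2 * k)" "f = (\<lambda>v. Q v ^ k * h v)"
    using f unfolding qpow_harmonics_def by blast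
  obtain h' where h': "h' \<in> harmonics B (d - 2 * l)" "g = (\<lambda>v. Q v ^ l * h' v)"
    using g unfolding qpow_harmonics_def by blast
  define U where "U = matrix_inv A"
  have p: "f \<in> polys" "g \<in> polys" "h \<in> polys" "h' \<in> polys"
    using qpow_harmonics_hom_polys[OF f k] qpow_harmonics_hom_polys[OF g l]
      harmonics_polys[OF h(1)] harmonics_polys[OF h'(1)] hom_polys_imp_polys by blast+
  have Q1: "Q (cvec x v* U) = 1" if "norm x = 1" for x
    using that
    by (simp add: U_def qform_linear_subst matrix_inv_A_normalizes qform_mat_1_cvec)
  have "herm_prod A f g = sphere_int (\<lambda>w. f (w v* U) * conj_poly (\<lambda>w. g (w v* U)) w)"
    unfolding U_def by (rule herm_prod_sphere_int[OF A p(1,2)])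
  also have "\<dots> = sphere_int (\<lambda>w. h (w v* U) * conj_poly (\<lambda>w. h' (w v* U)) w)"
  proof (rule sphere_int_cong)
    fix x :: "real^3" assume "norm x = 1"
    then show "f (cvec x v* U) * conj_poly (\<lambda>w. g (w v* U)) (cvec x)
        = h (cvec x v* U) * conj_poly (\<lambda>w. h' (w v* U)) (cvec x)"
      by (simp add: conj_poly_cvec h(2) h'(2) Q1)
  qed (intro polys_mult conj_poly_polys polys_linear_subst p)+
  also have "\<dots> = 0"
  proof (rule harmonics_orthogonal)
    show "(\<lambda>w. h (w v* U)) \<in> harmonics (mat 1) (d - 2 * k)"
      unfolding U_def by (rule harmonics_normalize[OF h(1)])
    show "conj_poly (\<lambda>w. h' (w v* U)) \<in> harmonics (mat 1) (d - 2 * l)"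
      unfolding U_def by (rule conj_poly_harmonics[OF harmonics_normalize[OF h'(1)]])
    show "d - 2 * k \<noteq> d - 2 * l" using k l kl by simp
  qed
  finally show ?thesis .
qed

lemma harmonics_orthogonal_to_higher_terms:
  assumes P: "P \<in> harmonics B d" and h: "\<And>k. 2 * k \<le> d \<Longrightarrow> h k \<in> harmonics B (d - 2 * k)"
  shows "herm_prod A P (\<lambda>v. \<Sum>k\<in>{k. 2 * k \<le> d} - {0}. Q v ^ k * h k v) = 0"
proof -
  have Pq: "P \<in> qpow_harmonics B d 0" using P by (auto simp: qpow_harmonics_def)
  have Pp: "P \<in> polys" using P by (auto simp: harmonics_iff intro: hom_polys_imp_polys)
  have q: "(\<lambda>v. Q v ^ k * h k v) \<in> qpow_harmonics B d k" if "2 * k \<le> d" for k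
    using h[OF that] by (auto simp: qpow_harmonics_def)
  then have p: "(\<lambda>v. Q v ^ k * h k v) \<in> polys" if "2 * k \<le> d" for k
    using qpow_harmonics_hom_polys that hom_polys_imp_polys by blast
  have "herm_prod A (\<lambda>v. \<Sum>k\<in>{k. 2 * k \<le> d} - {0}. Q v ^ k * h k v) P
      = (\<Sum>k\<in>{k. 2 * k \<le> d} - {0}. herm_prod A (\<lambda>v. Q v ^ k * h k v) P)"
    by (rule herm_prod_sum[OF A _ Pp]) (use p in auto)
  also have "\<dots> = 0"
    by (rule sum.neutral) (auto intro!: qpow_harmonics_orthogonal[OF _ _ _ q Pq])
  finally have zero: "herm_prod A (\<lambda>v. \<Sum>k\<in>{k. 2 * k \<le> d} - {0}. Q v ^ k * h k v) P = 0" .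
  have "(\<lambda>v. \<Sum>k\<in>{k. 2 * k \<le> d} - {0}. Q v ^ k * h k v) \<in> polys"
    using p by (intro polys_sum) auto
  from herm_prod_commute[OF A this Pp] show ?thesis unfolding zero by simp
qed

text \<open>The multiples of \<open>Q\<close> are exactly the sums of terms \<open>Q ^ k h\<^sub>k\<close> with \<open>k > 0\<close>. All of these are
  orthogonal to the harmonics. Conversely, if \<open>P\<close> is orthogonal to them, then its own part with
  \<open>k > 0\<close> is orthogonal to itself and so is zero.\<close>

lemma harmonics_iff_orthogonal:
  assumes P: "P \<in> hom_polys d"
  shows "P \<in> harmonics B d \<longleftrightarrow> (\<forall>T\<in>q_multiples B d. herm_prod A P T = 0)"
proof
  assume P: "P \<in> harmonics B d"
  show "\<forall>T\<in>q_multiples B d. herm_prod A P T = 0"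
  proof
    fix T assume T: "T \<in> q_multiples B d"
    then have Th: "T \<in> hom_polys d" and Tcone: "\<And>v. Q v = 0 \<Longrightarrow> T v = 0"
      by (auto simp: q_multiples_def)
    obtain h where h: "\<And>k. 2 * k \<le> d \<Longrightarrow> h k \<in> harmonics B (d - 2 * k)"
      "\<And>v. T v = (\<Sum>k | 2 * k \<le> d. Q v ^ k * h k v)"
      using harmonic_decomposition[OF Th] by blast
    have split: "T v = h 0 v + (\<Sum>k\<in>{k. 2 * k \<le> d} - {0}. Q v ^ k * h k v)" for v
      unfolding h(2) by (subst sum.remove[of _ 0]) (auto simp: finite_halves)
    \<comment> \<open>On the isotropic cone \<open>T\<close> and all terms with \<open>k > 0\<close> vanish, hence so does the harmonic \<open>h 0\<close>.\<close>
    have "h 0 v = 0" if "Q v = 0" for v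
      using split[of v] Tcone[OF that] that by (simp add: sum.neutral)
    then have "h 0 v = 0" for v
      using harmonic_vanishing_on_cone[of "h 0" d v] h(1)[of 0] by simp
    then have "T = (\<lambda>v. \<Sum>k\<in>{k. 2 * k \<le> d} - {0}. Q v ^ k * h k v)"
      using split by auto
    then show "herm_prod A P T = 0"
      using harmonics_orthogonal_to_higher_terms[OF P h(1)] by simp
  qed
next
  assume orth: "\<forall>T\<in>q_multiples B d. herm_prod A P T = 0"
  obtain h where h: "\<And>k. 2 * k \<le> d \<Longrightarrow> h k \<in> harmonics B (d - 2 * k)"
    "\<And>v. P v = (\<Sum>k | 2 * k \<le> d. Q v ^ k * h k v)"
    using harmonic_decomposition[OF P] by blast
  define T where "T v = (\<Sum>k\<in>{k. 2 * k \<le> d} - {0}. Q v ^ k * h k v)" for v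
  have split: "P v = h 0 v + T v" for v
    unfolding h(2) T_def by (subst sum.remove[of _ 0]) (auto simp: finite_halves)
  have h0: "h 0 \<in> harmonics B d" using h(1)[of 0] by simp
  have "T = (\<lambda>v. P v - h 0 v)" using split by auto
  then have Th: "T \<in> hom_polys d" using P h0 by (auto simp: harmonics_iff intro: hom_polys_diff)
  have p: "h 0 \<in> polys" "T \<in> polys"
    using Th h0 by (auto simp: harmonics_iff intro: hom_polys_imp_polys)
  have "T v = Q v * (\<Sum>k\<in>{k. 2 * k \<le> d} - {0}. Q v ^ (k - 1) * h k v)" for v
    unfolding T_def sum_distrib_left
    by (intro sum.cong refl) (auto simp: power_eq_if)
  moreover have "(\<lambda>v. \<Sum>k\<in>{k. 2 * k \<le> d} - {0}. Q v ^ (k - 1) * h k v) \<in> polys"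
    using h(1) by (intro polys_sum polys_mult polys_power qform_polys)
      (auto simp: harmonics_iff intro: hom_polys_imp_polys)
  ultimately have "T \<in> q_multiples B d" using Th by (auto simp: q_multiples_def)
  then have "herm_prod A P T = 0" using orth by blast
  moreover have "herm_prod A P T = herm_prod A (h 0) T + herm_prod A T T"
    using herm_prod_add[OF A p p(2)] split by (metis (no_types, lifting) ext)
  moreover have "herm_prod A (h 0) T = 0"
    using harmonics_orthogonal_to_higher_terms[OF h0 h(1)] by (simp add: T_def[abs_def])
  ultimately have "herm_prod A T T = 0" by simp
  then have "T = 0" using herm_prod_positive[OF A Th] by fastforce
  then have "P = h 0" using split by (auto simp: fun_eq_iff)
  then show "P \<in> harmonics B d" using h0 by simp
qed

end

text \<open>The Dirichlet problem for \<open>lap P = 0\<close> with a polynomial extension of \<open>F\<close> as boundary data.\<close>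

lemma harmonic_extension:
  assumes "poly_function_on (level_set B c) F"
  shows "\<exists>P\<in>polys. lap P = 0 \<and> (\<forall>v\<in>level_set B c. P v = F v)"
proof -
  obtain G where G: "G \<in> polys" "\<And>v. v \<in> level_set B c \<Longrightarrow> F v = G v"
    using assms by (auto simp: poly_function_on_def)
  obtain P where "P \<in> polys" "lap P = (\<lambda>v. 0)" "\<forall>v\<in>level_set B c. P v = G v"
    using dirichlet_problem[OF polys_const G(1)] by blast
  then show ?thesis using G(2) by (auto simp: zero_fun_def intro!: bexI[of _ P])
qed

end

theorem theorem12:
  fixes B :: "complex^3^3"
  assumes "transpose B = B" and "invertible B"
  shows
    \<comment> \<open>(1)\<close>
    "(\<forall>d.
        internal_direct_sum {k. 2 * k \<le> d} (qpow_harmonics B d) (hom_polys d) \<and>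
        (\<forall>k. 2 * k \<le> d \<longrightarrow> invariant_under (orth_group B) (qpow_harmonics B d k)) \<and>
        (\<forall>A. invertible A \<and> B = A ** transpose A \<longrightarrow>
           hermitian_inner_product_on (hom_polys d) (herm_prod A) \<and>
           (\<forall>k l. 2 * k \<le> d \<and> 2 * l \<le> d \<and> k \<noteq> l \<longrightarrow>
              (\<forall>f\<in>qpow_harmonics B d k. \<forall>g\<in>qpow_harmonics B d l. herm_prod A f g = 0)) \<and>
           (\<forall>P\<in>hom_polys d.
              P \<in> harmonics B d \<longleftrightarrow> (\<forall>T\<in>q_multiples B d. herm_prod A P T = 0))))
    \<and>
    \<comment> \<open>(2)\<close>
     (\<forall>c F. poly_function_on (level_set B c) F \<longrightarrow>
        (\<exists>P\<in>polys. laplacian B P = 0 \<and> (\<forall>v\<in>level_set B c. P v = F v)))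
    \<and>
    \<comment> \<open>(3)\<close>
     (\<forall>c. \<forall>M\<in>polys. \<forall>N\<in>polys.
        \<exists>!P. P \<in> polys \<and> laplacian B P = M \<and> (\<forall>v\<in>level_set B c. P v = N v))
    \<and>
    \<comment> \<open>(4)\<close>
     (\<forall>d. \<forall>P\<in>hom_polys d.
        \<exists>(u :: nat \<Rightarrow> nat \<Rightarrow> complex^3) (lam :: complex).
          \<forall>W s. sqrt_branch B W s \<longrightarrow>
            (\<forall>v\<in>W. P v =
               (\<Sum>k | 2 * k \<le> d.
                  if 2 * k = d then lam * qform B v ^ k
                  else s v ^ (2 * (d - k) + 1)
                       * iter_dir_deriv (\<lambda>j. u j k) (d - 2 * k) (\<lambda>w. 1 / s w) v)))"
proof -
  interpret nondegenerate_form B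
    using assms by unfold_locales
  show ?thesis
    using harmonic_direct_sum qpow_harmonics_invariant herm_prod_is_hermitian_inner_product
      qpow_harmonics_orthogonal harmonics_iff_orthogonal harmonic_extension dirichlet_problem
      maxwell_representation
    by (intro conjI allI ballI impI) auto
qed

end
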